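(* Let $G$ be a connected unimodular Lie group, let $\mathcal{G}$ be a left-invariant (Riemannian) metric tensor field on $G$, and let $\nu\in\mathbb{R}$. Then the Lie-Cartan Laplacian $\Delta_{\mathcal{G},\nu}$ and the Laplace-Beltrami operator $\Delta_{\mathcal{G}}$ coincide: with respect to a left-invariant frame $\{\mathcal{A}_i\}_i$, with $g^{ij}$ the components of the dual metric $\mathcal{G}^{-1}$ in this frame, $$\Delta_{\mathcal{G},\nu} = g^{ij}\mathcal{A}_i\mathcal{A}_j = \Delta_{\mathcal{G}}$$ as operators on smooth functions on $G$ (summing over repeated indices).
   Context: The Einstein summation convention is used throughout. A left-invariant frame $\{\mathcal{A}_i\}_i$ on a Lie group $G$ is a basis of the space of left-invariant vector fields $\mathfrak{X}(G)$. For a left-invariant metric tensor field $\mathcal{G}$, the components $g_{ij} = \mathcal{G}(\mathcal{A}_i,\mathcal{A}_j)$ are constants and $(g^{ij})$ is the inverse matrix of $(g_{ij})$. The gradient of a smooth function $U$ is $\nabla_{\mathcal{G}} U = g^{ij}(\mathcal{A}_i U)\mathcal{A}_j$. Generalised Laplacian: for a Riemannian manifold $(M,\mathcal{G})$ and an affine connection $\nabla$ on $M$, define the divergence of a smooth vector field $X$ by $\mathrm{div}_\nabla(X) = \mathrm{trace}(\nabla_{\cdot}X)$, i.e. the pointwise trace of the endomorphism $Z \mapsto \nabla_Z X$, and define $\Delta_{\mathcal{G},\nabla} U = \mathrm{div}_\nabla(\nabla_{\mathcal{G}} U)$. The Laplace-Beltrami operator is $\Delta_{\mathcal{G}} = \mathrm{div}_{\mathcal{G}}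 \circ \nabla_{\mathcal{G}}$, with $\mathrm{div}_{\mathcal{G}}$ the Riemannian divergence, which equals $\mathrm{div}_{\nabla^{\mathrm{LC}}}$ for the Levi-Civita connection $\nabla^{\mathrm{LC}}$ of $\mathcal{G}$. Lie-Cartan connection: for $\nu\in\mathbb{R}$, the $\nu$ Lie-Cartan connection $\nabla^{[\nu]}$ on $G$ is the affine connection such that $\nabla^{[\nu]}_X Y = \nu[X,Y]$ for all left-invariant vector fields $X,Y \in \mathfrak{X}(G)$. The Lie-Cartan Laplacian is $\Delta_{\mathcal{G},\nu} = \Delta_{\mathcal{G},\nabla^{[\nu]}}$. *)

theory Defs
  imports "HOL-Analysis.Analysis" "HOL-Library.Function_Algebras"
begin

section \<open>Pointwise real vector space structure on functions\<close>

instantiation "fun" :: (type, real_vector) real_vector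
begin

definition scaleR_fun :: "real \<Rightarrow> ('a \<Rightarrow> 'b) \<Rightarrow> 'a \<Rightarrow> 'b"
  where "scaleR_fun c f = (\<lambda>x. c *\<^sub>R f x)"

instance
  by standard (auto simp: scaleR_fun_def plus_fun_def fun_eq_iff scaleR_add_left scaleR_add_right)

end

lemma scaleR_fun_apply: "(c *\<^sub>R f) x = c *\<^sub>R f x"
  by (simp add: scaleR_fun_def)

lemma sum_fun_apply: "(\<Sum>i\<in>I. f i) x = (\<Sum>i\<in>I. f i x)"
  by (induction I rule: infinite_finite_induct) auto


section \<open>Smooth manifolds\<close>

text \<open>Smoothness of maps between real vector spaces is only used for finite-dimensional domains,
  where it is enough to iterate directional derivatives, and on open sets \<open>S\<close>.\<close>

primrec higher_differentiable_on ::
  "'a::real_normed_vector set \<Rightarrow> ('a \<Rightarrow> 'b::real_normed_vector) \<Rightarrow> nat \<Rightarrow> bool"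
where
  "higher_differentiable_on S f 0 \<longleftrightarrow> continuous_on S f"
| "higher_differentiable_on S f (Suc n) \<longleftrightarrow>
     (\<forall>x\<in>S. f differentiable (at x)) \<and>
     (\<forall>v. higher_differentiable_on S (\<lambda>x. frechet_derivative f (at x) v) n)"

definition smooth_on ::
  "'a::real_normed_vector set \<Rightarrow> ('a \<Rightarrow> 'b::real_normed_vector) \<Rightarrow> bool"
  where "smooth_on S f \<longleftrightarrow> (\<forall>n. higher_differentiable_on S f n)"

text \<open>A chart is a pair \<open>(U, \<phi>)\<close> of its domain and its coordinate map; its inverse is
  \<open>inv_into U \<phi>\<close>.\<close>

type_synonym ('a, 'e) chart = "'a set \<times> ('a \<Rightarrow> 'e)"

text \<open>The model space is a finite-dimensional inner product space rather than a
  \<open>euclidean_space\<close>, because the latter class excludes dimension zero. The atlas need not be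
  maximal.\<close>

locale smooth_manifold =
  fixes M :: "('a::{t2_space, second_countable_topology}, 'e::real_inner) chart set"
  assumes finite_dimensional: "\<exists>B::'e set. finite B \<and> span B = UNIV"
    and chart: "(U, \<phi>) \<in> M \<Longrightarrow>
      open U \<and> open (\<phi> ` U) \<and> homeomorphism U (\<phi> ` U) \<phi> (inv_into U \<phi>)"
    and cover: "(\<Union>(U, \<phi>)\<in>M. U) = UNIV"
    and compatible: "(U, \<phi>) \<in> M \<Longrightarrow> (V, \<psi>) \<in> M \<Longrightarrow>
      smooth_on (\<phi> ` (U \<inter> V)) (\<lambda>x. \<psi> (inv_into U \<phi> x))"

definition smooth_map ::
  "('a::topological_space, 'e::real_normed_vector) chart set \<Rightarrow>
   ('b::topological_space, 'f::real_normed_vector) chart set \<Rightarrow> ('a \<Rightarrow> 'b) \<Rightarrow> bool"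
  where "smooth_map M N f \<longleftrightarrow> continuous_on UNIV f \<and>
    (\<forall>(U, \<phi>)\<in>M. \<forall>(V, \<psi>)\<in>N. smooth_on (\<phi> ` (U \<inter> f -` V)) (\<lambda>x. \<psi> (f (inv_into U \<phi> x))))"

definition product_atlas ::
  "('a, 'e) chart set \<Rightarrow> ('b, 'f) chart set \<Rightarrow> ('a \<times> 'b, 'e \<times> 'f) chart set"
  where "product_atlas M N = {(U \<times> V, map_prod \<phi> \<psi>) | U \<phi> V \<psi>. (U, \<phi>) \<in> M \<and> (V, \<psi>) \<in> N}"

definition smooth_functions ::
  "('a, 'e::real_normed_vector) chart set \<Rightarrow> ('a \<Rightarrow> real) set"
  where "smooth_functions M = {f. \<forall>(U, \<phi>)\<in>M. smooth_on (\<phi> ` U) (\<lambda>x. f (inv_into U \<phi> x))}"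


section \<open>Tangent vectors and vector fields\<close>

text \<open>Tangent vectors at \<open>p\<close> are the derivations at \<open>p\<close> of the algebra of smooth functions. As
  HOL functions are total, they are set to zero on functions that are not smooth, so that equality
  of tangent vectors is equality of derivations.\<close>

type_synonym 'a tangent = "('a \<Rightarrow> real) \<Rightarrow> real"
type_synonym 'a vfield = "'a \<Rightarrow> 'a tangent"

definition tangent_space ::
  "('a, 'e::real_normed_vector) chart set \<Rightarrow> 'a \<Rightarrow> 'a tangent set"
  where "tangent_space M p = {v.
    (\<forall>f\<in>smooth_functions M. \<forall>h\<in>smooth_functions M. \<forall>a b.
       v (\<lambda>x. a * f x + b * h x) = a * v f + b * v h) \<and>
    (\<forall>f\<in>smooth_functions M. \<forall>h\<in>smooth_functions M.
       v (\<lambda>x. f x * h x) = f p * v h + h p * v f) \<and>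
    (\<forall>f. f \<notin> smooth_functions M \<longrightarrow> v f = 0)}"

definition vf_apply :: "'a vfield \<Rightarrow> ('a \<Rightarrow> real) \<Rightarrow> 'a \<Rightarrow> real"  (infixr "\<triangleright>" 75)
  where "X \<triangleright> f = (\<lambda>p. X p f)"

definition vf_scale :: "('a \<Rightarrow> real) \<Rightarrow> 'a vfield \<Rightarrow> 'a vfield"  (infixr "\<odot>" 75)
  where "f \<odot> X = (\<lambda>p. f p *\<^sub>R X p)"

definition vector_fields :: "('a, 'e::real_normed_vector) chart set \<Rightarrow> 'a vfield set"
  where "vector_fields M = {X. (\<forall>p. X p \<in> tangent_space M p) \<and>
    (\<forall>f\<in>smooth_functions M. X \<triangleright> f \<in> smooth_functions M)}"

definition lie_bracket :: "'a vfield \<Rightarrow> 'a vfield \<Rightarrow> 'a vfield"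
  where "lie_bracket X Y = (\<lambda>p f. X p (Y \<triangleright> f) - Y p (X \<triangleright> f))"

definition differential ::
  "('a, 'e::real_normed_vector) chart set \<Rightarrow> ('a \<Rightarrow> 'a) \<Rightarrow> 'a tangent \<Rightarrow> 'a tangent"
  where "differential M F v = (\<lambda>f. if f \<in> smooth_functions M then v (\<lambda>x. f (F x)) else 0)"


section \<open>Affine connections, Riemannian metrics and generalised Laplacians\<close>

text \<open>A connection is a map on pairs of vector fields; the last clause fixes its value elsewhere,
  so that equality of connections is equality of HOL functions.\<close>

definition affine_connection ::
  "('a, 'e::real_normed_vector) chart set \<Rightarrow> ('a vfield \<Rightarrow> 'a vfield \<Rightarrow> 'a vfield) \<Rightarrow> bool"
  where "affine_connection M \<D> \<longleftrightarrow>
    (\<forall>X\<in>vector_fields M. \<forall>Y\<in>vector_fields M. \<D> X Y \<in> vector_fields M) \<and>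
    (\<forall>X\<in>vector_fields M. \<forall>X'\<in>vector_fields M. \<forall>Y\<in>vector_fields M.
       \<D> (X + X') Y = \<D> X Y + \<D> X' Y) \<and>
    (\<forall>f\<in>smooth_functions M. \<forall>X\<in>vector_fields M. \<forall>Y\<in>vector_fields M.
       \<D> (f \<odot> X) Y = f \<odot> \<D> X Y) \<and>
    (\<forall>X\<in>vector_fields M. \<forall>Y\<in>vector_fields M. \<forall>Y'\<in>vector_fields M.
       \<D> X (Y + Y') = \<D> X Y + \<D> X Y') \<and>
    (\<forall>f\<in>smooth_functions M. \<forall>X\<in>vector_fields M. \<forall>Y\<in>vector_fields M.
       \<D> X (f \<odot> Y) = (X \<triangleright> f) \<odot> Y + f \<odot> \<D> X Y) \<and>
    (\<forall>X Y. X \<notin> vector_fields M \<or> Y \<notin> vector_fields M \<longrightarrow> \<D> X Y = 0)"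

definition riemannian_metric ::
  "('a, 'e::real_normed_vector) chart set \<Rightarrow> ('a \<Rightarrow> 'a tangent \<Rightarrow> 'a tangent \<Rightarrow> real) \<Rightarrow> bool"
  where "riemannian_metric M g \<longleftrightarrow>
    (\<forall>p. \<forall>u\<in>tangent_space M p. \<forall>v\<in>tangent_space M p. g p u v = g p v u) \<and>
    (\<forall>p. \<forall>u\<in>tangent_space M p. \<forall>v\<in>tangent_space M p. \<forall>w\<in>tangent_space M p. \<forall>a b.
       g p (a *\<^sub>R u + b *\<^sub>R v) w = a * g p u w + b * g p v w) \<and>
    (\<forall>p. \<forall>v\<in>tangent_space M p. v \<noteq> 0 \<longrightarrow> g p v v > 0) \<and>
    (\<forall>X\<in>vector_fields M. \<forall>Y\<in>vector_fields M. (\<lambda>p. g p (X p) (Y p)) \<in> smooth_functions M)"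

text \<open>The trace of an endomorphism \<open>L\<close> of a finite-dimensional subspace \<open>V\<close>.\<close>

definition trace_on :: "'v::real_vector set \<Rightarrow> ('v \<Rightarrow> 'v) \<Rightarrow> real"
  where "trace_on V L =
    (let B = (SOME B. B \<subseteq> V \<and> independent B \<and> V \<subseteq> span B)
     in \<Sum>b\<in>B. representation B (L b) b)"

text \<open>\<open>(\<D>\<^bsub>v\<^esub> X)(p)\<close> for \<open>v\<close> in the tangent space at \<open>p\<close>: by tensoriality in the first argument it may
  be computed with any vector field extending \<open>v\<close>.\<close>

definition covariant_derivative_at ::
  "('a, 'e::real_normed_vector) chart set \<Rightarrow> ('a vfield \<Rightarrow> 'a vfield \<Rightarrow> 'a vfield) \<Rightarrow>
   'a vfield \<Rightarrow> 'a \<Rightarrow> 'a tangent \<Rightarrow> 'a tangent"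
  where "covariant_derivative_at M \<D> X p v =
    \<D> (SOME Z. Z \<in> vector_fields M \<and> Z p = v) X p"

definition divergence ::
  "('a, 'e::real_normed_vector) chart set \<Rightarrow> ('a vfield \<Rightarrow> 'a vfield \<Rightarrow> 'a vfield) \<Rightarrow>
   'a vfield \<Rightarrow> 'a \<Rightarrow> real"
  where "divergence M \<D> X =
    (\<lambda>p. trace_on (tangent_space M p) (covariant_derivative_at M \<D> X p))"

definition gradient ::
  "('a, 'e::real_normed_vector) chart set \<Rightarrow> ('a \<Rightarrow> 'a tangent \<Rightarrow> 'a tangent \<Rightarrow> real) \<Rightarrow>
   ('a \<Rightarrow> real) \<Rightarrow> 'a vfield"
  where "gradient M g f =
    (\<lambda>p. THE v. v \<in> tangent_space M p \<and> (\<forall>w\<in>tangent_space M p. g p v w = w f))"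

definition inverse_matrix_on :: "'i set \<Rightarrow> ('i \<Rightarrow> 'i \<Rightarrow> real) \<Rightarrow> ('i \<Rightarrow> 'i \<Rightarrow> real) \<Rightarrow> bool"
  where "inverse_matrix_on I m n \<longleftrightarrow> (\<forall>i\<in>I. \<forall>k\<in>I.
    (\<Sum>j\<in>I. m i j * n j k) = (if i = k then 1 else 0) \<and>
    (\<Sum>j\<in>I. n i j * m j k) = (if i = k then 1 else 0))"

text \<open>In a frame, the gradient is given by the usual formula \<open>g\<^sup>i\<^sup>j (b\<^sub>i f) b\<^sub>j\<close>.\<close>

lemma gradient_in_frame:
  fixes b :: "'i \<Rightarrow> 'a tangent"
  assumes g: "riemannian_metric M g"
    and fin: "finite I" and spn: "span (b ` I) = tangent_space M p"
    and inv: "inverse_matrix_on I (\<lambda>i j. g p (b i) (b j)) ginv"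
  shows "gradient M g f p = (\<Sum>i\<in>I. \<Sum>j\<in>I. (ginv i j * b i f) *\<^sub>R b j)"
proof -
  let ?T = "tangent_space M p"
  let ?v = "\<Sum>i\<in>I. \<Sum>j\<in>I. (ginv i j * b i f) *\<^sub>R b j"
  have T: "subspace ?T" using spn by (metis subspace_span)
  have bT: "b i \<in> ?T" if "i \<in> I" for i using spn that by (metis imageI span_base)
  have lin: "g p (x *\<^sub>R u + y *\<^sub>R v) w = x * g p u w + y * g p v w"
    if "u \<in> ?T" "v \<in> ?T" "w \<in> ?T" for u v w x y
    using g that by (auto simp: riemannian_metric_def)
  have sym: "g p u v = g p v u" if "u \<in> ?T" "v \<in> ?T" for u v
    using g that by (auto simp: riemannian_metric_def)
  have pos: "v = 0" if "v \<in> ?T" "g p v v = 0" for v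
    using g that by (fastforce simp: riemannian_metric_def)
  have zero: "g p 0 w = 0" if "w \<in> ?T" for w
    using lin[of 0 0 w 0 0] that T by (simp add: subspace_0)
  have add: "g p (u + v) w = g p u w + g p v w" if "u \<in> ?T" "v \<in> ?T" "w \<in> ?T" for u v w
    using lin[of u v w 1 1] that by simp
  have scale: "g p (x *\<^sub>R u) w = x * g p u w" if "u \<in> ?T" "w \<in> ?T" for u w x
    using lin[of u u w x 0] that by simp
  have sm: "g p (\<Sum>k\<in>K. h k) w = (\<Sum>k\<in>K. g p (h k) w)"
    if "finite K" "\<And>k. k \<in> K \<Longrightarrow> h k \<in> ?T" "w \<in> ?T" for K :: "'i set" and h w
    using that by (induction K) (auto simp: zero add subspace_sum[OF T])
  have rowT: "(\<Sum>j\<in>I. (ginv i j * b i f) *\<^sub>R b j) \<in> ?T" for i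
    by (intro subspace_sum[OF T] subspace_scale[OF T] bT)
  have vT: "?v \<in> ?T" by (intro subspace_sum[OF T] rowT)
  have row: "g p (\<Sum>j\<in>I. (ginv i j * b i f) *\<^sub>R b j) (b k) = b i f * (if i = k then 1 else 0)"
    if "i \<in> I" "k \<in> I" for i k
  proof -
    have "g p (\<Sum>j\<in>I. (ginv i j * b i f) *\<^sub>R b j) (b k)
        = (\<Sum>j\<in>I. b i f * (ginv i j * g p (b j) (b k)))"
      using that by (subst sm) (auto simp: fin bT scale subspace_scale[OF T] mult_ac intro!: sum.cong)
    also have "\<dots> = b i f * (\<Sum>j\<in>I. ginv i j * g p (b j) (b k))"
      by (simp add: sum_distrib_left)
    finally show ?thesis using inv that by (simp add: inverse_matrix_on_def)
  qed
  have basis: "g p ?v (b k) = b k f" if "k \<in> I" for k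
  proof -
    have "g p ?v (b k) = (\<Sum>i\<in>I. b i f * (if i = k then 1 else 0))"
      using that by (subst sm) (auto simp: fin rowT bT row intro!: sum.cong)
    then show ?thesis using that fin by (simp add: if_distrib sum.delta cong: if_cong)
  qed
  have all: "g p ?v w = w f" if "w \<in> ?T" for w
  proof -
    have "w \<in> span (b ` I)" using that spn by simp
    then have "w \<in> ?T \<and> g p w ?v = w f"
    proof (induction rule: span_induct_alt)
      case base
      have "0 f = (0::real)" by simp
      then show ?case using zero[OF vT] subspace_0[OF T] by metis
    next
      case (step c x y)
      then obtain k where k: "k \<in> I" "x = b k" by auto
      have "g p x ?v = x f" using basis[OF k(1)] sym[OF vT bT[OF k(1)]] k(2) by simp
      have xT: "x \<in> ?T" using bT[OF k(1)] k(2) by blast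
      have yT: "y \<in> ?T" and y: "g p y ?v = y f" using step by blast+
      have "c *\<^sub>R x + y \<in> ?T"
        by (intro subspace_add[OF T] subspace_scale[OF T] xT yT)
      moreover have "g p (c *\<^sub>R x + y) ?v = c * g p x ?v + g p y ?v"
        using lin[OF xT yT vT, of c 1] by (simp only: scaleR_one mult_1)
      then have "g p (c *\<^sub>R x + y) ?v = (c *\<^sub>R x + y) f"
        using \<open>g p x ?v = x f\<close> y by (simp only: plus_fun_apply scaleR_fun_apply real_scaleR_def)
      ultimately show ?case by blast
    qed
    then show ?thesis using sym[OF vT that] by simp
  qed
  have uniq: "v = ?v" if "v \<in> ?T" "\<forall>w\<in>?T. g p v w = w f" for v
  proof -
    let ?d = "1 *\<^sub>R v + (-1) *\<^sub>R ?v"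
    have dT: "?d \<in> ?T"
      by (intro subspace_add[OF T] subspace_scale[OF T] that vT)
    have "g p ?d ?d = 0"
      using lin[OF that(1) vT dT, of 1 "-1"] all[OF dT] that(2) dT by simp
    from pos[OF dT this] show ?thesis by simp
  qed
  show ?thesis unfolding gradient_def using vT all uniq by (intro the_equality) blast+
qed

definition generalised_laplacian ::
  "('a, 'e::real_normed_vector) chart set \<Rightarrow> ('a \<Rightarrow> 'a tangent \<Rightarrow> 'a tangent \<Rightarrow> real) \<Rightarrow>
   ('a vfield \<Rightarrow> 'a vfield \<Rightarrow> 'a vfield) \<Rightarrow> ('a \<Rightarrow> real) \<Rightarrow> 'a \<Rightarrow> real"
  where "generalised_laplacian M g \<D> f = divergence M \<D> (gradient M g f)"

definition levi_civita ::
  "('a, 'e::real_normed_vector) chart set \<Rightarrow> ('a \<Rightarrow> 'a tangent \<Rightarrow> 'a tangent \<Rightarrow> real) \<Rightarrow>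
   'a vfield \<Rightarrow> 'a vfield \<Rightarrow> 'a vfield"
  where "levi_civita M g = (THE \<D>. affine_connection M \<D> \<and>
    (\<forall>X\<in>vector_fields M. \<forall>Y\<in>vector_fields M. \<D> X Y - \<D> Y X = lie_bracket X Y) \<and>
    (\<forall>X\<in>vector_fields M. \<forall>Y\<in>vector_fields M. \<forall>Z\<in>vector_fields M. \<forall>p.
       X p (\<lambda>q. g q (Y q) (Z q)) = g p (\<D> X Y p) (Z p) + g p (Y p) (\<D> X Z p)))"

definition laplace_beltrami ::
  "('a, 'e::real_normed_vector) chart set \<Rightarrow> ('a \<Rightarrow> 'a tangent \<Rightarrow> 'a tangent \<Rightarrow> real) \<Rightarrow>
   ('a \<Rightarrow> real) \<Rightarrow> 'a \<Rightarrow> real"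
  where "laplace_beltrami M g = generalised_laplacian M g (levi_civita M g)"


section \<open>Lie groups\<close>

locale lie_group = smooth_manifold M + group mul e iv
  for M :: "('a::{t2_space, second_countable_topology}, 'e::real_inner) chart set"
    and mul :: "'a \<Rightarrow> 'a \<Rightarrow> 'a" and e :: 'a and iv :: "'a \<Rightarrow> 'a" +
  assumes smooth_mul: "smooth_map (product_atlas M M) M (\<lambda>(x, y). mul x y)"
    and smooth_iv: "smooth_map M M iv"

definition left_invariant_fields ::
  "('a, 'e::real_normed_vector) chart set \<Rightarrow> ('a \<Rightarrow> 'a \<Rightarrow> 'a) \<Rightarrow> 'a vfield set"
  where "left_invariant_fields M mul =
    {X \<in> vector_fields M. \<forall>h p. X (mul h p) = differential M (mul h) (X p)}"

definition left_invariant_frame ::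
  "('a, 'e::real_normed_vector) chart set \<Rightarrow> ('a \<Rightarrow> 'a \<Rightarrow> 'a) \<Rightarrow> 'i set \<Rightarrow> ('i \<Rightarrow> 'a vfield) \<Rightarrow> bool"
  where "left_invariant_frame M mul I A \<longleftrightarrow> finite I \<and> inj_on A I \<and> independent (A ` I) \<and>
    span (A ` I) = left_invariant_fields M mul"

definition left_invariant_metric ::
  "('a, 'e::real_normed_vector) chart set \<Rightarrow> ('a \<Rightarrow> 'a \<Rightarrow> 'a) \<Rightarrow>
   ('a \<Rightarrow> 'a tangent \<Rightarrow> 'a tangent \<Rightarrow> real) \<Rightarrow> bool"
  where "left_invariant_metric M mul g \<longleftrightarrow> riemannian_metric M g \<and>
    (\<forall>h p. \<forall>v\<in>tangent_space M p. \<forall>w\<in>tangent_space M p.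
       g (mul h p) (differential M (mul h) v) (differential M (mul h) w) = g p v w)"

text \<open>On a second countable locally compact Hausdorff space, a Borel measure that is finite on
  compact sets is automatically regular.\<close>

definition left_haar_measure :: "('a::topological_space \<Rightarrow> 'a \<Rightarrow> 'a) \<Rightarrow> 'a measure \<Rightarrow> bool"
  where "left_haar_measure mul \<mu> \<longleftrightarrow> sets \<mu> = sets borel \<and> emeasure \<mu> UNIV \<noteq> 0 \<and>
    (\<forall>K. compact K \<longrightarrow> emeasure \<mu> K < \<infinity>) \<and>
    (\<forall>h. distr \<mu> borel (\<lambda>x. mul h x) = \<mu>)"

text \<open>Left Haar measures exist and are unique up to scaling, so it does not matter which one is
  required to be right-invariant.\<close>

definition unimodular :: "('a::topological_space \<Rightarrow> 'a \<Rightarrow> 'a) \<Rightarrow> bool"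
  where "unimodular mul \<longleftrightarrow>
    (\<exists>\<mu>. left_haar_measure mul \<mu> \<and> (\<forall>h. distr \<mu> borel (\<lambda>x. mul x h) = \<mu>))"

definition lie_cartan_connection ::
  "('a, 'e::real_normed_vector) chart set \<Rightarrow> ('a \<Rightarrow> 'a \<Rightarrow> 'a) \<Rightarrow> real \<Rightarrow>
   'a vfield \<Rightarrow> 'a vfield \<Rightarrow> 'a vfield"
  where "lie_cartan_connection M mul \<nu> = (THE \<D>. affine_connection M \<D> \<and>
    (\<forall>X\<in>left_invariant_fields M mul. \<forall>Y\<in>left_invariant_fields M mul.
       \<D> X Y = \<nu> *\<^sub>R lie_bracket X Y))"

definition lie_cartan_laplacian ::
  "('a, 'e::real_normed_vector) chart set \<Rightarrow> ('a \<Rightarrow> 'a \<Rightarrow> 'a) \<Rightarrow>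
   ('a \<Rightarrow> 'a tangent \<Rightarrow> 'a tangent \<Rightarrow> real) \<Rightarrow> real \<Rightarrow> ('a \<Rightarrow> real) \<Rightarrow> 'a \<Rightarrow> real"
  where "lie_cartan_laplacian M mul g \<nu> =
    generalised_laplacian M g (lie_cartan_connection M mul \<nu>)"

text \<open>For a left-invariant metric and left-invariant fields the components \<open>g(A\<^sub>i, A\<^sub>j)\<close> are
  constant; they are evaluated at the point \<open>e\<close>.\<close>

definition metric_components ::
  "('a \<Rightarrow> 'a tangent \<Rightarrow> 'a tangent \<Rightarrow> real) \<Rightarrow> ('i \<Rightarrow> 'a vfield) \<Rightarrow> 'a \<Rightarrow> 'i \<Rightarrow> 'i \<Rightarrow> real"
  where "metric_components g A e = (\<lambda>i j. g e (A i e) (A j e))"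

end

theory Submission
  imports Defs
begin

text \<open>
  Let \<open>A\<^sub>1, \<dots>, A\<^sub>n\<close> be a left-invariant frame. It is a basis of every tangent space, so an affine
  connection \<open>\<D>\<close> is determined by the fields \<open>\<D> A\<^sub>i A\<^sub>j\<close> and can be prescribed freely on them. Expanding
  the gradient in the frame, the Leibniz rule gives for the generalised Laplacian of a function \<open>U\<close>
  the sum of \<open>g\<^sup>i\<^sup>j A\<^sub>i A\<^sub>j U\<close> and of first order terms whose coefficients are the divergences of the
  \<open>A\<^sub>j\<close>, that is, the traces of \<open>Z \<mapsto> \<D> Z A\<^sub>j\<close> (\<open>generalised_laplacian_in_frame\<close>). For the Lie-Cartan
  connection this trace is \<open>\<nu>\<close> times the trace of \<open>Z \<mapsto> [Z, A\<^sub>j]\<close>. For the Levi-Civita connection,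
  \<open>\<nabla> Z A\<^sub>j = \<nabla> A\<^sub>j Z + [Z, A\<^sub>j]\<close>, where \<open>Z \<mapsto> \<nabla> A\<^sub>j Z\<close> is skew on left-invariant fields because the
  \<open>g(A\<^sub>k, A\<^sub>l)\<close> are constant, so the divergence is the same bracket trace. Both Laplacians are therefore
  \<open>g\<^sup>i\<^sup>j A\<^sub>i A\<^sub>j\<close> as soon as the bracket trace \<open>ad_trace\<close> vanishes.

  That a unimodular group has vanishing bracket traces is \<open>ad_trace_eq_0\<close>. It is proved by integration
  by parts against the bi-invariant measure. Left-invariant fields differentiate along right
  translations, so \<open>\<integral> A\<^sub>i f = 0\<close> for every compactly supported smooth \<open>f\<close>; symmetrically \<open>\<integral> Y f = 0\<close> for
  right-invariant \<open>Y\<close> (\<open>integral_left_field_eq_0\<close>, applied to the group and to its opposite). Write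
  \<open>Y = \<Sum> a\<^sub>i A\<^sub>i\<close>. Then \<open>\<integral> f \<Sum> A\<^sub>i a\<^sub>i = \<integral> \<Sum> A\<^sub>i (a\<^sub>i f) - \<integral> Y f = 0\<close> for all \<open>f\<close>, hence \<open>\<Sum> A\<^sub>i a\<^sub>i = 0\<close>
  (\<open>right_field_divergence_free\<close>). On the other hand left- and right-invariant fields commute
  (\<open>left_right_commute\<close>), and the frame components of \<open>[A\<^sub>i, Y] = 0\<close> turn \<open>\<Sum> A\<^sub>i a\<^sub>i = 0\<close> into
  \<open>\<Sum> a\<^sub>j trace [\<cdot>, A\<^sub>j] = 0\<close>. At a given point \<open>Y\<close> can be chosen to agree with any \<open>A\<^sub>j\<close>.

  All this presupposes that left-invariant fields span every tangent space (\<open>frame_span\<close>). Tangent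
  vectors are abstract derivations, and the field \<open>p \<mapsto> v (f \<circ> L\<^sub>p)\<close> generated by a derivation \<open>v\<close> at the
  identity is smooth only because \<open>v\<close> is a directional derivative in a chart. This is the classical
  consequence of bump functions and Hadamard's lemma (\<open>tangent_directional\<close>, \<open>hadamard\<close>), for which
  the calculus of smooth maps is developed first.
\<close>

section \<open>Calculus of iterated directional derivatives\<close>

lemma higher_diff_cong:
  assumes "open S" "higher_differentiable_on S f n" "\<And>x. x \<in> S \<Longrightarrow> f x = g x"
  shows "higher_differentiable_on S g n"
  using assms(2,3)
proof (induction n arbitrary: f g)
  case 0
  then show ?case using continuous_on_cong[of S S f g] by simp
next
  case (Suc n)
  have d: "(g has_derivative frechet_derivative f (at x)) (at x)" if "x \<in> S" for x
  proof -
    have "(f has_derivative frechet_derivative f (at x)) (at x)"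
      using Suc.prems(1) that frechet_derivative_works by auto
    then show ?thesis
      using has_derivative_transform_within_open[OF _ assms(1) that] Suc.prems(2) by metis
  qed
  have e: "frechet_derivative f (at x) v = frechet_derivative g (at x) v" if "x \<in> S" for x v
    using frechet_derivative_at[OF d[OF that]] by simp
  have "higher_differentiable_on S (\<lambda>x. frechet_derivative g (at x) v) n" for v
    using Suc.prems(1) by (intro Suc.IH[OF _ e]) auto
  then show ?case using d by (auto intro: differentiableI)
qed

text \<open>The directional derivative is usually known only as a formula \<open>D\<close> on \<open>S\<close>; this allows \<open>D\<close> in place
of the total function \<open>frechet_derivative f\<close>.\<close>

lemma higher_diff_SucI:
  assumes "open S" "\<And>x. x \<in> S \<Longrightarrow> (f has_derivative D x) (at x)"
    and "\<And>v. higher_differentiable_on S (\<lambda>x. D x v) n"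
  shows "higher_differentiable_on S f (Suc n)"
proof -
  have "D x v = frechet_derivative f (at x) v" if "x \<in> S" for x v
    using frechet_derivative_at[OF assms(2)[OF that]] by simp
  then have "higher_differentiable_on S (\<lambda>x. frechet_derivative f (at x) v) n" for v
    by (rule higher_diff_cong[OF assms(1) assms(3)])
  moreover have "f differentiable (at x)" if "x \<in> S" for x
    using assms(2)[OF that] by (rule differentiableI)
  ultimately show ?thesis by simp
qed

lemma higher_diff_has_derivative:
  assumes "higher_differentiable_on S f (Suc n)" "x \<in> S"
  shows "(f has_derivative frechet_derivative f (at x)) (at x)"
  using assms frechet_derivative_works by auto

lemma higher_diff_SucD:
  assumes "higher_differentiable_on S f (Suc n)"
  shows "higher_differentiable_on S f n"
  using assms
proof (induction n arbitrary: f)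
  case 0
  then show ?case by (auto intro!: continuous_at_imp_continuous_on differentiable_imp_continuous_within)
qed auto

lemma higher_diff_subset: "higher_differentiable_on S f n \<Longrightarrow> T \<subseteq> S \<Longrightarrow> higher_differentiable_on T f n"
  by (induction n arbitrary: f) (auto intro: continuous_on_subset)

lemma higher_diff_local:
  assumes "\<And>x. x \<in> S \<Longrightarrow> \<exists>T. open T \<and> x \<in> T \<and> higher_differentiable_on T f n"
  shows "higher_differentiable_on S f n"
  using assms
proof (induction n arbitrary: f)
  case 0
  then show ?case
    by (force intro!: continuous_at_imp_continuous_on simp: continuous_on_eq_continuous_at)
next
  case (Suc n)
  have "higher_differentiable_on S (\<lambda>x. frechet_derivative f (at x) v) n" for v
    using Suc.prems unfolding higher_differentiable_on.simps by (intro Suc.IH) blast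
  then show ?case using Suc.prems by fastforce
qed

lemma higher_diff_const: "higher_differentiable_on S (\<lambda>x. c) n"
  by (induction n arbitrary: c) auto

lemma higher_diff_add:
  assumes "open S" "higher_differentiable_on S f n" "higher_differentiable_on S g n"
  shows "higher_differentiable_on S (\<lambda>x. f x + g x) n"
  using assms(2,3)
proof (induction n arbitrary: f g)
  case 0
  then show ?case by (auto intro: continuous_intros)
next
  case (Suc n)
  show ?case
    using Suc.prems
    by (intro higher_diff_SucI[OF assms(1) has_derivative_add[OF higher_diff_has_derivative[OF Suc.prems(1)] higher_diff_has_derivative[OF Suc.prems(2)]]] Suc.IH) auto
qed

lemma higher_diff_bounded_linear:
  assumes "open S" "bounded_linear L" "higher_differentiable_on S f n"
  shows "higher_differentiable_on S (\<lambda>x. L (f x)) n"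
  using assms(3)
proof (induction n arbitrary: f)
  case 0
  then show ?case using bounded_linear.continuous_on[OF assms(2)] by auto
next
  case (Suc n)
  show ?case
    using Suc.prems
    by (intro higher_diff_SucI[OF assms(1) bounded_linear.has_derivative[OF assms(2) higher_diff_has_derivative[OF Suc.prems]]] Suc.IH)
      auto
qed

lemma higher_diff_mult:
  fixes f g :: "'a::real_normed_vector \<Rightarrow> real"
  assumes "open S" "higher_differentiable_on S f n" "higher_differentiable_on S g n"
  shows "higher_differentiable_on S (\<lambda>x. f x * g x) n"
  using assms(2,3)
proof (induction n arbitrary: f g)
  case 0
  then show ?case by (auto intro: continuous_intros)
next
  case (Suc n)
  show ?case
    using Suc.prems higher_diff_SucD[OF Suc.prems(1)] higher_diff_SucD[OF Suc.prems(2)]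
    by (intro higher_diff_SucI[OF assms(1) has_derivative_mult[OF higher_diff_has_derivative[OF Suc.prems(1)] higher_diff_has_derivative[OF Suc.prems(2)]]]
        higher_diff_add[OF assms(1)] Suc.IH) auto
qed

lemma higher_diff_sum:
  assumes "open S" "\<And>i. i \<in> I \<Longrightarrow> higher_differentiable_on S (f i) n"
  shows "higher_differentiable_on S (\<lambda>x. \<Sum>i\<in>I. f i x) n"
  using assms(2) by (induction I rule: infinite_finite_induct) (auto intro: higher_diff_const higher_diff_add[OF assms(1)])

lemma higher_diff_affine:
  assumes "open T" "bounded_linear L" "higher_differentiable_on S f n" "\<And>x. x \<in> T \<Longrightarrow> L x + c \<in> S"
  shows "higher_differentiable_on T (\<lambda>x. f (L x + c)) n"
  using assms(3)
proof (induction n arbitrary: f)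
  case 0
  have "continuous_on T (\<lambda>x. L x + c)"
    by (intro continuous_intros bounded_linear.continuous_on[OF assms(2)])
  then show ?case using 0 assms(4) continuous_on_compose2[of S f T] by auto
next
  case (Suc n)
  have d: "((\<lambda>x. f (L x + c)) has_derivative (\<lambda>v. frechet_derivative f (at (L x + c)) (L v))) (at x)"
    if "x \<in> T" for x
  proof -
    have "((\<lambda>x. L x + c) has_derivative L) (at x)"
      using bounded_linear_imp_has_derivative[OF assms(2)] by (auto intro!: derivative_eq_intros)
    from has_derivative_compose[OF this higher_diff_has_derivative[OF Suc.prems assms(4)[OF that]]]
    show ?thesis .
  qed
  show ?case
    using Suc.prems Suc.IH[of "\<lambda>y. frechet_derivative f (at y) (L v)" for v]
    by (intro higher_diff_SucI[OF assms(1) d]) auto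
qed

text \<open>The model space of a manifold is a finite-dimensional inner product space that need not be an
instance of \<^class>\<open>euclidean_space\<close>; Gram-Schmidt supplies the orthonormal basis that the class would
provide.\<close>

lemma orthonormal_expansion:
  assumes "\<exists>B::'e::real_inner set. finite B \<and> span B = UNIV"
  obtains B :: "'e::real_inner set" where "finite B" "\<And>b. b \<in> B \<Longrightarrow> norm b = 1" "\<And>x. x = (\<Sum>b\<in>B. (x \<bullet> b) *\<^sub>R b)"
proof -
  obtain C :: "'e set" where C: "finite C" "span C = UNIV" "pairwise orthogonal C"
    using assms basis_orthogonal by metis
  define B where "B = (\<lambda>b. b /\<^sub>R norm b) ` (C - {0})"
  have fB: "finite B" and nB: "\<And>b. b \<in> B \<Longrightarrow> norm b = 1"
    using C(1) by (auto simp: B_def) (metis left_inverse norm_eq_zero)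
  have ort: "b \<bullet> b' = 0" if "b \<in> B" "b' \<in> B" "b \<noteq> b'" for b b'
    using that C(3) by (auto simp: B_def pairwise_def orthogonal_def) (metis+)
  have "c \<in> span B" if "c \<in> C" for c
  proof (cases "c = 0")
    case True then show ?thesis by (simp add: span_zero)
  next
    case False
    then have "c /\<^sub>R norm c \<in> B" using that by (auto simp: B_def)
    then have "norm c *\<^sub>R (c /\<^sub>R norm c) \<in> span B" by (intro span_scale span_base)
    then show ?thesis using False by simp
  qed
  then have "span C \<subseteq> span B" by (simp add: span_minimal subsetI)
  then have sB: "span B = UNIV" using C(2) by auto
  have "x = (\<Sum>b\<in>B. (x \<bullet> b) *\<^sub>R b)" for x
  proof -
    have "x \<in> span B" using sB by simp
    then show ?thesis
    proof (induction rule: span_induct_alt)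
      case base then show ?case by simp
    next
      case (step c b y)
      have "(\<Sum>b'\<in>B. (b \<bullet> b') *\<^sub>R b') = (\<Sum>b'\<in>B. if b' = b then b else 0)"
        using ort nB step(1) by (intro sum.cong) (auto simp: dot_square_norm)
      also have "\<dots> = b" using fB step(1) by simp
      finally have "(\<Sum>b'\<in>B. (b \<bullet> b') *\<^sub>R b') = b" .
      moreover have "(\<Sum>b'\<in>B. ((c *\<^sub>R b + y) \<bullet> b') *\<^sub>R b')
          = c *\<^sub>R (\<Sum>b'\<in>B. (b \<bullet> b') *\<^sub>R b') + (\<Sum>b'\<in>B. (y \<bullet> b') *\<^sub>R b')"
        by (simp add: inner_add_left scaleR_add_left sum.distrib scaleR_sum_right)
      ultimately show ?case using step(2) by simp
    qed
  qed
  with fB nB show thesis using that by blast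
qed

lemma linear_expansion:
  assumes "finite B" "\<And>x. x = (\<Sum>b\<in>B. (x \<bullet> b) *\<^sub>R b)" "linear L"
  shows "L x = (\<Sum>b\<in>B. (x \<bullet> b) *\<^sub>R L b)"
proof -
  have "L x = L (\<Sum>b\<in>B. (x \<bullet> b) *\<^sub>R b)" using assms(2) by metis
  then show ?thesis by (simp add: linear_sum[OF assms(3)] linear_cmul[OF assms(3)])
qed

text \<open>The derivative of \<open>h \<circ> f\<close> is a derivative of \<open>h\<close> in a direction that varies with the point.
Expanding that direction in a fixed orthonormal basis leaves sums of products of functions to which
the induction hypothesis applies; this is where finite dimension enters.\<close>

lemma higher_diff_compose:
  fixes f :: "'d::real_normed_vector \<Rightarrow> 'e::real_inner" and h :: "'e \<Rightarrow> real"
  assumes fd: "\<exists>B::'e set. finite B \<and> span B = UNIV"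
    and S: "open S" and f: "higher_differentiable_on S f n"
    and h: "higher_differentiable_on T h n" and sub: "\<And>x. x \<in> S \<Longrightarrow> f x \<in> T"
  shows "higher_differentiable_on S (\<lambda>x. h (f x)) n"
proof -
  obtain B :: "'e set" where B: "finite B" "\<And>x. x = (\<Sum>b\<in>B. (x \<bullet> b) *\<^sub>R b)"
    using orthonormal_expansion[OF fd] by metis
  show ?thesis using f h
  proof (induction n arbitrary: h)
    case 0
    then show ?case using sub continuous_on_compose2[of T h S f] by auto
  next
    case (Suc n)
    have d: "((\<lambda>x. h (f x)) has_derivative
        (\<lambda>v. \<Sum>b\<in>B. (frechet_derivative f (at x) v \<bullet> b) * frechet_derivative h (at (f x)) b)) (at x)"
      if "x \<in> S" for x
    proof -
      have hx: "(h has_derivative frechet_derivative h (at (f x))) (at (f x))"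
        by (rule higher_diff_has_derivative[OF Suc.prems(2) sub[OF that]])
      have "frechet_derivative h (at (f x)) w
          = (\<Sum>b\<in>B. (w \<bullet> b) * frechet_derivative h (at (f x)) b)" for w
        using linear_expansion[OF B has_derivative_linear[OF hx], of w]
        unfolding real_scaleR_def .
      then show ?thesis
        by (intro has_derivative_eq_rhs[OF has_derivative_compose[OF higher_diff_has_derivative[OF Suc.prems(1) that] hx]] ext)
    qed
    show ?case
    proof (intro higher_diff_SucI[OF S d] higher_diff_sum[OF S] higher_diff_mult[OF S])
      fix b v
      show "higher_differentiable_on S (\<lambda>x. frechet_derivative f (at x) v \<bullet> b) n"
        using Suc.prems by (intro higher_diff_bounded_linear[OF S bounded_linear_inner_left]) auto
      show "higher_differentiable_on S (\<lambda>x. frechet_derivative h (at (f x)) b) n"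
        using Suc.prems higher_diff_SucD[OF Suc.prems(1)] by (intro Suc.IH) auto
    qed
  qed
qed

lemma smooth_on_cong: "open S \<Longrightarrow> smooth_on S f \<Longrightarrow> (\<And>x. x \<in> S \<Longrightarrow> f x = g x) \<Longrightarrow> smooth_on S g"
  unfolding smooth_on_def using higher_diff_cong by blast

lemma smooth_on_subset: "smooth_on S f \<Longrightarrow> T \<subseteq> S \<Longrightarrow> smooth_on T f"
  unfolding smooth_on_def using higher_diff_subset by blast

lemma smooth_on_local:
  "(\<And>x. x \<in> S \<Longrightarrow> \<exists>T. open T \<and> x \<in> T \<and> smooth_on T f) \<Longrightarrow> smooth_on S f"
  unfolding smooth_on_def by (metis higher_diff_local)

lemma smooth_on_const: "smooth_on S (\<lambda>x. c)"
  unfolding smooth_on_def using higher_diff_const by blast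

lemma smooth_on_add:
  "open S \<Longrightarrow> smooth_on S f \<Longrightarrow> smooth_on S g \<Longrightarrow> smooth_on S (\<lambda>x. f x + g x)"
  unfolding smooth_on_def using higher_diff_add by blast

lemma smooth_on_mult:
  fixes f g :: "'a::real_normed_vector \<Rightarrow> real"
  shows "open S \<Longrightarrow> smooth_on S f \<Longrightarrow> smooth_on S g \<Longrightarrow> smooth_on S (\<lambda>x. f x * g x)"
  unfolding smooth_on_def using higher_diff_mult by blast

lemma smooth_on_sum:
  "open S \<Longrightarrow> (\<And>i. i \<in> I \<Longrightarrow> smooth_on S (f i)) \<Longrightarrow> smooth_on S (\<lambda>x. \<Sum>i\<in>I. f i x)"
  unfolding smooth_on_def by (intro allI higher_diff_sum) simp_all

lemma smooth_on_bounded_linear: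
  "open S \<Longrightarrow> bounded_linear L \<Longrightarrow> smooth_on S f \<Longrightarrow> smooth_on S (\<lambda>x. L (f x))"
  unfolding smooth_on_def using higher_diff_bounded_linear by blast

lemma smooth_on_affine:
  "open T \<Longrightarrow> bounded_linear L \<Longrightarrow> smooth_on S f \<Longrightarrow> (\<And>x. x \<in> T \<Longrightarrow> L x + c \<in> S) \<Longrightarrow>
   smooth_on T (\<lambda>x. f (L x + c))"
  unfolding smooth_on_def using higher_diff_affine by blast

lemma smooth_on_compose:
  fixes f :: "'d::real_normed_vector \<Rightarrow> 'e::real_inner" and h :: "'e \<Rightarrow> real"
  assumes "\<exists>B::'e set. finite B \<and> span B = UNIV"
    and "open S" "smooth_on S f" "smooth_on T h" "\<And>x. x \<in> S \<Longrightarrow> f x \<in> T"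
  shows "smooth_on S (\<lambda>x. h (f x))"
  using assms higher_diff_compose[OF assms(1,2)] unfolding smooth_on_def by blast

lemma smooth_on_id:
  "smooth_on S (\<lambda>x. x)"
proof -
  have "higher_differentiable_on UNIV (\<lambda>x::'a. x) n" for n
    by (cases n) (auto intro!: higher_diff_SucI[where D="\<lambda>x v. v"] higher_diff_const simp del: higher_differentiable_on.simps(2))
  then show ?thesis using smooth_on_subset unfolding smooth_on_def by blast
qed

lemma smooth_on_has_derivative:
  assumes "smooth_on S f" "x \<in> S"
  shows "(f has_derivative frechet_derivative f (at x)) (at x)"
  using assms higher_diff_has_derivative unfolding smooth_on_def by blast

lemma smooth_on_frechet_derivative:
  assumes "smooth_on S f"
  shows "smooth_on S (\<lambda>x. frechet_derivative f (at x) v)"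
  unfolding smooth_on_def
proof
  fix n
  have "higher_differentiable_on S f (Suc n)" using assms unfolding smooth_on_def by blast
  then show "higher_differentiable_on S (\<lambda>x. frechet_derivative f (at x) v) n" by simp
qed

lemma smooth_on_continuous_on: "smooth_on S f \<Longrightarrow> continuous_on S f"
  unfolding smooth_on_def by (metis higher_differentiable_on.simps(1))

section \<open>A flat function and compact balls\<close>

text \<open>The functions \<open>t\<^sup>-\<^sup>k exp (- 1 / t)\<close>, extended by zero. For \<open>k = 0\<close> this is the usual smooth function that is
flat at the origin; the whole family is needed because it is closed under differentiation up to
linear combinations.\<close>

definition flat :: "nat \<Rightarrow> real \<Rightarrow> real"
  where "flat k t = (if t \<le> 0 then 0 else exp (- inverse t) * inverse t ^ k)"

lemma flat_tendsto_0: "(flat k \<longlongrightarrow> 0) (at 0)"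
proof -
  have r: "((\<lambda>t. inverse t ^ k / exp (inverse t)) \<longlongrightarrow> (0::real)) (at_right 0)"
    by (rule filterlim_compose[OF tendsto_power_div_exp_0 filterlim_inverse_at_top_right])
  have "(flat k \<longlongrightarrow> 0) (at_right 0)"
    by (rule Lim_transform_eventually[OF r])
      (auto simp: eventually_at_right_field flat_def exp_minus field_simps intro!: exI[of _ 1])
  moreover have "(flat k \<longlongrightarrow> 0) (at_left 0)"
    by (rule tendsto_eventually) (auto simp: eventually_at_left_field flat_def intro!: exI[of _ "-1"])
  ultimately show ?thesis by (simp add: filterlim_split_at)
qed

lemma flat_has_derivative:
  "(flat k has_real_derivative (flat (k + 2) t - k * flat (k + 1) t)) (at t)"
proof -
  consider "t < 0" | "t = 0" | "t > 0" by linarith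
  then show ?thesis
  proof cases
    case 1
    have "((\<lambda>t. 0) has_real_derivative 0) (at t)" by simp
    then have "(flat k has_real_derivative 0) (at t)"
      by (rule has_field_derivative_transform_within_open[where S="{..<0}"]) (use 1 in \<open>auto simp: flat_def\<close>)
    then show ?thesis using 1 by (simp add: flat_def)
  next
    case 2
    have "((\<lambda>h. (flat k (0 + h) - flat k 0) / h) \<longlongrightarrow> 0) (at 0)"
      by (rule Lim_transform_eventually[OF flat_tendsto_0[of "Suc k"]])
        (auto simp: flat_def eventually_at_filter field_simps)
    then show ?thesis using 2 by (simp add: DERIV_def flat_def)
  next
    case 3
    have "((\<lambda>t. exp (- inverse t) * inverse t ^ k) has_real_derivative
        (flat (k + 2) t - k * flat (k + 1) t)) (at t)"
      using 3 by (auto intro!: derivative_eq_intros simp: flat_def)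
        (cases k, auto simp: field_simps power2_eq_square)
    then show ?thesis
      by (rule has_field_derivative_transform_within_open[where S="{0<..}"]) (use 3 in \<open>auto simp: flat_def\<close>)
  qed
qed

lemma smooth_on_flat: "smooth_on UNIV (flat k)"
proof -
  have "higher_differentiable_on UNIV (flat k) n" for n
  proof (induction n arbitrary: k)
    case 0
    show ?case using flat_has_derivative
      by (auto intro!: continuous_at_imp_continuous_on DERIV_isCont)
  next
    case (Suc n)
    have "higher_differentiable_on UNIV (\<lambda>t. (flat (k + 2) t - k * flat (k + 1) t) * v) n" for v
    proof -
      have "higher_differentiable_on UNIV (\<lambda>t. (flat (k + 2) t + (- k) * flat (k + 1) t) * v) n"
        by (intro higher_diff_mult higher_diff_add higher_diff_const Suc open_UNIV)
      then show ?thesis by simp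
    qed
    then show ?case
      by (intro higher_diff_SucI[OF open_UNIV flat_has_derivative[unfolded has_field_derivative_def]])
  qed
  then show ?thesis unfolding smooth_on_def by blast
qed

text \<open>By induction on the spanning set, as the continuous image of an interval times a lower-dimensional
cube.\<close>

lemma compact_cube:
  fixes B :: "'e::real_normed_vector set"
  assumes "finite B"
  shows "compact {\<Sum>b\<in>B. c b *\<^sub>R b | c. \<forall>b\<in>B. c b \<in> {-r..r}}" (is "compact (?C B)")
  using assms
proof induction
  case empty
  have "?C {} = {0}" by auto
  then show ?case by simp
next
  case (insert a B)
  have "?C (insert a B) = (\<lambda>(t, x). t *\<^sub>R a + x) ` ({-r..r} \<times> ?C B)"
  proof (intro set_eqI iffI)
    fix x assume "x \<in> ?C (insert a B)"
    then obtain c where "\<forall>b\<in>insert a B. c b \<in> {-r..r}" "x = (\<Sum>b\<in>insert a B. c b *\<^sub>R b)" by blast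
    then show "x \<in> (\<lambda>(t, x). t *\<^sub>R a + x) ` ({-r..r} \<times> ?C B)"
      using insert by (intro image_eqI[of _ _ "(c a, \<Sum>b\<in>B. c b *\<^sub>R b)"]) auto
  next
    fix x assume "x \<in> (\<lambda>(t, x). t *\<^sub>R a + x) ` ({-r..r} \<times> ?C B)"
    then obtain t c where c: "t \<in> {-r..r}" "\<forall>b\<in>B. c b \<in> {-r..r}" "x = t *\<^sub>R a + (\<Sum>b\<in>B. c b *\<^sub>R b)"
      by auto
    have "(\<Sum>b\<in>B. (c(a := t)) b *\<^sub>R b) = (\<Sum>b\<in>B. c b *\<^sub>R b)"
      using insert by (intro sum.cong) auto
    then have "x = (\<Sum>b\<in>insert a B. (c(a := t)) b *\<^sub>R b)" using insert c by simp
    moreover have "\<forall>b\<in>insert a B. (c(a := t)) b \<in> {-r..r}" using c by auto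
    ultimately show "x \<in> ?C (insert a B)" by blast
  qed
  moreover have "compact ({-r..r} \<times> ?C B)" using insert by (intro compact_Times) auto
  then have "compact ((\<lambda>(t, x). t *\<^sub>R a + x) ` ({-r..r} \<times> ?C B))"
    by (intro compact_continuous_image) (auto simp: case_prod_unfold intro!: continuous_intros)
  ultimately show ?case by simp
qed

lemma compact_cball_fin_dim:
  fixes x :: "'e::real_inner"
  assumes "\<exists>B::'e set. finite B \<and> span B = UNIV"
  shows "compact (cball x r)"
proof -
  obtain B :: "'e set" where B: "finite B" "\<And>b. b \<in> B \<Longrightarrow> norm b = 1" "\<And>x. x = (\<Sum>b\<in>B. (x \<bullet> b) *\<^sub>R b)"
    using orthonormal_expansion[OF assms] by blast
  let ?C = "{\<Sum>b\<in>B. c b *\<^sub>R b | c. \<forall>b\<in>B. c b \<in> {-r..r}}"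
  have "y \<in> (+) x ` ?C" if "y \<in> cball x r" for y
  proof -
    have n: "norm (y - x) \<le> r" using that by (simp add: dist_norm norm_minus_commute)
    have "\<bar>(y - x) \<bullet> b\<bar> \<le> r" if "b \<in> B" for b
      using Cauchy_Schwarz_ineq2[of "y - x" b] B(2)[OF that] n by simp
    then have "\<forall>b\<in>B. (y - x) \<bullet> b \<in> {-r..r}" unfolding abs_le_iff atLeastAtMost_iff
      by (metis minus_le_iff)
    then have "(\<Sum>b\<in>B. ((y - x) \<bullet> b) *\<^sub>R b) \<in> ?C" by blast
    then have "y - x \<in> ?C" by (rule ssubst[OF B(3)[of "y - x"], of "\<lambda>z. z \<in> ?C"])
    then show ?thesis by (rule rev_image_eqI) simp
  qed
  moreover have "compact ((+) x ` ?C)" using compact_cube[OF B(1)] compact_translation by blast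
  ultimately have eq: "cball x r = ((+) x ` ?C) \<inter> cball x r" by blast
  have "compact (((+) x ` ?C) \<inter> cball x r)"
    by (rule compact_Int_closed[OF _ closed_cball]) fact
  then show ?thesis by (rule ssubst[OF eq, of compact])
qed

section \<open>Mixed partial derivatives and the Hadamard lemma\<close>

lemma directional_derivative:
  assumes "smooth_on S f" "x + s *\<^sub>R v \<in> S"
  shows "((\<lambda>s. f (x + s *\<^sub>R v)) has_real_derivative frechet_derivative f (at (x + s *\<^sub>R v)) v) (at s)"
proof -
  let ?D = "frechet_derivative f (at (x + s *\<^sub>R v))"
  have d: "(f has_derivative ?D) (at (x + s *\<^sub>R v))"
    by (rule smooth_on_has_derivative[OF assms])
  have "((\<lambda>s. x + s *\<^sub>R v) has_derivative (\<lambda>s. s *\<^sub>R v)) (at s)"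
    by (auto intro!: derivative_eq_intros)
  from has_derivative_compose[OF this d]
  show ?thesis
    unfolding has_field_derivative_def
    by (rule has_derivative_eq_rhs) (simp add: fun_eq_iff linear_cmul[OF has_derivative_linear[OF d]])
qed

text \<open>The left-hand side is symmetric in \<open>v\<close> and \<open>w\<close>, the right-hand side is not: this is the classical
reason for the symmetry of second derivatives.\<close>

lemma second_difference_mean_value:
  fixes f :: "'a::real_normed_vector \<Rightarrow> real"
  assumes f: "smooth_on S f" and h: "0 < h"
    and sub: "\<And>s t. s \<in> {0..h} \<Longrightarrow> t \<in> {0..h} \<Longrightarrow> x + s *\<^sub>R v + t *\<^sub>R w \<in> S"
  obtains s t where "0 < s" "s < h" "0 < t" "t < h"
    "f (x + h *\<^sub>R v + h *\<^sub>R w) - f (x + h *\<^sub>R v) - f (x + h *\<^sub>R w) + f x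
      = h * h * frechet_derivative (\<lambda>y. frechet_derivative f (at y) v) (at (x + s *\<^sub>R v + t *\<^sub>R w)) w"
proof -
  have "\<exists>s. 0 < s \<and> s < h \<and>
      (f (x + h *\<^sub>R w + h *\<^sub>R v) - f (x + h *\<^sub>R v)) - (f (x + h *\<^sub>R w + 0 *\<^sub>R v) - f (x + 0 *\<^sub>R v))
      = (h - 0) * (frechet_derivative f (at (x + h *\<^sub>R w + s *\<^sub>R v)) v - frechet_derivative f (at (x + s *\<^sub>R v)) v)"
  proof (rule MVT2[OF h])
    fix s assume s: "0 \<le> s" "s \<le> h"
    show "((\<lambda>s. f (x + h *\<^sub>R w + s *\<^sub>R v) - f (x + s *\<^sub>R v)) has_real_derivative
      frechet_derivative f (at (x + h *\<^sub>R w + s *\<^sub>R v)) v - frechet_derivative f (at (x + s *\<^sub>R v)) v) (at s)"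
      using sub[of s h] sub[of s 0] s h
      by (intro DERIV_diff directional_derivative[OF f]) (auto simp: algebra_simps)
  qed
  then obtain s where s: "0 < s" "s < h"
    "f (x + h *\<^sub>R v + h *\<^sub>R w) - f (x + h *\<^sub>R v) - f (x + h *\<^sub>R w) + f x
      = h * (frechet_derivative f (at (x + s *\<^sub>R v + h *\<^sub>R w)) v - frechet_derivative f (at (x + s *\<^sub>R v)) v)"
    by (auto simp: algebra_simps)
  let ?g = "\<lambda>y. frechet_derivative f (at y) v"
  have "\<exists>t. 0 < t \<and> t < h \<and> ?g (x + s *\<^sub>R v + h *\<^sub>R w) - ?g (x + s *\<^sub>R v + 0 *\<^sub>R w)
      = (h - 0) * frechet_derivative ?g (at (x + s *\<^sub>R v + t *\<^sub>R w)) w"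
  proof (rule MVT2[OF h])
    fix t assume t: "0 \<le> t" "t \<le> h"
    show "((\<lambda>t. ?g (x + s *\<^sub>R v + t *\<^sub>R w)) has_real_derivative
      frechet_derivative ?g (at (x + s *\<^sub>R v + t *\<^sub>R w)) w) (at t)"
      using sub[of s t] s t
      by (intro directional_derivative[OF smooth_on_frechet_derivative[OF f]]) auto
  qed
  then show thesis using s that[of s] by auto
qed

lemma mixed_partials_commute:
  fixes f :: "'a::real_normed_vector \<Rightarrow> real"
  assumes f: "smooth_on S f" and S: "open S" "x \<in> S"
  shows "frechet_derivative (\<lambda>y. frechet_derivative f (at y) v) (at x) w
    = frechet_derivative (\<lambda>y. frechet_derivative f (at y) w) (at x) v"
proof (rule ccontr)
  let ?P = "\<lambda>v w z. frechet_derivative (\<lambda>y. frechet_derivative f (at y) v) (at z) w"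
  assume "?P v w x \<noteq> ?P w v x"
  then have e: "\<bar>?P v w x - ?P w v x\<bar> / 2 > 0" by simp
  have c: "isCont (?P v w) x" for v w
    using smooth_on_continuous_on[OF smooth_on_frechet_derivative[OF smooth_on_frechet_derivative[OF f]]]
      S continuous_on_eq_continuous_at by blast
  obtain d1 where d1: "d1 > 0" "\<And>z. dist z x < d1 \<Longrightarrow> dist (?P v w z) (?P v w x) < \<bar>?P v w x - ?P w v x\<bar> / 2"
    using c[of v w] e unfolding continuous_at_eps_delta by meson
  obtain d2 where d2: "d2 > 0" "\<And>z. dist z x < d2 \<Longrightarrow> dist (?P w v z) (?P w v x) < \<bar>?P v w x - ?P w v x\<bar> / 2"
    using c[of w v] e unfolding continuous_at_eps_delta by meson
  obtain d3 where d3: "d3 > 0" "ball x d3 \<subseteq> S" using S openE by blast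
  define d where "d = min d1 (min d2 d3)"
  \<comment> \<open>small enough for the parallelogram spanned by \<open>h v\<close> and \<open>h w\<close> to stay within distance \<open>d\<close> of \<open>x\<close>\<close>
  define h where "h = d / (norm v + norm w + 1)"
  have d: "d > 0" using d1 d2 d3 by (simp add: d_def)
  have h: "h > 0" unfolding h_def using d by (intro divide_pos_pos add_nonneg_pos) auto
  have hd: "h * (norm v + norm w) < d"
  proof -
    have "h * (norm v + norm w + 1) = d"
      using norm_ge_zero[of v] norm_ge_zero[of w] unfolding h_def
      by (intro nonzero_eq_divide_eq[THEN iffD1, OF _ refl]) linarith
    then show ?thesis using h by (simp add: algebra_simps)
  qed
  have near: "dist (x + s *\<^sub>R v + t *\<^sub>R w) x < d" if "s \<in> {0..h}" "t \<in> {0..h}" for s t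
  proof -
    have "dist (x + s *\<^sub>R v + t *\<^sub>R w) x = norm (s *\<^sub>R v + t *\<^sub>R w)" by (simp add: dist_norm)
    also have "\<dots> \<le> s * norm v + t * norm w"
      using that norm_triangle_ineq[of "s *\<^sub>R v" "t *\<^sub>R w"] by simp
    also have "\<dots> \<le> h * norm v + h * norm w"
      using that by (intro add_mono mult_right_mono) auto
    finally show ?thesis using hd by (simp add: algebra_simps)
  qed
  have inS: "x + s *\<^sub>R v + t *\<^sub>R w \<in> S" if "s \<in> {0..h}" "t \<in> {0..h}" for s t
    using near[OF that] d3 by (auto simp: d_def dist_commute)
  obtain s t where st: "0 < s" "s < h" "0 < t" "t < h"
    "f (x + h *\<^sub>R v + h *\<^sub>R w) - f (x + h *\<^sub>R v) - f (x + h *\<^sub>R w) + f x = h * h * ?P v w (x + s *\<^sub>R v + t *\<^sub>R w)"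
    using second_difference_mean_value[OF f h inS] by blast
  have inS': "x + t *\<^sub>R w + s *\<^sub>R v \<in> S" if "t \<in> {0..h}" "s \<in> {0..h}" for s t
    using inS[OF that(2,1)] by (simp add: add.commute add.left_commute)
  obtain t' s' where st': "0 < t'" "t' < h" "0 < s'" "s' < h"
    "f (x + h *\<^sub>R w + h *\<^sub>R v) - f (x + h *\<^sub>R w) - f (x + h *\<^sub>R v) + f x = h * h * ?P w v (x + t' *\<^sub>R w + s' *\<^sub>R v)"
    using second_difference_mean_value[OF f h inS'] by blast
  have "h * h * ?P v w (x + s *\<^sub>R v + t *\<^sub>R w) = h * h * ?P w v (x + s' *\<^sub>R v + t' *\<^sub>R w)"
    using st(5) st'(5)
    unfolding add.assoc[of x] add.commute[of "_ *\<^sub>R w"] by linarith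
  then have eq: "?P v w (x + s *\<^sub>R v + t *\<^sub>R w) = ?P w v (x + s' *\<^sub>R v + t' *\<^sub>R w)" using h by simp
  have "dist (?P v w (x + s *\<^sub>R v + t *\<^sub>R w)) (?P v w x) < \<bar>?P v w x - ?P w v x\<bar> / 2"
    using near[of s t] st by (intro d1) (auto simp: d_def)
  moreover have "dist (?P w v (x + s' *\<^sub>R v + t' *\<^sub>R w)) (?P w v x) < \<bar>?P v w x - ?P w v x\<bar> / 2"
    using near[of s' t'] st' by (intro d2) (auto simp: d_def)
  moreover have False if "\<bar>a - p\<bar> < \<bar>p - q\<bar> / 2" "\<bar>a - q\<bar> < \<bar>p - q\<bar> / 2" for a p q :: real
    using that by (auto simp: abs_if split: if_splits)
  ultimately show False using eq unfolding dist_real_def by metis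
qed

text \<open>For \<open>k = 0\<close> and \<open>f\<close> a partial derivative, this is the coefficient function of the Hadamard lemma.
Each differentiation under the integral sign produces one more factor \<open>s\<close>.\<close>

definition ray_integral :: "'e::real_inner \<Rightarrow> nat \<Rightarrow> ('e \<Rightarrow> real) \<Rightarrow> 'e \<Rightarrow> real"
  where "ray_integral x0 k f x = integral {0..1} (\<lambda>s. s ^ k * f (x0 + s *\<^sub>R (x - x0)))"

lemma ray_in_ball:
  fixes x x0 :: "'e::real_inner"
  assumes "dist x0 x < R" "s \<in> {0..1}"
  shows "dist x0 (x0 + s *\<^sub>R (x - x0)) < R"
proof -
  have "dist x0 (x0 + s *\<^sub>R (x - x0)) = s * dist x0 x"
    using assms(2) norm_minus_commute[of x x0] by (simp add: dist_norm)
  also have "\<dots> \<le> 1 * dist x0 x" using assms(2) by (intro mult_right_mono) auto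
  finally show ?thesis using assms(1) by simp
qed

lemma ray_integrable:
  fixes x x0 :: "'e::real_inner"
  assumes "continuous_on (ball x0 R) f" "x \<in> ball x0 R"
  shows "(\<lambda>s. s ^ k * f (x0 + s *\<^sub>R (x - x0))) integrable_on {0..1}"
proof -
  have "continuous_on {0..1} (\<lambda>s. f (x0 + s *\<^sub>R (x - x0)))"
  proof (rule continuous_on_compose2[OF assms(1)])
    show "continuous_on {0..1} (\<lambda>s. x0 + s *\<^sub>R (x - x0))" by (intro continuous_intros)
    show "(\<lambda>s. x0 + s *\<^sub>R (x - x0)) ` {0..1} \<subseteq> ball x0 R"
      using ray_in_ball[of x0 x R] assms(2) by auto
  qed
  then have "continuous_on {0..1} (\<lambda>s. s ^ k * f (x0 + s *\<^sub>R (x - x0)))"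
    by (intro continuous_intros)
  then show ?thesis by (rule integrable_continuous_real)
qed

text \<open>Differentiation under the integral sign. The partial derivatives of \<open>f\<close> are uniformly continuous on a
compact ball around \<open>x0\<close> that contains \<open>x\<close> in its interior, so the linearisation error of \<open>f\<close> is small
uniformly along the ray from \<open>x0\<close> to \<open>x\<close>.\<close>

lemma ray_integral_has_derivative:
  fixes f :: "'e::real_inner \<Rightarrow> real"
  assumes fd: "\<exists>B::'e set. finite B \<and> span B = UNIV"
    and f: "smooth_on (ball x0 R) f" and x: "x \<in> ball x0 R"
  shows "(ray_integral x0 k f has_derivative
    (\<lambda>v. ray_integral x0 (Suc k) (\<lambda>y. frechet_derivative f (at y) v) x)) (at x)"
proof -
  obtain B :: "'e set" where B: "finite B" "\<And>b. b \<in> B \<Longrightarrow> norm b = 1" "\<And>x. x = (\<Sum>b\<in>B. (x \<bullet> b) *\<^sub>R b)"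
    using orthonormal_expansion[OF fd] by blast
  define D where "D y v = frechet_derivative f (at y) v" for y v
  define c where "c s y = x0 + s *\<^sub>R (y - x0)" for s y
  have Dd: "(f has_derivative D y) (at y)" if "y \<in> ball x0 R" for y
    unfolding D_def using smooth_on_has_derivative[OF f that] .
  have Dlin: "linear (D y)" if "y \<in> ball x0 R" for y
    using has_derivative_linear[OF Dd[OF that]] .
  have Dexp: "D y v = (\<Sum>b\<in>B. (v \<bullet> b) * D y b)" if "y \<in> ball x0 R" for y v
    using linear_expansion[OF B(1,3) Dlin[OF that]] unfolding real_scaleR_def .
  have Dcont: "continuous_on (ball x0 R) (\<lambda>y. D y v)" for v
    unfolding D_def by (rule smooth_on_continuous_on[OF smooth_on_frechet_derivative[OF f]])
  have cR: "c s y \<in> ball x0 R" if "y \<in> ball x0 R" "s \<in> {0..1}" for s y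
    using ray_in_ball[of x0 y R s] that by (simp add: c_def)
  let ?L = "\<lambda>v. ray_integral x0 (Suc k) (\<lambda>y. D y v) x"
  have int: "(\<lambda>s. s ^ Suc k * D (c s x) v) integrable_on {0..1}" for v
    unfolding c_def by (rule ray_integrable[OF Dcont x])
  have intf: "(\<lambda>s. s ^ k * f (c s y)) integrable_on {0..1}" if "y \<in> ball x0 R" for y
    unfolding c_def by (rule ray_integrable[OF smooth_on_continuous_on[OF f] that])
  have L: "?L v = (\<Sum>b\<in>B. (v \<bullet> b) * ?L b)" for v
  proof -
    have "?L v = integral {0..1} (\<lambda>s. \<Sum>b\<in>B. (v \<bullet> b) * (s ^ Suc k * D (c s x) b))"
      unfolding ray_integral_def c_def[symmetric]
    proof (rule integral_cong)
      fix s :: real assume s: "s \<in> {0..1}"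
      have "(\<Sum>b\<in>B. (v \<bullet> b) * (s ^ Suc k * D (c s x) b))
          = s ^ Suc k * (\<Sum>b\<in>B. (v \<bullet> b) * D (c s x) b)"
        unfolding sum_distrib_left by (simp add: mult_ac)
      then show "s ^ Suc k * D (c s x) v = (\<Sum>b\<in>B. (v \<bullet> b) * (s ^ Suc k * D (c s x) b))"
        by (simp only: Dexp[OF cR[OF x s], symmetric])
    qed
    also have "\<dots> = (\<Sum>b\<in>B. integral {0..1} (\<lambda>s. (v \<bullet> b) * (s ^ Suc k * D (c s x) b)))"
      by (intro integral_sum B(1) integrable_on_mult_right int)
    also have "\<dots> = (\<Sum>b\<in>B. (v \<bullet> b) * ?L b)"
      unfolding ray_integral_def c_def[symmetric] by simp
    finally show ?thesis .
  qed
  have bl: "bounded_linear ?L"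
  proof -
    have "bounded_linear (\<lambda>v. \<Sum>b\<in>B. (v \<bullet> b) * ?L b)"
      by (intro bounded_linear_sum bounded_linear_mult_const bounded_linear_inner_left)
    then show ?thesis by (simp only: L[symmetric])
  qed
  \<comment> \<open>the ball of radius \<open>r\<close> contains \<open>x\<close> in its interior and its closure lies in the domain\<close>
  define r where "r = (dist x0 x + R) / 2"
  have r: "dist x0 x < r" "r < R" using x by (auto simp: r_def)
  have cpt: "compact (cball x0 r)" by (rule compact_cball_fin_dim[OF fd])
  have KR: "cball x0 r \<subseteq> ball x0 R" using r by auto
  have "\<exists>d>0. \<forall>y. norm (y - x) < d \<longrightarrow>
      norm (ray_integral x0 k f y - ray_integral x0 k f x - ?L (y - x)) \<le> e * norm (y - x)"
    if e: "e > 0" for e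
  proof -
    define e' where "e' = e / (card B + 1)"
    have e': "e' > 0" using e by (simp add: e'_def)
    have "\<exists>d>0. \<forall>y\<in>cball x0 r. \<forall>z\<in>cball x0 r. dist z y < d \<longrightarrow> dist (D z b) (D y b) < e'" for b
      using compact_uniformly_continuous[OF continuous_on_subset[OF Dcont KR] cpt] e'
      unfolding uniformly_continuous_on_def by blast
    then obtain d where d: "\<And>b. d b > 0"
      "\<And>b y z. y \<in> cball x0 r \<Longrightarrow> z \<in> cball x0 r \<Longrightarrow> dist z y < d b \<Longrightarrow> dist (D z b) (D y b) < e'"
      by metis
    define d0 where "d0 = Min (insert (r - dist x0 x) (d ` B))"
    have d0: "d0 > 0" "d0 \<le> r - dist x0 x" "\<And>b. b \<in> B \<Longrightarrow> d0 \<le> d b"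
      using B(1) d(1) r by (auto simp: d0_def)
    have on: "onorm (\<lambda>v. D z v - D y v) \<le> e"
      if yz: "y \<in> cball x0 r" "z \<in> cball x0 r" "dist z y < d0" for y z
    proof (rule onorm_bound)
      fix v
      have yz': "y \<in> ball x0 R" "z \<in> ball x0 R" using yz KR by auto
      have "norm (D z v - D y v) = norm (\<Sum>b\<in>B. (v \<bullet> b) * (D z b - D y b))"
        by (simp only: right_diff_distrib sum_subtractf Dexp[OF yz'(1), symmetric]
            Dexp[OF yz'(2), symmetric])
      also have "\<dots> \<le> (\<Sum>b\<in>B. norm v * e')"
      proof (rule sum_norm_le)
        fix b assume b: "b \<in> B"
        have "\<bar>v \<bullet> b\<bar> \<le> norm v" using Cauchy_Schwarz_ineq2[of v b] B(2)[OF b] by simp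
        moreover have "\<bar>D z b - D y b\<bar> \<le> e'"
          using d(2)[OF yz(1,2), of b] yz(3) d0(3)[OF b] by (simp add: dist_real_def)
        ultimately show "norm ((v \<bullet> b) * (D z b - D y b)) \<le> norm v * e'"
          unfolding real_norm_def abs_mult by (intro mult_mono) auto
      qed
      also have "\<dots> = (card B * e') * norm v" by simp
      also have "\<dots> \<le> e * norm v"
      proof (rule mult_right_mono)
        have "card B * e' \<le> (card B + 1) * e'" using e' by (intro mult_right_mono) auto
        also have "\<dots> = e" by (simp add: e'_def)
        finally show "card B * e' \<le> e" .
      qed simp
      finally show "norm (D z v - D y v) \<le> e * norm v" .
    qed (use e in simp)
    show ?thesis
    proof (intro exI[of _ d0] conjI allI impI)
      show "d0 > 0" by (rule d0)
      fix y assume y: "norm (y - x) < d0"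
      have yr: "y \<in> ball x0 r"
      proof -
        have "dist x0 y \<le> dist x0 x + dist x y" by (rule dist_triangle)
        then show ?thesis using y d0(2) by (simp add: dist_norm norm_minus_commute)
      qed
      have yR: "y \<in> ball x0 R" using yr r by auto
      have seg: "c s z \<in> cball x0 r" if "s \<in> {0..1}" "z \<in> {x, y}" for s z
        using ray_in_ball[of x0 z r s] that yr r by (auto simp: c_def)
      have rem: "norm (f (c s y) - f (c s x) - s * D (c s x) (y - x)) \<le> e * norm (y - x)"
        if s: "s \<in> {0..1}" for s
      proof -
        have diff: "c s y - c s x = s *\<^sub>R (y - x)" by (simp add: c_def algebra_simps)
        have sn: "norm (s *\<^sub>R (y - x)) \<le> norm (y - x)"
          using s mult_right_mono[of s 1 "norm (y - x)"] by simp
        have sub: "closed_segment (c s x) (c s y) \<subseteq> cball x0 r"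
          using seg[OF s] by (intro closed_segment_subset) auto
        have "norm (f (c s y) - f (c s x) - D (c s x) (c s y - c s x)) \<le> norm (c s y - c s x) * e"
        proof (rule differentiable_bound_linearization[where S="closed_segment (c s x) (c s y)" and f'=D])
          show "c s x + t *\<^sub>R (c s y - c s x) \<in> closed_segment (c s x) (c s y)" if "t \<in> {0..1}" for t
            using that by (auto simp: in_segment algebra_simps intro!: exI[of _ t])
          show "(f has_derivative D z) (at z within closed_segment (c s x) (c s y))"
            if "z \<in> closed_segment (c s x) (c s y)" for z
            by (rule has_derivative_at_withinI[OF Dd[OF subsetD[OF KR subsetD[OF sub that]]]])
          show "onorm (D z - D (c s x)) \<le> e" if z: "z \<in> closed_segment (c s x) (c s y)" for z
          proof -
            have "dist z (c s x) \<le> dist (c s y) (c s x)"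
              using z segment_bound1 by (metis dist_norm norm_minus_commute)
            also have "\<dots> < d0" using sn y by (simp add: dist_norm diff)
            finally show ?thesis
              using on[of "c s x" z] seg[OF s] sub z by (auto simp: fun_diff_def)
          qed
        qed simp
        also have "D (c s x) (c s y - c s x) = s * D (c s x) (y - x)"
          unfolding diff using linear_cmul[OF Dlin[OF cR[OF x s]]] by simp
        also have "norm (c s y - c s x) * e \<le> e * norm (y - x)"
          unfolding diff using sn e by (simp add: mult.commute mult_left_mono)
        finally show ?thesis .
      qed
      have "norm (ray_integral x0 k f y - ray_integral x0 k f x - ?L (y - x))
          = norm (integral {0..1} (\<lambda>s. s ^ k * f (c s y) - s ^ k * f (c s x) - s ^ Suc k * D (c s x) (y - x)))"
        unfolding ray_integral_def c_def[symmetric]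
        by (simp only: integral_diff[OF integrable_diff[OF intf[OF yR] intf[OF x]] int]
            integral_diff[OF intf[OF yR] intf[OF x]])
      also have "\<dots> \<le> e * norm (y - x) * measure lborel {0..1::real}"
      proof (rule integrable_bound[where a="0::real" and b=1, unfolded cbox_interval])
        show "(\<lambda>s. s ^ k * f (c s y) - s ^ k * f (c s x) - s ^ Suc k * D (c s x) (y - x)) integrable_on {0..1}"
          by (intro integrable_diff intf int x yR)
        fix s :: real assume s: "s \<in> {0..1}"
        have "s ^ k * f (c s y) - s ^ k * f (c s x) - s ^ Suc k * D (c s x) (y - x)
            = s ^ k * (f (c s y) - f (c s x) - s * D (c s x) (y - x))"
          by (simp add: algebra_simps)
        also have "norm \<dots> \<le> 1 * norm (f (c s y) - f (c s x) - s * D (c s x) (y - x))"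
          unfolding norm_mult using s by (intro mult_right_mono) (auto simp: power_le_one)
        finally show "norm (s ^ k * f (c s y) - s ^ k * f (c s x) - s ^ Suc k * D (c s x) (y - x))
            \<le> e * norm (y - x)"
          using rem[OF s] by simp
      qed (use e in auto)
      finally show "norm (ray_integral x0 k f y - ray_integral x0 k f x - ?L (y - x)) \<le> e * norm (y - x)"
        by simp
    qed
  qed
  with bl have "(ray_integral x0 k f has_derivative ?L) (at x)"
    unfolding has_derivative_at_alt by blast
  then show ?thesis unfolding D_def .
qed

lemma smooth_on_ray_integral:
  fixes f :: "'e::real_inner \<Rightarrow> real"
  assumes fd: "\<exists>B::'e set. finite B \<and> span B = UNIV" and f: "smooth_on (ball x0 R) f"
  shows "smooth_on (ball x0 R) (ray_integral x0 k f)"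
proof -
  have "higher_differentiable_on (ball x0 R) (ray_integral x0 k f) n" for n
    using f
  proof (induction n arbitrary: f k)
    case 0
    then show ?case
      using ray_integral_has_derivative[OF fd]
      by (auto intro!: continuous_at_imp_continuous_on has_derivative_continuous)
  next
    case (Suc n)
    show ?case
      by (intro higher_diff_SucI[OF open_ball ray_integral_has_derivative[OF fd Suc.prems]] Suc.IH
          smooth_on_frechet_derivative[OF Suc.prems])
  qed
  then show ?thesis unfolding smooth_on_def by blast
qed

text \<open>Integrate the derivative of \<open>f\<close> along the segment from \<open>x0\<close> to \<open>x\<close> and expand the direction \<open>x - x0\<close> in the
basis.\<close>

lemma hadamard:
  fixes f :: "'e::real_inner \<Rightarrow> real"
  assumes fd: "\<exists>B::'e set. finite B \<and> span B = UNIV" and f: "smooth_on (ball x0 R) f"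
    and B: "finite B" "\<And>x::'e. x = (\<Sum>b\<in>B. (x \<bullet> b) *\<^sub>R b)"
  obtains h where "\<And>b. smooth_on (ball x0 R) (h b)"
    "\<And>x. x \<in> ball x0 R \<Longrightarrow> f x = f x0 + (\<Sum>b\<in>B. ((x - x0) \<bullet> b) * h b x)"
    "\<And>b. h b x0 = frechet_derivative f (at x0) b"
proof
  let ?h = "\<lambda>b. ray_integral x0 0 (\<lambda>y. frechet_derivative f (at y) b)"
  show "smooth_on (ball x0 R) (?h b)" for b
    by (intro smooth_on_ray_integral[OF fd] smooth_on_frechet_derivative[OF f])
  show "?h b x0 = frechet_derivative f (at x0) b" for b
    by (simp add: ray_integral_def)
  fix x assume x: "x \<in> ball x0 R"
  have ray: "x0 + s *\<^sub>R (x - x0) \<in> ball x0 R" if "s \<in> {0..1}" for s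
    using ray_in_ball[of x0 x R s] that x by simp
  have "((\<lambda>s. frechet_derivative f (at (x0 + s *\<^sub>R (x - x0))) (x - x0)) has_integral
      f (x0 + 1 *\<^sub>R (x - x0)) - f (x0 + 0 *\<^sub>R (x - x0))) {0..1}"
    using directional_derivative[OF f ray]
    by (intro fundamental_theorem_of_calculus)
      (auto simp: has_real_derivative_iff_has_vector_derivative intro: has_vector_derivative_at_within)
  then have "f x - f x0 = integral {0..1} (\<lambda>s. frechet_derivative f (at (x0 + s *\<^sub>R (x - x0))) (x - x0))"
    by (simp add: integral_unique)
  also have "\<dots> = integral {0..1} (\<lambda>s. \<Sum>b\<in>B. ((x - x0) \<bullet> b) *
      (s ^ 0 * frechet_derivative f (at (x0 + s *\<^sub>R (x - x0))) b))"
    by (intro integral_cong)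
      (simp only: power_0 mult_1 linear_expansion[OF B has_derivative_linear[OF
          smooth_on_has_derivative[OF f ray]], unfolded real_scaleR_def, symmetric])
  also have "\<dots> = (\<Sum>b\<in>B. integral {0..1} (\<lambda>s. ((x - x0) \<bullet> b) *
      (s ^ 0 * frechet_derivative f (at (x0 + s *\<^sub>R (x - x0))) b)))"
    by (intro integral_sum B(1) integrable_on_mult_right ray_integrable[OF _ x]
        smooth_on_continuous_on[OF smooth_on_frechet_derivative[OF f]])
  also have "\<dots> = (\<Sum>b\<in>B. ((x - x0) \<bullet> b) * ?h b x)"
    by (simp add: ray_integral_def)
  finally show "f x = f x0 + (\<Sum>b\<in>B. ((x - x0) \<bullet> b) * ?h b x)" by simp
qed

section \<open>Smooth functions and tangent vectors\<close>

context smooth_manifold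
begin

abbreviation "SF \<equiv> smooth_functions M"
abbreviation "VF \<equiv> vector_fields M"
abbreviation "TM \<equiv> tangent_space M"

lemma chart_open: "(U, \<phi>) \<in> M \<Longrightarrow> open U" and chart_image_open: "(U, \<phi>) \<in> M \<Longrightarrow> open (\<phi> ` U)"
  and chart_continuous: "(U, \<phi>) \<in> M \<Longrightarrow> continuous_on U \<phi>"
  and chart_inverse_continuous: "(U, \<phi>) \<in> M \<Longrightarrow> continuous_on (\<phi> ` U) (inv_into U \<phi>)"
  and chart_inv: "(U, \<phi>) \<in> M \<Longrightarrow> x \<in> U \<Longrightarrow> inv_into U \<phi> (\<phi> x) = x"
  using chart unfolding homeomorphism_def by blast+

lemma chart_open_image:
  assumes "(U, \<phi>) \<in> M" "open N" "N \<subseteq> U"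
  shows "open (\<phi> ` N)"
proof -
  have "\<phi> ` N = \<phi> ` U \<inter> inv_into U \<phi> -` N"
    using assms(3) chart_inv[OF assms(1)] by (auto intro: rev_image_eqI)
  then show ?thesis
    using continuous_on_open_vimage[OF chart_image_open[OF assms(1)], of "inv_into U \<phi>"]
      chart_inverse_continuous[OF assms(1)] assms(2) by (simp add: Int_commute)
qed

lemma chart_open_preimage:
  assumes "(U, \<phi>) \<in> M" "open T"
  shows "open (U \<inter> \<phi> -` T)"
  using continuous_on_open_vimage[OF chart_open[OF assms(1)], of \<phi>] chart_continuous[OF assms(1)]
    assms(2) by (simp add: Int_commute)

lemma chart_at: obtains U \<phi> where "(U, \<phi>) \<in> M" "p \<in> U"
  using cover by fastforce

text \<open>Smoothness may be tested near each point in a single chart, since transition maps are smooth.\<close>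

lemma smooth_functionsI_local:
  assumes "\<And>p. \<exists>U \<phi> N. (U, \<phi>) \<in> M \<and> open N \<and> p \<in> N \<and> N \<subseteq> U \<and>
    smooth_on (\<phi> ` N) (\<lambda>x. f (inv_into U \<phi> x))"
  shows "f \<in> SF"
  unfolding smooth_functions_def
proof (clarify, rule smooth_on_local)
  fix V \<psi> x assume V: "(V, \<psi>) \<in> M" and "x \<in> \<psi> ` V"
  then obtain p where p: "p \<in> V" "x = \<psi> p" by blast
  obtain U \<phi> N where U: "(U, \<phi>) \<in> M" and N: "open N" "p \<in> N" "N \<subseteq> U"
    and sm: "smooth_on (\<phi> ` N) (\<lambda>x. f (inv_into U \<phi> x))"
    using assms by blast
  have o: "open (\<psi> ` (V \<inter> N))"
    using N chart_open[OF V] by (intro chart_open_image[OF V]) auto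
  have "smooth_on (\<psi> ` (V \<inter> N)) (\<lambda>x. \<phi> (inv_into V \<psi> x))"
    using compatible[OF V U] by (rule smooth_on_subset) (use N in auto)
  have "smooth_on (\<psi> ` (V \<inter> N)) (\<lambda>x. f (inv_into U \<phi> (\<phi> (inv_into V \<psi> x))))"
    by (rule smooth_on_compose[OF finite_dimensional o \<open>smooth_on (\<psi> ` (V \<inter> N)) _\<close> sm])
      (auto simp: chart_inv[OF V])
  then have "smooth_on (\<psi> ` (V \<inter> N)) (\<lambda>x. f (inv_into V \<psi> x))"
    by (rule smooth_on_cong[OF o]) (use N in \<open>auto simp: chart_inv[OF V] chart_inv[OF U]\<close>)
  then show "\<exists>T. open T \<and> x \<in> T \<and> smooth_on T (\<lambda>x. f (inv_into V \<psi> x))"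
    using o p N by blast
qed

lemma smooth_functionsD:
  "f \<in> SF \<Longrightarrow> (U, \<phi>) \<in> M \<Longrightarrow> smooth_on (\<phi> ` U) (\<lambda>x. f (inv_into U \<phi> x))"
  unfolding smooth_functions_def by blast

lemma smooth_functions_continuous:
  assumes "f \<in> SF"
  shows "continuous_on UNIV f"
proof (intro continuous_at_imp_continuous_on ballI)
  fix p
  obtain U \<phi> where U: "(U, \<phi>) \<in> M" "p \<in> U" by (rule chart_at)
  have "continuous_on U (\<lambda>q. f (inv_into U \<phi> (\<phi> q)))"
    using smooth_on_continuous_on[OF smooth_functionsD[OF assms U(1)]] chart_continuous[OF U(1)]
    by (rule continuous_on_compose2) auto
  then have "continuous_on U f"
    by (rule continuous_on_eq) (simp add: chart_inv[OF U(1)])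
  then show "isCont f p" using U chart_open continuous_on_eq_continuous_at by blast
qed

lemma smooth_const: "(\<lambda>x. c) \<in> SF"
  unfolding smooth_functions_def using smooth_on_const by blast

lemma smooth_add:
  "f \<in> SF \<Longrightarrow> h \<in> SF \<Longrightarrow> (\<lambda>x. f x + h x) \<in> SF"
  unfolding smooth_functions_def using smooth_on_add chart_image_open by fast

lemma smooth_mult:
  "f \<in> SF \<Longrightarrow> h \<in> SF \<Longrightarrow> (\<lambda>x. f x * h x) \<in> SF"
  unfolding smooth_functions_def using smooth_on_mult chart_image_open by fast

lemma smooth_sum:
  "(\<And>i. i \<in> I \<Longrightarrow> f i \<in> SF) \<Longrightarrow> (\<lambda>x. \<Sum>i\<in>I. f i x) \<in> SF"
  by (induction I rule: infinite_finite_induct) (auto intro: smooth_const smooth_add)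

lemma smooth_diff:
  assumes "f \<in> SF" "h \<in> SF"
  shows "(\<lambda>x. f x - h x) \<in> SF"
  using smooth_add[OF assms(1) smooth_mult[OF smooth_const[of "-1"] assms(2)]] by simp

lemma smooth_linear:
  assumes "f \<in> SF" "h \<in> SF"
  shows "(\<lambda>x. a * f x + b * h x) \<in> SF"
  by (intro smooth_add smooth_mult smooth_const assms)

text \<open>A function given in one chart extends by zero to the manifold if it vanishes off a compact set:
the image of that set is compact, hence closed by the Hausdorff property, and near points outside it
the extension is zero.\<close>

lemma cutoff:
  assumes U: "(U, \<phi>) \<in> M" and T: "open T" and w: "smooth_on T w"
    and C: "compact C" "C \<subseteq> T" "T \<subseteq> \<phi> ` U" and zero: "\<And>x. x \<in> T \<Longrightarrow> x \<notin> C \<Longrightarrow> w x = 0"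
  shows "(\<lambda>q. if q \<in> U \<and> \<phi> q \<in> T then w (\<phi> q) else 0) \<in> SF" (is "?f \<in> _")
proof (rule smooth_functionsI_local)
  fix p
  let ?N = "U \<inter> \<phi> -` T"
  have N: "open ?N" by (rule chart_open_preimage[OF U T])
  have "compact (inv_into U \<phi> ` C)"
    using C by (intro compact_continuous_image continuous_on_subset[OF chart_inverse_continuous[OF U]]) auto
  then have cl: "open (- inv_into U \<phi> ` C)" using compact_imp_closed open_Compl by blast
  show "\<exists>U \<phi> N. (U, \<phi>) \<in> M \<and> open N \<and> p \<in> N \<and> N \<subseteq> U \<and> smooth_on (\<phi> ` N) (\<lambda>x. ?f (inv_into U \<phi> x))"
  proof (cases "p \<in> ?N")
    case True
    have "smooth_on (\<phi> ` ?N) (\<lambda>x. ?f (inv_into U \<phi> x))"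
    proof (rule smooth_on_cong[of _ w])
      show "open (\<phi> ` ?N)" by (rule chart_open_image[OF U N]) auto
      show "smooth_on (\<phi> ` ?N) w" using w by (rule smooth_on_subset) auto
    qed (auto simp: chart_inv[OF U])
    then show ?thesis using U N True by blast
  next
    case False
    obtain V \<psi> where V: "(V, \<psi>) \<in> M" "p \<in> V" by (rule chart_at)
    let ?K = "V \<inter> - inv_into U \<phi> ` C"
    have "open ?K" using chart_open[OF V(1)] cl by blast
    have "p \<in> ?K" using V False C chart_inv[OF U] by force
    have z: "?f q = 0" if "q \<in> ?K" for q
    proof -
      have "\<phi> q \<notin> C" if "q \<in> U" using \<open>q \<in> ?K\<close> chart_inv[OF U that] by (metis ComplD IntD2 image_eqI)
      then show ?thesis using zero[of "\<phi> q"] by auto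
    qed
    have "smooth_on (\<psi> ` ?K) (\<lambda>x. ?f (inv_into V \<psi> x))"
    proof (rule smooth_on_cong[OF _ smooth_on_const])
      show "open (\<psi> ` ?K)" by (rule chart_open_image[OF V(1) \<open>open ?K\<close>]) auto
      fix x assume "x \<in> \<psi> ` ?K"
      then have "inv_into V \<psi> x \<in> ?K" using chart_inv[OF V(1)] by auto
      from z[OF this] show "0 = ?f (inv_into V \<psi> x)" by simp
    qed
    then show ?thesis using V \<open>open ?K\<close> \<open>p \<in> ?K\<close> by blast
  qed
qed

definition ball_bump :: "'e \<Rightarrow> real \<Rightarrow> 'e \<Rightarrow> real"
  where "ball_bump x0 r x = flat 0 (r\<^sup>2 - (norm (x - x0))\<^sup>2)"

lemma smooth_on_ball_bump: "smooth_on S (ball_bump x0 r)"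
proof -
  obtain B :: "'e set" where B: "finite B" "\<And>x. x = (\<Sum>b\<in>B. (x \<bullet> b) *\<^sub>R b)"
    using orthonormal_expansion[OF finite_dimensional] by metis
  have n: "(norm x)\<^sup>2 = (\<Sum>b\<in>B. (x \<bullet> b) * (x \<bullet> b))" for x
  proof -
    have "(norm x)\<^sup>2 = x \<bullet> x" by (simp add: dot_square_norm)
    also have "\<dots> = (\<Sum>b\<in>B. (x \<bullet> b) *\<^sub>R (x \<bullet> b))"
      by (rule linear_expansion[OF B]) (simp add: linear_iff inner_add_right)
    finally show ?thesis by simp
  qed
  have lin: "smooth_on UNIV (\<lambda>x::'e. (x - x0) \<bullet> b)" for b
  proof -
    have "smooth_on UNIV (\<lambda>x::'e. x \<bullet> b + (- (x0 \<bullet> b)))"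
      by (intro smooth_on_add smooth_on_const smooth_on_bounded_linear[OF _ bounded_linear_inner_left]
          smooth_on_id open_UNIV)
    then show ?thesis by (simp add: inner_diff_left)
  qed
  have "smooth_on UNIV (\<lambda>x. r\<^sup>2 + (-1) * (\<Sum>b\<in>B. ((x - x0) \<bullet> b) * ((x - x0) \<bullet> b)))"
    by (intro smooth_on_add smooth_on_const smooth_on_mult smooth_on_sum lin open_UNIV)
  then have "smooth_on UNIV (\<lambda>x. r\<^sup>2 - (norm (x - x0))\<^sup>2)" by (simp add: n)
  moreover have "\<exists>B::real set. finite B \<and> span B = UNIV" by (intro exI[of _ "{1}"]) (auto simp: span_singleton)
  ultimately have "smooth_on UNIV (ball_bump x0 r)"
    unfolding ball_bump_def[abs_def] using smooth_on_compose[OF _ open_UNIV _ smooth_on_flat] by blast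
  then show ?thesis by (rule smooth_on_subset) simp
qed

lemma ball_bump_nonneg: "ball_bump x0 r x \<ge> 0"
  and ball_bump_pos: "r > 0 \<Longrightarrow> ball_bump x0 r x0 > 0"
  and ball_bump_zero: "r > 0 \<Longrightarrow> x \<notin> cball x0 r \<Longrightarrow> ball_bump x0 r x = 0"
proof -
  show "ball_bump x0 r x \<ge> 0" by (simp add: ball_bump_def flat_def)
  show "r > 0 \<Longrightarrow> ball_bump x0 r x0 > 0" by (simp add: ball_bump_def flat_def)
  show "ball_bump x0 r x = 0" if "r > 0" "x \<notin> cball x0 r"
  proof -
    have "r < norm (x - x0)" using that by (simp add: dist_norm norm_minus_commute)
    then have "r\<^sup>2 \<le> (norm (x - x0))\<^sup>2" using that by (intro power_mono) auto
    then show ?thesis by (simp add: ball_bump_def flat_def)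
  qed
qed

lemma bump:
  assumes W: "open W" "p \<in> W"
  obtains \<rho> K where "\<rho> \<in> SF" "\<And>q. \<rho> q \<ge> 0" "\<rho> p > 0"
    "compact K" "K \<subseteq> W" "\<And>q. q \<notin> K \<Longrightarrow> \<rho> q = 0"
proof -
  obtain U \<phi> where U: "(U, \<phi>) \<in> M" "p \<in> U" by (rule chart_at)
  let ?T = "\<phi> ` (U \<inter> W)"
  have T: "open ?T" using W chart_open[OF U(1)] by (intro chart_open_image[OF U(1)]) auto
  moreover have "\<phi> p \<in> ?T" using W U by blast
  ultimately obtain r where r: "r > 0" "cball (\<phi> p) r \<subseteq> ?T"
    using open_contains_cball by blast
  let ?w = "ball_bump (\<phi> p) r"
  let ?f = "\<lambda>q. if q \<in> U \<and> \<phi> q \<in> ?T then ?w (\<phi> q) else 0"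
  let ?K = "inv_into U \<phi> ` cball (\<phi> p) r"
  show thesis
  proof (rule that[of ?f ?K])
    show "?f \<in> SF"
      using r ball_bump_zero[OF r(1)]
      by (intro cutoff[OF U(1) T smooth_on_ball_bump, where C="cball (\<phi> p) r"]
          compact_cball_fin_dim[OF finite_dimensional]) auto
    show "?f q \<ge> 0" for q using ball_bump_nonneg by simp
    show "?f p > 0" using U W ball_bump_pos[OF r(1)] by auto
    show "compact ?K"
      using r(2) by (intro compact_continuous_image continuous_on_subset[OF chart_inverse_continuous[OF U(1)]]
          compact_cball_fin_dim[OF finite_dimensional]) auto
    show "?K \<subseteq> W" using r(2) chart_inv[OF U(1)] by force
    show "?f q = 0" if "q \<notin> ?K" for q
    proof -
      have "\<phi> q \<notin> cball (\<phi> p) r" if "q \<in> U"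
        using \<open>q \<notin> ?K\<close> chart_inv[OF U(1) that] by (metis image_eqI)
      then show ?thesis using ball_bump_zero[OF r(1), of "\<phi> q"] by auto
    qed
  qed
qed

lemma tangent_linear:
  "v \<in> TM p \<Longrightarrow> f \<in> SF \<Longrightarrow> h \<in> SF \<Longrightarrow>
    v (\<lambda>x. a * f x + b * h x) = a * v f + b * v h"
  and tangent_mult: "v \<in> TM p \<Longrightarrow> f \<in> SF \<Longrightarrow> h \<in> SF \<Longrightarrow>
    v (\<lambda>x. f x * h x) = f p * v h + h p * v f"
  and tangent_nonsmooth: "v \<in> TM p \<Longrightarrow> f \<notin> SF \<Longrightarrow> v f = 0"
  unfolding tangent_space_def by blast+

lemma tangent_add: "v \<in> TM p \<Longrightarrow> f \<in> SF \<Longrightarrow> h \<in> SF \<Longrightarrow>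
    v (\<lambda>x. f x + h x) = v f + v h"
  using tangent_linear[of v p f h 1 1] by simp

lemma tangent_scale: "v \<in> TM p \<Longrightarrow> f \<in> SF \<Longrightarrow> v (\<lambda>x. c * f x) = c * v f"
  using tangent_linear[of v p f f c 0] by simp

lemma tangent_const:
  assumes "v \<in> TM p"
  shows "v (\<lambda>x. c) = 0"
proof -
  have "v (\<lambda>x. 1) = 0" using tangent_mult[OF assms smooth_const smooth_const, of 1 1] by simp
  then show ?thesis using tangent_scale[OF assms smooth_const, of c 1] by simp
qed

lemma tangent_sum:
  assumes "v \<in> TM p" "\<And>i. i \<in> I \<Longrightarrow> f i \<in> SF"
  shows "v (\<lambda>x. \<Sum>i\<in>I. f i x) = (\<Sum>i\<in>I. v (f i))"
  using assms(2)
proof (induction I rule: infinite_finite_induct)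
  case (insert i I)
  then show ?case
    using tangent_add[OF assms(1), of "f i" "\<lambda>x. \<Sum>i\<in>I. f i x"] smooth_sum[of I f] by simp
qed (simp_all add: tangent_const[OF assms(1)])

lemma tangent_subspace: "subspace (TM p)"
  unfolding subspace_def tangent_space_def
  by (auto simp: scaleR_fun_apply algebra_simps)

text \<open>Every derivation is a directional derivative in a chart. With a bump function \<open>\<rho>\<close> supported in the
chart, the Hadamard lemma becomes an identity between globally defined smooth functions,
\<open>\<rho>\<^sup>2 f = f(p) \<rho>\<^sup>2 + \<Sum> (\<rho> (x\<^sub>b - x\<^sub>b(p))) (\<rho> h\<^sub>b)\<close>, to which \<open>v\<close> can be applied. In the last sum the
first factors vanish at \<open>p\<close>, so only \<open>h\<^sub>b(p)\<close>, a partial derivative of \<open>f\<close>, survives.\<close>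

lemma tangent_directional:
  assumes v: "v \<in> TM p" and U: "(U, \<phi>) \<in> M" "p \<in> U"
  obtains w where "\<And>f. f \<in> SF \<Longrightarrow>
    v f = frechet_derivative (\<lambda>x. f (inv_into U \<phi> x)) (at (\<phi> p)) w"
proof -
  obtain B :: "'e set" where B: "finite B" "\<And>x. x = (\<Sum>b\<in>B. (x \<bullet> b) *\<^sub>R b)"
    using orthonormal_expansion[OF finite_dimensional] by metis
  let ?x0 = "\<phi> p"
  obtain R where R: "R > 0" "ball ?x0 R \<subseteq> \<phi> ` U"
    using chart_image_open[OF U(1)] U(2) open_contains_ball by blast
  let ?T = "ball ?x0 R" and ?C = "cball ?x0 (R / 2)" and ?\<beta> = "ball_bump ?x0 (R / 2)"
  define ext where "ext u q = (if q \<in> U \<and> \<phi> q \<in> ?T then ?\<beta> (\<phi> q) * u (\<phi> q) else 0)" for u q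
  have ext: "ext u \<in> SF" if "smooth_on ?T u" for u
    unfolding ext_def using R ball_bump_zero[of "R/2"]
    by (intro cutoff[OF U(1) open_ball _ compact_cball_fin_dim[OF finite_dimensional, of ?x0 "R/2"]]
        smooth_on_mult[OF open_ball smooth_on_ball_bump that]) auto
  have ext_p: "ext u p = ?\<beta> ?x0 * u ?x0" for u using U R by (simp add: ext_def)
  have \<beta>: "?\<beta> ?x0 > 0" using ball_bump_pos[of "R/2"] R by simp
  have coord: "smooth_on ?T (\<lambda>x. (x - ?x0) \<bullet> b)" for b
  proof -
    have "smooth_on ?T (\<lambda>x. x \<bullet> b + (- (?x0 \<bullet> b)))"
      by (intro smooth_on_add smooth_on_const smooth_on_bounded_linear[OF _ bounded_linear_inner_left]
          smooth_on_id open_ball)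
    then show ?thesis by (simp add: inner_diff_left)
  qed
  \<comment> \<open>the value of \<open>v\<close> on the cut-off coordinates; the division compensates for the value of the bump at \<open>p\<close>\<close>
  define w where "w = (\<Sum>b\<in>B. (v (ext (\<lambda>x. (x - ?x0) \<bullet> b)) / ?\<beta> ?x0) *\<^sub>R b)"
  have "v f = frechet_derivative (\<lambda>x. f (inv_into U \<phi> x)) (at ?x0) w" if f: "f \<in> SF" for f
  proof -
    let ?F = "\<lambda>x. f (inv_into U \<phi> x)"
    have F: "smooth_on ?T ?F" using smooth_functionsD[OF f U(1)] R(2) by (rule smooth_on_subset)
    obtain h where h: "\<And>b. smooth_on ?T (h b)"
      "\<And>x. x \<in> ?T \<Longrightarrow> ?F x = ?F ?x0 + (\<Sum>b\<in>B. ((x - ?x0) \<bullet> b) * h b x)"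
      "\<And>b. h b ?x0 = frechet_derivative ?F (at ?x0) b"
      using hadamard[OF finite_dimensional F B] by blast
    have F0: "?F ?x0 = f p" using chart_inv[OF U] by simp
    let ?\<rho> = "ext (\<lambda>x. 1)"
    have \<rho>: "?\<rho> \<in> SF" using ext[OF smooth_on_const] .
    have \<rho>2: "(\<lambda>q. ?\<rho> q * ?\<rho> q) \<in> SF" by (rule smooth_mult[OF \<rho> \<rho>])
    have prod: "(\<lambda>q. ext (\<lambda>x. (x - ?x0) \<bullet> b) q * ext (h b) q) \<in> SF" for b
      by (intro smooth_mult ext coord h)
    have eq: "(\<lambda>q. (?\<rho> q * ?\<rho> q) * f q)
        = (\<lambda>q. f p * (?\<rho> q * ?\<rho> q) + (\<Sum>b\<in>B. ext (\<lambda>x. (x - ?x0) \<bullet> b) q * ext (h b) q))"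
    proof
      fix q
      show "(?\<rho> q * ?\<rho> q) * f q
        = f p * (?\<rho> q * ?\<rho> q) + (\<Sum>b\<in>B. ext (\<lambda>x. (x - ?x0) \<bullet> b) q * ext (h b) q)"
      proof (cases "q \<in> U \<and> \<phi> q \<in> ?T")
        case True
        then have "f q = f p + (\<Sum>b\<in>B. ((\<phi> q - ?x0) \<bullet> b) * h b (\<phi> q))"
          using h(2)[of "\<phi> q"] F0 chart_inv[OF U(1), of q] by simp
        then show ?thesis
          using True by (simp add: ext_def algebra_simps sum_distrib_left)
      qed (auto simp: ext_def)
    qed
    have "v (\<lambda>q. (?\<rho> q * ?\<rho> q) * f q) = (?\<beta> ?x0 * ?\<beta> ?x0) * v f + f p * v (\<lambda>q. ?\<rho> q * ?\<rho> q)"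
      using tangent_mult[OF v \<rho>2 f] ext_p by simp
    moreover have "v (\<lambda>q. (?\<rho> q * ?\<rho> q) * f q) = f p * v (\<lambda>q. ?\<rho> q * ?\<rho> q)
        + (\<Sum>b\<in>B. v (\<lambda>q. ext (\<lambda>x. (x - ?x0) \<bullet> b) q * ext (h b) q))"
      unfolding eq tangent_add[OF v smooth_mult[OF smooth_const \<rho>2] smooth_sum[OF prod]]
        tangent_scale[OF v \<rho>2] tangent_sum[OF v prod] ..
    moreover have "v (\<lambda>q. ext (\<lambda>x. (x - ?x0) \<bullet> b) q * ext (h b) q)
        = ?\<beta> ?x0 * h b ?x0 * v (ext (\<lambda>x. (x - ?x0) \<bullet> b))" for b
      using tangent_mult[OF v ext[OF coord] ext[OF h(1)], of b b] ext_p by simp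
    ultimately have "(?\<beta> ?x0 * ?\<beta> ?x0) * v f
        = (\<Sum>b\<in>B. ?\<beta> ?x0 * h b ?x0 * v (ext (\<lambda>x. (x - ?x0) \<bullet> b)))" by simp
    also have "\<dots> = (?\<beta> ?x0 * ?\<beta> ?x0) * (\<Sum>b\<in>B. (v (ext (\<lambda>x. (x - ?x0) \<bullet> b)) / ?\<beta> ?x0) * h b ?x0)"
      using \<beta> by (simp add: sum_distrib_left field_simps)
    also have "(\<Sum>b\<in>B. (v (ext (\<lambda>x. (x - ?x0) \<bullet> b)) / ?\<beta> ?x0) * h b ?x0) = frechet_derivative ?F (at ?x0) w"
    proof -
      have "linear (frechet_derivative ?F (at ?x0))"
        using has_derivative_linear[OF smooth_on_has_derivative[OF F]] R by simp
      then show ?thesis by (simp add: w_def h(3) linear_sum linear_cmul)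
    qed
    finally show ?thesis using \<beta> by simp
  qed
  then show thesis using that by blast
qed

text \<open>Multiplying \<open>f\<close> by a bump function supported where \<open>f\<close> vanishes gives the zero function.\<close>

lemma tangent_local:
  assumes v: "v \<in> TM p" and f: "f \<in> SF"
    and W: "open W" "p \<in> W" "\<And>q. q \<in> W \<Longrightarrow> f q = 0"
  shows "v f = 0"
proof -
  obtain \<rho> K where \<rho>: "\<rho> \<in> SF" "\<rho> p > 0" "K \<subseteq> W" "\<And>q. q \<notin> K \<Longrightarrow> \<rho> q = 0"
    using bump[OF W(1,2)] by metis
  have "(\<lambda>q. \<rho> q * f q) = (\<lambda>q. 0)" using \<rho> W by fastforce
  then have "\<rho> p * v f + f p * v \<rho> = 0"
    using tangent_mult[OF v \<rho>(1) f] tangent_const[OF v, of 0] by simp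
  then show ?thesis using W \<rho> by auto
qed

end

section \<open>Left-invariant and right-invariant fields\<close>

lemma partial_derivative_fst:
  assumes F: "smooth_on S F" and "(a, b) \<in> S"
  shows "frechet_derivative (\<lambda>x. F (x, b)) (at a) v = frechet_derivative F (at (a, b)) (v, 0)"
proof -
  have "((\<lambda>x. (x, b)) has_derivative (\<lambda>v. (v, 0))) (at a)"
    by (intro has_derivative_Pair has_derivative_ident has_derivative_const)
  from has_derivative_compose[OF this smooth_on_has_derivative[OF assms]]
  show ?thesis using frechet_derivative_at by metis
qed

lemma partial_derivative_snd:
  assumes F: "smooth_on S F" and "(a, b) \<in> S"
  shows "frechet_derivative (\<lambda>y. F (a, y)) (at b) v = frechet_derivative F (at (a, b)) (0, v)"
proof -
  have "((\<lambda>y. (a, y)) has_derivative (\<lambda>v. (0, v))) (at b)"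
    by (intro has_derivative_Pair has_derivative_ident has_derivative_const)
  from has_derivative_compose[OF this smooth_on_has_derivative[OF assms]]
  show ?thesis using frechet_derivative_at by metis
qed

lemma inv_into_map_prod:
  assumes "inj_on f A" "inj_on g B" "x \<in> f ` A" "y \<in> g ` B"
  shows "inv_into (A \<times> B) (map_prod f g) (x, y) = (inv_into A f x, inv_into B g y)"
  using assms by (intro inv_into_f_eq map_prod_inj_on) (auto simp: inv_into_into f_inv_into_f)

lemma smooth_on_slice_fst:
  assumes "smooth_on S F" "open T" "\<And>x. x \<in> T \<Longrightarrow> (x, b) \<in> S"
  shows "smooth_on T (\<lambda>x. F (x, b))"
proof -
  have "smooth_on T (\<lambda>x. F ((x, 0) + (0, b)))"
    by (rule smooth_on_affine[OF assms(2) _ assms(1)])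
      (auto intro: assms(3) bounded_linear_Pair bounded_linear_ident bounded_linear_zero)
  then show ?thesis by simp
qed

lemma smooth_on_slice_snd:
  assumes "smooth_on S F" "open T" "\<And>y. y \<in> T \<Longrightarrow> (a, y) \<in> S"
  shows "smooth_on T (\<lambda>y. F (a, y))"
proof -
  have "smooth_on T (\<lambda>y. F ((0, y) + (a, 0)))"
    by (rule smooth_on_affine[OF assms(2) _ assms(1)])
      (auto intro: assms(3) bounded_linear_Pair bounded_linear_ident bounded_linear_zero)
  then show ?thesis by simp
qed

context smooth_manifold
begin

text \<open>The coordinate domain on which the smoothness of a map \<open>m\<close>, in product charts and a chart with domain
\<open>W\<close>, is required.\<close>

lemma product_chart_preimage:
  fixes m :: "'a \<times> 'a \<Rightarrow> 'a"
  assumes U: "(U, \<phi>) \<in> M" and V: "(V, \<psi>) \<in> M" and m: "continuous_on UNIV m" and W: "open W"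
  shows "open (map_prod \<phi> \<psi> ` (U \<times> V \<inter> m -` W))"
    and "z \<in> map_prod \<phi> \<psi> ` (U \<times> V \<inter> m -` W) \<Longrightarrow>
      inv_into (U \<times> V) (map_prod \<phi> \<psi>) z = (inv_into U \<phi> (fst z), inv_into V \<psi> (snd z)) \<and>
      m (inv_into U \<phi> (fst z), inv_into V \<psi> (snd z)) \<in> W"
proof -
  let ?D = "\<phi> ` U \<times> \<psi> ` V" and ?inv = "\<lambda>z. (inv_into U \<phi> (fst z), inv_into V \<psi> (snd z))"
  have S: "map_prod \<phi> \<psi> ` (U \<times> V \<inter> m -` W) = {z \<in> ?D. ?inv z \<in> m -` W}"
    using chart_inv[OF U] chart_inv[OF V] by (auto intro!: rev_image_eqI)
  have "open ?D" using chart_image_open U V by (intro open_Times) auto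
  moreover have "continuous_on ?D ?inv"
    by (intro continuous_on_Pair continuous_on_compose2[OF chart_inverse_continuous[OF U]]
        continuous_on_compose2[OF chart_inverse_continuous[OF V]] continuous_intros) auto
  ultimately have "open (?inv -` (m -` W) \<inter> ?D)"
    using continuous_on_open_vimage open_vimage[OF W m] by blast
  then show "open (map_prod \<phi> \<psi> ` (U \<times> V \<inter> m -` W))"
    unfolding S by (simp add: vimage_def Int_def conj_commute)
  have inj: "inj_on \<phi> U" "inj_on \<psi> V" using chart_inv U V by (auto intro: inj_on_inverseI)
  show "inv_into (U \<times> V) (map_prod \<phi> \<psi>) z = ?inv z \<and> m (?inv z) \<in> W"
    if "z \<in> map_prod \<phi> \<psi> ` (U \<times> V \<inter> m -` W)"
    using that inv_into_map_prod[OF inj, of "fst z" "snd z"] unfolding S by auto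
qed

end

context lie_group
begin

lemma continuous_mul: "continuous_on UNIV (\<lambda>(x, y). mul x y)"
  using smooth_mul unfolding smooth_map_def by blast

text \<open>Passing to the opposite group exchanges left and right, so that every statement about left
translations yields its mirror image.\<close>

lemma opposite_lie_group: "lie_group M (\<lambda>x y. mul y x) e iv"
proof (intro lie_group.intro lie_group_axioms.intro)
  show "smooth_manifold M" by (rule smooth_manifold_axioms)
  show "group (\<lambda>x y. mul y x) e iv"
    by standard (simp_all add: assoc)
  show "smooth_map M M iv" by (rule smooth_iv)
  show "smooth_map (product_atlas M M) M (\<lambda>(x, y). mul y x)"
    unfolding smooth_map_def product_atlas_def
  proof (safe)
    have "continuous_on UNIV (\<lambda>p. (snd p, fst p) :: 'a \<times> 'a)" by (intro continuous_intros)
    from continuous_on_compose2[OF continuous_mul this]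
    show c: "continuous_on UNIV (\<lambda>(x, y). mul y x)" by (simp add: case_prod_unfold)
    fix U \<phi> V \<psi> W \<kappa> assume U: "(U, \<phi>) \<in> M" and V: "(V, \<psi>) \<in> M" and W: "(W, \<kappa>) \<in> M"
    let ?S = "map_prod \<psi> \<phi> ` ((V \<times> U) \<inter> (\<lambda>(x, y). mul x y) -` W)"
    let ?T = "map_prod \<phi> \<psi> ` ((U \<times> V) \<inter> (\<lambda>(x, y). mul y x) -` W)"
    let ?G = "\<lambda>z. \<kappa> (case inv_into (V \<times> U) (map_prod \<psi> \<phi>) z of (x, y) \<Rightarrow> mul x y)"
    have G: "smooth_on ?S ?G"
      using smooth_mul U V W unfolding smooth_map_def product_atlas_def by fast
    have "open ?T" by (rule product_chart_preimage[OF U V c chart_open[OF W]])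
    moreover have "bounded_linear (\<lambda>z. (snd z, fst z) :: 'e \<times> 'e)"
      by (intro bounded_linear_Pair bounded_linear_fst bounded_linear_snd)
    moreover have "(snd z, fst z) + 0 \<in> ?S" if "z \<in> ?T" for z
      using that by force
    ultimately have "smooth_on ?T (\<lambda>z. ?G ((snd z, fst z) + 0))"
      by (rule smooth_on_affine[OF _ _ G])
    then show "smooth_on ?T (\<lambda>z. \<kappa> (case inv_into (U \<times> V) (map_prod \<phi> \<psi>) z of (x, y) \<Rightarrow> mul y x))"
    proof (rule smooth_on_cong[OF \<open>open ?T\<close>])
      fix z assume z: "z \<in> ?T"
      then have "(snd z, fst z) \<in> ?S" by force
      with z show "?G ((snd z, fst z) + 0) = \<kappa> (case inv_into (U \<times> V) (map_prod \<phi> \<psi>) z of (x, y) \<Rightarrow> mul y x)"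
        using product_chart_preimage(2)[OF U V c chart_open[OF W], of z]
          product_chart_preimage(2)[OF V U continuous_mul chart_open[OF W], of "(snd z, fst z)"] by simp
    qed
  qed
qed

lemma smooth_mul_in_charts:
  assumes f: "f \<in> SF" and U: "(U, \<phi>) \<in> M" and V: "(V, \<psi>) \<in> M"
  shows "smooth_on (\<phi> ` U \<times> \<psi> ` V) (\<lambda>z. f (mul (inv_into U \<phi> (fst z)) (inv_into V \<psi> (snd z))))"
    (is "smooth_on ?D ?F")
proof (rule smooth_on_local)
  fix z assume "z \<in> ?D"
  then obtain x y where xy: "x \<in> U" "y \<in> V" "z = (\<phi> x, \<psi> y)" by auto
  obtain W \<kappa> where W: "(W, \<kappa>) \<in> M" "mul x y \<in> W" by (rule chart_at)
  let ?m = "\<lambda>(x, y). mul x y"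
  let ?S = "map_prod \<phi> \<psi> ` ((U \<times> V) \<inter> ?m -` W)"
  let ?G = "\<lambda>z. \<kappa> (?m (inv_into (U \<times> V) (map_prod \<phi> \<psi>) z))"
  have G: "smooth_on ?S ?G"
    using smooth_mul U V W(1) unfolding smooth_map_def product_atlas_def by fast
  note S = product_chart_preimage[OF U V continuous_mul chart_open[OF W(1)]]
  have "smooth_on ?S (\<lambda>z. f (inv_into W \<kappa> (?G z)))"
    using S(2) by (intro smooth_on_compose[OF finite_dimensional S(1) G smooth_functionsD[OF f W(1)]]) auto
  then have "smooth_on ?S ?F"
    using S(2) chart_inv[OF W(1)] by (elim smooth_on_cong[OF S(1)]) auto
  moreover have "z \<in> ?S" using xy W by force
  ultimately show "\<exists>T. open T \<and> z \<in> T \<and> smooth_on T ?F" using S(1) by blast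
qed

lemma smooth_left_translate:
  assumes f: "f \<in> SF"
  shows "(\<lambda>x. f (mul h x)) \<in> SF"
  unfolding smooth_functions_def
proof clarify
  fix V \<psi> assume V: "(V, \<psi>) \<in> M"
  obtain U \<phi> where U: "(U, \<phi>) \<in> M" "h \<in> U" by (rule chart_at)
  show "smooth_on (\<psi> ` V) (\<lambda>x. f (mul h (inv_into V \<psi> x)))"
    using smooth_on_slice_snd[OF smooth_mul_in_charts[OF f U(1) V] chart_image_open[OF V], of "\<phi> h"] U
    by (simp add: chart_inv)
qed

definition left_field :: "'a tangent \<Rightarrow> 'a vfield"
  where "left_field v p f = (if f \<in> SF then v (\<lambda>x. f (mul p x)) else 0)"

lemma differential_left_translation:
  assumes v: "v \<in> TM p"
  shows "differential M (mul h) v \<in> TM (mul h p)"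
  using assms unfolding tangent_space_def differential_def
  by (auto simp: smooth_left_translate smooth_linear smooth_mult)

text \<open>In charts, \<open>p \<mapsto> v (f \<circ> L\<^sub>p)\<close> is a partial derivative of the smooth function \<open>(p, x) \<mapsto> f (p x)\<close>, because \<open>v\<close>
is a directional derivative.\<close>

lemma left_field_smooth:
  assumes v: "v \<in> TM e" and f: "f \<in> SF"
  shows "left_field v \<triangleright> f \<in> SF"
  unfolding smooth_functions_def
proof clarify
  fix V \<psi> assume V: "(V, \<psi>) \<in> M"
  obtain U \<phi> where U: "(U, \<phi>) \<in> M" "e \<in> U" by (rule chart_at)
  obtain w where w: "\<And>f. f \<in> SF \<Longrightarrow>
      v f = frechet_derivative (\<lambda>x. f (inv_into U \<phi> x)) (at (\<phi> e)) w"
    using tangent_directional[OF v U] by blast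
  let ?F = "\<lambda>z. f (mul (inv_into V \<psi> (fst z)) (inv_into U \<phi> (snd z)))"
  have F: "smooth_on (\<psi> ` V \<times> \<phi> ` U) ?F" by (rule smooth_mul_in_charts[OF f V U(1)])
  have "smooth_on (\<psi> ` V) (\<lambda>z. frechet_derivative ?F (at (z, \<phi> e)) (0, w))"
    using U by (intro smooth_on_slice_fst[OF smooth_on_frechet_derivative[OF F] chart_image_open[OF V]]) auto
  then show "smooth_on (\<psi> ` V) (\<lambda>x. (left_field v \<triangleright> f) (inv_into V \<psi> x))"
  proof (rule smooth_on_cong[OF chart_image_open[OF V]])
    fix z assume z: "z \<in> \<psi> ` V"
    have "(left_field v \<triangleright> f) (inv_into V \<psi> z)
        = frechet_derivative (\<lambda>y. ?F (z, y)) (at (\<phi> e)) w"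
      using f w[OF smooth_left_translate[OF f]] by (simp add: vf_apply_def left_field_def)
    then show "frechet_derivative ?F (at (z, \<phi> e)) (0, w) = (left_field v \<triangleright> f) (inv_into V \<psi> z)"
      using partial_derivative_snd[OF F, of z "\<phi> e" w] z U by simp
  qed
qed

lemma left_field_tangent:
  assumes v: "v \<in> TM e"
  shows "left_field v p \<in> TM p"
proof -
  have "left_field v p = differential M (mul p) v"
    by (simp add: left_field_def differential_def fun_eq_iff)
  then show ?thesis using differential_left_translation[OF v, of p] by simp
qed

lemma left_field_vector_field:
  "v \<in> TM e \<Longrightarrow> left_field v \<in> VF"
  unfolding vector_fields_def using left_field_tangent left_field_smooth by blast

lemma left_field_invariant:
  assumes v: "v \<in> TM e"
  shows "left_field v \<in> left_invariant_fields M mul"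
  unfolding left_invariant_fields_def
  using left_field_vector_field[OF v]
  by (auto simp: left_field_def differential_def fun_eq_iff smooth_left_translate assoc)

lemma left_invariant_eq_left_field:
  assumes "X \<in> left_invariant_fields M mul"
  shows "X = left_field (X e)"
proof (intro ext)
  fix p f
  have "X (mul p e) = differential M (mul p) (X e)"
    using assms unfolding left_invariant_fields_def by blast
  then show "X p f = left_field (X e) p f" by (simp add: differential_def left_field_def)
qed

definition right_field :: "'a tangent \<Rightarrow> 'a vfield"
  where "right_field v p f = (if f \<in> SF then v (\<lambda>x. f (mul x p)) else 0)"

lemma opposite_left_field: "lie_group.left_field M (\<lambda>x y. mul y x) = right_field"
  by (simp add: fun_eq_iff right_field_def lie_group.left_field_def[OF opposite_lie_group])

lemmas right_field_vector_field =
  lie_group.left_field_vector_field[OF opposite_lie_group, unfolded opposite_left_field]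

lemmas smooth_right_translate = lie_group.smooth_left_translate[OF opposite_lie_group]

text \<open>In a chart at \<open>e\<close> both sides are the mixed second partial derivative of \<open>(y, x) \<mapsto> f (y x)\<close> in the
directions that represent \<open>w\<close> and \<open>v\<close>.\<close>

lemma identity_derivations_commute:
  assumes v: "v \<in> TM e" and w: "w \<in> TM e" and f: "f \<in> SF"
  shows "v (\<lambda>x. w (\<lambda>y. f (mul y x))) = w (\<lambda>y. v (\<lambda>x. f (mul y x)))"
proof -
  obtain U \<phi> where U: "(U, \<phi>) \<in> M" "e \<in> U" by (rule chart_at)
  obtain v' where v': "\<And>f. f \<in> SF \<Longrightarrow>
      v f = frechet_derivative (\<lambda>x. f (inv_into U \<phi> x)) (at (\<phi> e)) v'"
    using tangent_directional[OF v U] by blast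
  obtain w' where w': "\<And>f. f \<in> SF \<Longrightarrow>
      w f = frechet_derivative (\<lambda>x. f (inv_into U \<phi> x)) (at (\<phi> e)) w'"
    using tangent_directional[OF w U] by blast
  let ?o = "\<phi> e" and ?D = "\<phi> ` U"
  let ?F = "\<lambda>z. f (mul (inv_into U \<phi> (fst z)) (inv_into U \<phi> (snd z)))"
  have F: "smooth_on (?D \<times> ?D) ?F" by (rule smooth_mul_in_charts[OF f U(1) U(1)])
  have o: "?o \<in> ?D" using U by blast
  have oD: "open ?D" by (rule chart_image_open[OF U(1)])
  have fv: "(\<lambda>x. v (\<lambda>y. f (mul x y))) \<in> SF"
    using left_field_smooth[OF v f] f by (simp add: vf_apply_def left_field_def)
  have fw: "(\<lambda>x. w (\<lambda>y. f (mul y x))) \<in> SF"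
    using lie_group.left_field_smooth[OF opposite_lie_group w f] f
    by (simp add: vf_apply_def opposite_left_field right_field_def)
  have 1: "w (\<lambda>y. f (mul y (inv_into U \<phi> z))) = frechet_derivative ?F (at (?o, z)) (w', 0)" if "z \<in> ?D" for z
    using w'[OF smooth_right_translate[OF f]] partial_derivative_fst[OF F, of ?o z w'] that o by simp
  have 2: "v (\<lambda>x. f (mul (inv_into U \<phi> z) x)) = frechet_derivative ?F (at (z, ?o)) (0, v')" if "z \<in> ?D" for z
    using v'[OF smooth_left_translate[OF f]] partial_derivative_snd[OF F, of z ?o v'] that o by simp
  have cong: "frechet_derivative h (at ?o) u = frechet_derivative k (at ?o) u"
    if "smooth_on ?D h" "\<And>z. z \<in> ?D \<Longrightarrow> h z = k z" for h k :: "'e \<Rightarrow> real" and u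
    using has_derivative_transform_within_open[OF smooth_on_has_derivative[OF that(1) o] oD o, of k] that(2)
      frechet_derivative_at by metis
  have s1: "smooth_on ?D (\<lambda>z. frechet_derivative ?F (at (?o, z)) (w', 0))"
    using o by (intro smooth_on_slice_snd[OF smooth_on_frechet_derivative[OF F] oD]) auto
  have s2: "smooth_on ?D (\<lambda>z. frechet_derivative ?F (at (z, ?o)) (0, v'))"
    using o by (intro smooth_on_slice_fst[OF smooth_on_frechet_derivative[OF F] oD]) auto
  have "v (\<lambda>x. w (\<lambda>y. f (mul y x)))
      = frechet_derivative (\<lambda>z. frechet_derivative ?F (at (?o, z)) (w', 0)) (at ?o) v'"
    unfolding v'[OF fw] by (rule cong[symmetric, OF s1]) (simp add: 1)
  also have "\<dots> = frechet_derivative (\<lambda>z. frechet_derivative ?F (at z) (w', 0)) (at (?o, ?o)) (0, v')"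
    using o by (intro partial_derivative_snd[OF smooth_on_frechet_derivative[OF F]]) auto
  also have "\<dots> = frechet_derivative (\<lambda>z. frechet_derivative ?F (at z) (0, v')) (at (?o, ?o)) (w', 0)"
    using o oD by (intro mixed_partials_commute[OF F] open_Times) auto
  also have "\<dots> = frechet_derivative (\<lambda>z. frechet_derivative ?F (at (z, ?o)) (0, v')) (at ?o) w'"
    using o by (intro partial_derivative_fst[OF smooth_on_frechet_derivative[OF F], symmetric]) auto
  also have "\<dots> = w (\<lambda>y. v (\<lambda>x. f (mul y x)))"
    unfolding w'[OF fv] by (rule cong[OF s2]) (simp add: 2)
  finally show ?thesis .
qed

text \<open>At the identity this is the symmetry of mixed partial derivatives. At \<open>p\<close>, rewriting
\<open>f (y p x) = f (p (p\<^sup>-\<^sup>1 y p) x)\<close> reduces it to that case, with \<open>f \<circ> L\<^sub>p\<close> in place of \<open>f\<close> and the conjugated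
derivation \<open>w'\<close> in place of \<open>w\<close>.\<close>

lemma left_right_commute:
  assumes v: "v \<in> TM e" and w: "w \<in> TM e"
  shows "lie_bracket (left_field v) (right_field w) = 0"
proof (intro ext)
  fix p f
  have nz: "(\<lambda>p. 0::real) \<in> SF" by (rule smooth_const)
  show "lie_bracket (left_field v) (right_field w) p f = 0 p f"
  proof (cases "f \<in> SF")
    case False
    then have "left_field v \<triangleright> f = (\<lambda>x. 0)" "right_field w \<triangleright> f = (\<lambda>x. 0)"
      by (auto simp: vf_apply_def left_field_def right_field_def)
    then show ?thesis
      using tangent_const[OF v] tangent_const[OF w]
      by (simp add: lie_bracket_def left_field_def right_field_def)
  next
    case f: True
    define w' where "w' h = (if h \<in> SF then w (\<lambda>y. h (mul (iv p) (mul y p))) else 0)" for h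
    have conj: "(\<lambda>y. h (mul (iv p) (mul y p))) \<in> SF" if "h \<in> SF" for h
      using smooth_right_translate[OF smooth_left_translate[OF that]] .
    have w': "w' \<in> TM e"
      unfolding tangent_space_def w'_def
      using tangent_linear[OF w conj conj] tangent_mult[OF w conj conj] smooth_linear smooth_mult
      by (auto simp: left_inverse)
    let ?fp = "\<lambda>x. f (mul p x)"
    have fp: "?fp \<in> SF" by (rule smooth_left_translate[OF f])
    have trans: "w (\<lambda>y. h (mul y p)) = w' (\<lambda>y. h (mul p y))" if "h \<in> SF" for h
      using smooth_left_translate[OF that] by (simp add: w'_def assoc[symmetric])
    have X: "left_field v \<triangleright> f \<in> SF" by (rule left_field_smooth[OF v f])
    have Y: "right_field w \<triangleright> f \<in> SF"
      using right_field_vector_field[OF w] f unfolding vector_fields_def by blast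
    have "left_field v p (right_field w \<triangleright> f) = v (\<lambda>x. w (\<lambda>y. f (mul (mul y p) x)))"
      using Y f by (simp add: left_field_def right_field_def vf_apply_def assoc)
    also have "\<dots> = v (\<lambda>x. w' (\<lambda>y. ?fp (mul y x)))"
      using trans[OF smooth_right_translate[OF f]] by (simp add: assoc)
    also have "\<dots> = w' (\<lambda>y. v (\<lambda>x. ?fp (mul y x)))"
      by (rule identity_derivations_commute[OF v w' fp])
    also have "\<dots> = w (\<lambda>y. (left_field v \<triangleright> f) (mul y p))"
      unfolding trans[OF X] using f by (simp add: left_field_def vf_apply_def assoc)
    also have "\<dots> = right_field w p (left_field v \<triangleright> f)"
      using X by (simp add: right_field_def)
    finally show ?thesis by (simp add: lie_bracket_def)
  qed
qed

end

section \<open>Traces, vector fields and left-invariant frames\<close>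

text \<open>The trace may be computed with any finite spanning family \<open>a\<close> and linear coefficient functions \<open>c\<close>
that expand every vector. With respect to a basis \<open>B\<close>, expanding \<open>L b\<close> by the hypothesis on \<open>L\<close> gives
\<open>\<Sum>\<^sub>i \<Sum>\<^sub>b c\<^sub>i(b) (L a\<^sub>i)\<^sub>b\<close>, and the inner sum is \<open>c\<^sub>i(L a\<^sub>i)\<close> by linearity.\<close>

lemma trace_on_eq:
  fixes V :: "'v::real_vector set" and a :: "'i \<Rightarrow> 'v" and c :: "'i \<Rightarrow> 'v \<Rightarrow> real"
  assumes V: "subspace V" and I: "finite I" and a: "\<And>i. i \<in> I \<Longrightarrow> a i \<in> V"
    and exp: "\<And>v. v \<in> V \<Longrightarrow> v = (\<Sum>i\<in>I. c i v *\<^sub>R a i)"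
    and c: "\<And>i r u v. i \<in> I \<Longrightarrow> u \<in> V \<Longrightarrow> v \<in> V \<Longrightarrow> c i (r *\<^sub>R u + v) = r * c i u + c i v"
    and L: "\<And>i. i \<in> I \<Longrightarrow> L (a i) \<in> V" "\<And>v. v \<in> V \<Longrightarrow> L v = (\<Sum>i\<in>I. c i v *\<^sub>R L (a i))"
  shows "trace_on V L = (\<Sum>i\<in>I. c i (L (a i)))"
proof -
  define B where "B = (SOME B. B \<subseteq> V \<and> independent B \<and> V \<subseteq> span B)"
  have "\<exists>B. B \<subseteq> V \<and> independent B \<and> V \<subseteq> span B" using basis_exists by metis
  then have B: "B \<subseteq> V" "independent B" "V \<subseteq> span B"
    unfolding B_def using someI_ex[of "\<lambda>B. B \<subseteq> V \<and> independent B \<and> V \<subseteq> span B"] by blast+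
  have "V \<subseteq> span (a ` I)"
  proof
    fix v assume "v \<in> V"
    have "(\<Sum>i\<in>I. c i v *\<^sub>R a i) \<in> span (a ` I)" by (intro span_sum span_scale span_base) auto
    then show "v \<in> span (a ` I)" using exp[OF \<open>v \<in> V\<close>] by simp
  qed
  then have fin: "finite B" using independent_span_bound[of "a ` I" B] I B by blast
  have c0: "c i 0 = 0" if "i \<in> I" for i
    using c[OF that, of 0 0 1] subspace_0[OF V] by simp
  have csum: "c i (\<Sum>b\<in>B'. r b *\<^sub>R b) = (\<Sum>b\<in>B'. r b * c i b)" if "i \<in> I" "finite B'" "B' \<subseteq> V" for i r B'
    using that(2,3)
  proof induction
    case (insert b B')
    then show ?case
      using c[OF that(1), of b "\<Sum>b\<in>B'. r b *\<^sub>R b" "r b"]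
      by (auto simp: subspace_sum[OF V] subspace_scale[OF V] subset_iff)
  qed (simp add: c0[OF that(1)])
  have rep: "representation B (L b) b = (\<Sum>i\<in>I. c i b * representation B (L (a i)) b)" if "b \<in> B" for b
  proof -
    have "representation B (L b) = representation B (\<Sum>i\<in>I. c i b *\<^sub>R L (a i))"
      using L(2)[of b] that B by auto
    also have "\<dots> = (\<lambda>b'. \<Sum>i\<in>I. representation B (c i b *\<^sub>R L (a i)) b')"
      using B L(1) by (intro representation_sum span_scale) auto
    also have "\<dots> = (\<lambda>b'. \<Sum>i\<in>I. c i b * representation B (L (a i)) b')"
      using B L(1) by (intro ext sum.cong) (auto simp: representation_scale subset_iff)
    finally show ?thesis by metis
  qed
  have "trace_on V L = (\<Sum>b\<in>B. representation B (L b) b)"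
    by (simp add: trace_on_def B_def Let_def)
  also have "\<dots> = (\<Sum>b\<in>B. \<Sum>i\<in>I. c i b * representation B (L (a i)) b)"
    using rep by (intro sum.cong) auto
  also have "\<dots> = (\<Sum>i\<in>I. \<Sum>b\<in>B. c i b * representation B (L (a i)) b)"
    by (rule sum.swap)
  also have "\<dots> = (\<Sum>i\<in>I. c i (L (a i)))"
  proof (rule sum.cong[OF refl])
    fix i assume i: "i \<in> I"
    have "L (a i) = (\<Sum>b\<in>B. representation B (L (a i)) b *\<^sub>R b)"
      using sum_representation_eq[OF B(2) _ fin order_refl, of "L (a i)"] L(1)[OF i] B(3) by auto
    then show "(\<Sum>b\<in>B. c i b * representation B (L (a i)) b) = c i (L (a i))"
      using csum[OF i fin B(1), of "representation B (L (a i))"] by (simp add: mult.commute)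
  qed
  finally show ?thesis .
qed

context smooth_manifold
begin

lemma vector_field_tangent: "X \<in> VF \<Longrightarrow> X p \<in> TM p"
  and vector_field_smooth: "X \<in> VF \<Longrightarrow> f \<in> SF \<Longrightarrow> X \<triangleright> f \<in> SF"
  unfolding vector_fields_def by blast+

lemma vector_field_add: "X \<in> VF \<Longrightarrow> Y \<in> VF \<Longrightarrow> X + Y \<in> VF"
  using smooth_add subspace_add[OF tangent_subspace]
  unfolding vector_fields_def vf_apply_def by (auto simp: plus_fun_def)

lemma vector_field_mult: "f \<in> SF \<Longrightarrow> X \<in> VF \<Longrightarrow> f \<odot> X \<in> VF"
  using smooth_mult subspace_scale[OF tangent_subspace]
  unfolding vector_fields_def vf_apply_def vf_scale_def by (auto simp: scaleR_fun_apply)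

lemma vector_field_0: "0 \<in> VF"
  using smooth_const[of 0] subspace_0[OF tangent_subspace]
  unfolding vector_fields_def vf_apply_def by (auto simp: zero_fun_def)

lemma vector_field_sum: "(\<And>i. i \<in> I \<Longrightarrow> X i \<in> VF) \<Longrightarrow> (\<Sum>i\<in>I. X i) \<in> VF"
  by (induction I rule: infinite_finite_induct) (auto intro: vector_field_0 vector_field_add)

lemma vector_field_scaleR: "X \<in> VF \<Longrightarrow> c *\<^sub>R X \<in> VF"
  using vector_field_mult[OF smooth_const[of c], of X] by (simp add: vf_scale_def scaleR_fun_def)

lemma nonsmooth_apply: "X \<in> VF \<Longrightarrow> f \<notin> SF \<Longrightarrow> X \<triangleright> f = (\<lambda>p. 0)"
  using tangent_nonsmooth vector_field_tangent unfolding vf_apply_def by blast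

lemma vector_field_bracket:
  assumes X: "X \<in> VF" and Y: "Y \<in> VF"
  shows "lie_bracket X Y \<in> VF"
proof -
  have "lie_bracket X Y p \<in> TM p" for p
    unfolding tangent_space_def
  proof (safe)
    fix f h a b assume f: "f \<in> SF" and h: "h \<in> SF"
    note Xt = vector_field_tangent[OF X] and Yt = vector_field_tangent[OF Y]
    note s = f h vector_field_smooth[OF X f] vector_field_smooth[OF X h]
      vector_field_smooth[OF Y f] vector_field_smooth[OF Y h]
    have "X \<triangleright> (\<lambda>x. a * f x + b * h x) = (\<lambda>x. a * (X \<triangleright> f) x + b * (X \<triangleright> h) x)"
      "Y \<triangleright> (\<lambda>x. a * f x + b * h x) = (\<lambda>x. a * (Y \<triangleright> f) x + b * (Y \<triangleright> h) x)"
      using tangent_linear[OF Xt f h] tangent_linear[OF Yt f h] by (simp_all add: vf_apply_def)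
    then show "lie_bracket X Y p (\<lambda>x. a * f x + b * h x) = a * lie_bracket X Y p f + b * lie_bracket X Y p h"
      using tangent_linear[OF Xt s(5,6)] tangent_linear[OF Yt s(3,4)]
      by (simp add: lie_bracket_def algebra_simps)
    have "X \<triangleright> (\<lambda>x. f x * h x) = (\<lambda>x. f x * (X \<triangleright> h) x + h x * (X \<triangleright> f) x)"
      "Y \<triangleright> (\<lambda>x. f x * h x) = (\<lambda>x. f x * (Y \<triangleright> h) x + h x * (Y \<triangleright> f) x)"
      using tangent_mult[OF Xt f h] tangent_mult[OF Yt f h] by (simp_all add: vf_apply_def)
    then show "lie_bracket X Y p (\<lambda>x. f x * h x) = f p * lie_bracket X Y p h + h p * lie_bracket X Y p f"
      using s by (simp add: lie_bracket_def tangent_add[OF Xt] tangent_add[OF Yt] smooth_mult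
          tangent_mult[OF Xt] tangent_mult[OF Yt]) (simp add: vf_apply_def algebra_simps)
  next
    fix f assume "f \<notin> SF"
    then show "lie_bracket X Y p f = 0"
      using nonsmooth_apply X Y tangent_const[OF vector_field_tangent[OF X]]
        tangent_const[OF vector_field_tangent[OF Y]] by (simp add: lie_bracket_def)
  qed
  moreover have "lie_bracket X Y \<triangleright> f \<in> SF" if f: "f \<in> SF" for f
    using smooth_diff[OF vector_field_smooth[OF X vector_field_smooth[OF Y f]]
        vector_field_smooth[OF Y vector_field_smooth[OF X f]]]
    by (simp add: vf_apply_def lie_bracket_def)
  ultimately show ?thesis unfolding vector_fields_def by blast
qed

lemma lie_bracket_skew: "lie_bracket X Y = - lie_bracket Y X"
  by (simp add: lie_bracket_def fun_eq_iff)

end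

locale lie_frame = lie_group M mul e iv
  for M :: "('a::{t2_space, second_countable_topology}, 'e::real_inner) chart set"
    and mul :: "'a \<Rightarrow> 'a \<Rightarrow> 'a" and e :: 'a and iv :: "'a \<Rightarrow> 'a" +
  fixes g :: "'a \<Rightarrow> 'a tangent \<Rightarrow> 'a tangent \<Rightarrow> real"
    and I :: "'i set" and A :: "'i \<Rightarrow> 'a vfield" and ginv :: "'i \<Rightarrow> 'i \<Rightarrow> real"
  assumes metric: "left_invariant_metric M mul g"
    and frame: "left_invariant_frame M mul I A"
    and ginv: "inverse_matrix_on I (metric_components g A e) ginv"
begin

lemma finite_I: "finite I" using frame unfolding left_invariant_frame_def by blast

lemma frame_left_invariant: "i \<in> I \<Longrightarrow> A i \<in> left_invariant_fields M mul"
  using frame span_base[of "A i" "A ` I"] unfolding left_invariant_frame_def by auto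

lemma frame_vector_field: "i \<in> I \<Longrightarrow> A i \<in> VF"
  using frame_left_invariant unfolding left_invariant_fields_def by blast

lemma frame_tangent: "i \<in> I \<Longrightarrow> A i p \<in> TM p"
  using frame_vector_field vector_field_tangent by blast

lemma g_riemannian: "riemannian_metric M g"
  using metric unfolding left_invariant_metric_def by blast

lemma g_sym: "u \<in> TM p \<Longrightarrow> v \<in> TM p \<Longrightarrow> g p u v = g p v u"
  using g_riemannian unfolding riemannian_metric_def by blast

lemma g_linear: "u \<in> TM p \<Longrightarrow> v \<in> TM p \<Longrightarrow> w \<in> TM p \<Longrightarrow> g p (a *\<^sub>R u + b *\<^sub>R v) w = a * g p u w + b * g p v w"
  using g_riemannian unfolding riemannian_metric_def by blast

lemma g_add: "u \<in> TM p \<Longrightarrow> v \<in> TM p \<Longrightarrow> w \<in> TM p \<Longrightarrow> g p (u + v) w = g p u w + g p v w"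
  using g_linear[of u p v w 1 1] by simp

lemma g_scale: "u \<in> TM p \<Longrightarrow> w \<in> TM p \<Longrightarrow> g p (a *\<^sub>R u) w = a * g p u w"
  using g_linear[of u p u w a 0] by simp

lemma g_zero: "w \<in> TM p \<Longrightarrow> g p 0 w = 0"
  using g_scale[of 0 p w 0] subspace_0[OF tangent_subspace] by simp

lemma g_sum: "(\<And>k. k \<in> K \<Longrightarrow> u k \<in> TM p) \<Longrightarrow> w \<in> TM p \<Longrightarrow> g p (\<Sum>k\<in>K. u k) w = (\<Sum>k\<in>K. g p (u k) w)"
  by (induction K rule: infinite_finite_induct)
    (auto simp: g_zero g_add subspace_sum[OF tangent_subspace])

lemma metric_constant:
  assumes "X \<in> left_invariant_fields M mul" "Y \<in> left_invariant_fields M mul"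
  shows "g p (X p) (Y p) = g e (X e) (Y e)"
proof -
  have XY: "X (mul p e) = differential M (mul p) (X e)" "Y (mul p e) = differential M (mul p) (Y e)"
    "X e \<in> TM e" "Y e \<in> TM e"
    using assms vector_field_tangent unfolding left_invariant_fields_def by blast+
  have "g (mul p e) (differential M (mul p) (X e)) (differential M (mul p) (Y e)) = g e (X e) (Y e)"
    using metric[unfolded left_invariant_metric_def, THEN conjunct2, rule_format, OF XY(3,4)] .
  then show ?thesis unfolding XY(1,2)[symmetric] by simp
qed

abbreviation G :: "'i \<Rightarrow> 'i \<Rightarrow> real" where "G \<equiv> metric_components g A e"

lemma g_frame: "i \<in> I \<Longrightarrow> j \<in> I \<Longrightarrow> g p (A i p) (A j p) = G i j"
  unfolding metric_components_def by (rule metric_constant[OF frame_left_invariant frame_left_invariant])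

lemma G_sym: "i \<in> I \<Longrightarrow> j \<in> I \<Longrightarrow> G i j = G j i"
  using g_frame g_sym frame_tangent by metis

lemma ginv_G: "i \<in> I \<Longrightarrow> k \<in> I \<Longrightarrow> (\<Sum>j\<in>I. ginv i j * G j k) = (if i = k then 1 else 0)"
  and G_ginv: "i \<in> I \<Longrightarrow> k \<in> I \<Longrightarrow> (\<Sum>j\<in>I. G i j * ginv j k) = (if i = k then 1 else 0)"
  using ginv unfolding inverse_matrix_on_def by auto

lemma sum_delta: "k \<in> I \<Longrightarrow> (\<Sum>j\<in>I. f j * (if j = k then 1 else 0)) = (f k :: real)"
  "k \<in> I \<Longrightarrow> (\<Sum>j\<in>I. f j * (if k = j then 1 else 0)) = (f k :: real)"
  "k \<in> I \<Longrightarrow> (\<Sum>j\<in>I. (if j = k then 1 else 0) * f j) = (f k :: real)"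
  "k \<in> I \<Longrightarrow> (\<Sum>j\<in>I. (if k = j then 1 else 0) * f j) = (f k :: real)"
  using finite_I by (simp_all add: if_distrib if_distribR cong: if_cong)

lemma ginv_sym:
  assumes "i \<in> I" "k \<in> I"
  shows "ginv i k = ginv k i"
proof -
  have "ginv i k = (\<Sum>j\<in>I. ginv i j * (\<Sum>l\<in>I. G j l * ginv k l))"
  proof -
    have "(\<Sum>l\<in>I. G j l * ginv k l) = (if j = k then 1 else 0)" if "j \<in> I" for j
      using ginv_G[OF assms(2) that] G_sym[OF that] that
      by (simp add: mult.commute eq_commute cong: sum.cong)
    then show ?thesis using sum_delta(1)[OF assms(2), of "ginv i"] by (simp cong: sum.cong)
  qed
  also have "\<dots> = (\<Sum>l\<in>I. (\<Sum>j\<in>I. ginv i j * G j l) * ginv k l)"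
    unfolding sum_distrib_left sum_distrib_right mult.assoc by (rule sum.swap)
  also have "\<dots> = ginv k i"
    using ginv_G[OF assms(1)] sum_delta(4)[OF assms(1), of "ginv k"] by (simp cong: sum.cong)
  finally show ?thesis .
qed

text \<open>The frame coefficients of a tangent vector, read off with the metric. As the metric of smooth
fields is smooth by definition and \<open>ginv\<close> is constant, this form makes the coefficients of a vector
field visibly smooth.\<close>

definition coef_at :: "'a \<Rightarrow> 'i \<Rightarrow> 'a tangent \<Rightarrow> real"
  where "coef_at p k v = (\<Sum>l\<in>I. ginv k l * g p v (A l p))"

lemma coef_at_linear: "u \<in> TM p \<Longrightarrow> v \<in> TM p \<Longrightarrow> coef_at p k (a *\<^sub>R u + v) = a * coef_at p k u + coef_at p k v"
  unfolding coef_at_def using g_linear[of u p v _ a 1] frame_tangent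
  by (simp add: sum_distrib_left sum.distrib algebra_simps cong: sum.cong)

lemma coef_at_zero: "coef_at p k 0 = 0"
  unfolding coef_at_def using g_zero frame_tangent by (simp cong: sum.cong)

lemma coef_at_add: "u \<in> TM p \<Longrightarrow> v \<in> TM p \<Longrightarrow> coef_at p k (u + v) = coef_at p k u + coef_at p k v"
  using coef_at_linear[of u p v k 1] by simp

lemma coef_at_scale: "u \<in> TM p \<Longrightarrow> coef_at p k (a *\<^sub>R u) = a * coef_at p k u"
  using coef_at_linear[of u p 0 k a] subspace_0[OF tangent_subspace] by (simp add: coef_at_zero)

lemma coef_at_sum: "(\<And>i. i \<in> J \<Longrightarrow> u i \<in> TM p) \<Longrightarrow> coef_at p k (\<Sum>i\<in>J. u i) = (\<Sum>i\<in>J. coef_at p k (u i))"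
  by (induction J rule: infinite_finite_induct)
    (auto simp: coef_at_zero coef_at_add subspace_sum[OF tangent_subspace])

lemma coef_at_frame: "i \<in> I \<Longrightarrow> k \<in> I \<Longrightarrow> coef_at p k (A i p) = (if k = i then 1 else 0)"
  unfolding coef_at_def using ginv_G[of k i] by (simp add: g_frame G_sym[of i] cong: sum.cong)

text \<open>Translate a tangent vector at \<open>p\<close> to the identity, extend it to a left-invariant field, and expand
that field in the frame.\<close>

lemma frame_span: "span ((\<lambda>i. A i p) ` I) = TM p"
proof
  show "span ((\<lambda>i. A i p) ` I) \<subseteq> TM p"
    using frame_tangent by (intro span_minimal tangent_subspace) auto
  show "TM p \<subseteq> span ((\<lambda>i. A i p) ` I)"
  proof
    fix w assume w: "w \<in> TM p"
    let ?v = "differential M (mul (iv p)) w"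
    have v: "?v \<in> TM e" using differential_left_translation[OF w, of "iv p"] by simp
    have "left_field ?v p f = w f" for f
      using tangent_nonsmooth[OF w] smooth_left_translate
      by (simp add: left_field_def differential_def assoc[symmetric])
    then have eq: "left_field ?v p = w" by blast
    have "left_field ?v \<in> span (A ` I)"
      using left_field_invariant[OF v] frame unfolding left_invariant_frame_def by blast
    then have "left_field ?v p \<in> span ((\<lambda>i. A i p) ` I)"
    proof (induction rule: span_induct_alt)
      case base
      then show ?case by (simp add: span_zero zero_fun_def[symmetric])
    next
      case (step c X Y)
      then have "X p \<in> span ((\<lambda>i. A i p) ` I)" by (blast intro: span_base)
      then have "c *\<^sub>R X p + Y p \<in> span ((\<lambda>i. A i p) ` I)" using step by (blast intro: span_add span_scale)
      moreover have "(c *\<^sub>R X + Y) p = c *\<^sub>R X p + Y p" by (simp add: scaleR_fun_apply fun_eq_iff)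
      ultimately show ?case by metis
    qed
    then show "w \<in> span ((\<lambda>i. A i p) ` I)" by (simp only: eq)
  qed
qed

lemma frame_expansion:
  assumes "v \<in> TM p"
  shows "v = (\<Sum>k\<in>I. coef_at p k v *\<^sub>R A k p)"
proof -
  have "v \<in> span ((\<lambda>i. A i p) ` I)" using assms frame_span by blast
  then have "v \<in> TM p \<and> v = (\<Sum>k\<in>I. coef_at p k v *\<^sub>R A k p)"
  proof (induction rule: span_induct_alt)
    case base
    show ?case by (simp only: coef_at_zero scaleR_zero_left sum.neutral_const subspace_0[OF tangent_subspace])
  next
    case (step c x y)
    then obtain i where i: "i \<in> I" "x = A i p" by blast
    have x: "x \<in> TM p" using frame_tangent i by blast
    have "(\<Sum>k\<in>I. coef_at p k x *\<^sub>R A k p) = (\<Sum>k\<in>I. if k = i then A k p else 0)"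
      using i by (intro sum.cong) (auto simp: coef_at_frame)
    also have "\<dots> = x" using i finite_I by simp
    finally have "(\<Sum>k\<in>I. coef_at p k x *\<^sub>R A k p) = x" .
    moreover have "(\<Sum>k\<in>I. coef_at p k (c *\<^sub>R x + y) *\<^sub>R A k p)
        = c *\<^sub>R (\<Sum>k\<in>I. coef_at p k x *\<^sub>R A k p) + (\<Sum>k\<in>I. coef_at p k y *\<^sub>R A k p)"
      using x step by (simp only: coef_at_linear scaleR_add_left sum.distrib scaleR_sum_right scaleR_scaleR)
    moreover have "c *\<^sub>R x + y \<in> TM p"
      using x step by (blast intro: subspace_add[OF tangent_subspace] subspace_scale[OF tangent_subspace])
    ultimately show ?case using step by metis
  qed
  then show ?thesis by blast
qed

definition coef :: "'a vfield \<Rightarrow> 'i \<Rightarrow> 'a \<Rightarrow> real"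
  where "coef X k = (\<lambda>p. coef_at p k (X p))"

lemma coef_smooth:
  assumes "X \<in> VF"
  shows "coef X k \<in> SF"
proof -
  have "(\<lambda>p. g p (X p) (A l p)) \<in> SF" if "l \<in> I" for l
    using g_riemannian assms frame_vector_field[OF that] unfolding riemannian_metric_def by blast
  then show ?thesis
    unfolding coef_def coef_at_def by (intro smooth_sum smooth_mult smooth_const)
qed

lemma coef_frame: "i \<in> I \<Longrightarrow> k \<in> I \<Longrightarrow> coef (A i) k = (\<lambda>p. if k = i then 1 else 0)"
  by (simp add: coef_def coef_at_frame)

lemma coef_left_invariant:
  assumes "X \<in> left_invariant_fields M mul"
  shows "coef X k p = coef X k e"
  unfolding coef_def coef_at_def
  by (intro sum.cong refl arg_cong2[where f="(*)"] metric_constant[OF assms frame_left_invariant])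

lemma vector_field_expansion:
  assumes "X \<in> VF"
  shows "X = (\<Sum>k\<in>I. coef X k \<odot> A k)"
proof
  fix p
  show "X p = (\<Sum>k\<in>I. coef X k \<odot> A k) p"
    by (subst sum_fun_apply, unfold vf_scale_def coef_def)
      (rule frame_expansion[OF vector_field_tangent[OF assms]])
qed

lemma field_expansion_at: "X \<in> VF \<Longrightarrow> X p f = (\<Sum>k\<in>I. coef X k p * A k p f)"
  using arg_cong[OF vector_field_expansion, of X "\<lambda>X. X p f"]
  by (simp add: sum_fun_apply vf_scale_def scaleR_fun_apply)

text \<open>The Leibniz rule for the bracket of \<open>\<Sum> x\<^sub>i A\<^sub>i\<close> and \<open>\<Sum> y\<^sub>j A\<^sub>j\<close>.\<close>

lemma bracket_in_frame:
  assumes X: "X \<in> VF" and Y: "Y \<in> VF"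
  shows "lie_bracket X Y p = (\<Sum>j\<in>I. (X p (coef Y j) - Y p (coef X j)) *\<^sub>R A j p)
    + (\<Sum>i\<in>I. \<Sum>j\<in>I. (coef X i p * coef Y j p) *\<^sub>R lie_bracket (A i) (A j) p)"
proof
  fix f
  have iter: "X p (Y \<triangleright> f) = (\<Sum>j\<in>I. X p (coef Y j) * A j p f)
      + (\<Sum>i\<in>I. \<Sum>j\<in>I. coef X i p * coef Y j p * A i p (A j \<triangleright> f))"
    if X: "X \<in> VF" and Y: "Y \<in> VF" and f: "f \<in> SF" for X Y
  proof -
    have s: "A j \<triangleright> f \<in> SF" if "j \<in> I" for j by (rule vector_field_smooth[OF frame_vector_field[OF that] f])
    have "Y \<triangleright> f = (\<lambda>p. \<Sum>j\<in>I. coef Y j p * (A j \<triangleright> f) p)"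
      using field_expansion_at[OF Y] by (simp add: vf_apply_def)
    then have "X p (Y \<triangleright> f) = (\<Sum>j\<in>I. X p (\<lambda>p. coef Y j p * (A j \<triangleright> f) p))"
      using tangent_sum[OF vector_field_tangent[OF X], of I "\<lambda>j p. coef Y j p * (A j \<triangleright> f) p" p]
        smooth_mult[OF coef_smooth[OF Y] s] by simp
    also have "\<dots> = (\<Sum>j\<in>I. coef Y j p * X p (A j \<triangleright> f) + A j p f * X p (coef Y j))"
      using tangent_mult[OF vector_field_tangent[OF X] coef_smooth[OF Y] s]
      by (intro sum.cong) (auto simp: vf_apply_def)
    also have "\<dots> = (\<Sum>j\<in>I. X p (coef Y j) * A j p f) + (\<Sum>j\<in>I. \<Sum>i\<in>I. coef X i p * coef Y j p * A i p (A j \<triangleright> f))"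
      by (subst field_expansion_at[OF X, of p "A j \<triangleright> f" for j])
        (simp add: sum.distrib sum_distrib_left mult_ac)
    also have "(\<Sum>j\<in>I. \<Sum>i\<in>I. coef X i p * coef Y j p * A i p (A j \<triangleright> f))
        = (\<Sum>i\<in>I. \<Sum>j\<in>I. coef X i p * coef Y j p * A i p (A j \<triangleright> f))" by (rule sum.swap)
    finally show ?thesis .
  qed
  show "lie_bracket X Y p f = ((\<Sum>j\<in>I. (X p (coef Y j) - Y p (coef X j)) *\<^sub>R A j p)
    + (\<Sum>i\<in>I. \<Sum>j\<in>I. (coef X i p * coef Y j p) *\<^sub>R lie_bracket (A i) (A j) p)) f"
  proof (cases "f \<in> SF")
    case False
    have "lie_bracket (A i) (A j) p f = 0" if "i \<in> I" "j \<in> I" for i j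
      using tangent_nonsmooth[OF vector_field_tangent[OF vector_field_bracket[OF
            frame_vector_field[OF that(1)] frame_vector_field[OF that(2)]]] False] .
    moreover have "lie_bracket X Y p f = 0"
      using tangent_nonsmooth[OF vector_field_tangent[OF vector_field_bracket[OF X Y]] False] .
    moreover have "A i p f = 0" if "i \<in> I" for i
      using tangent_nonsmooth[OF frame_tangent[OF that] False] .
    ultimately show ?thesis by (simp add: sum_fun_apply scaleR_fun_apply cong: sum.cong)
  next
    case f: True
    have sw: "(\<Sum>i\<in>I. \<Sum>j\<in>I. coef Y i p * coef X j p * A i p (A j \<triangleright> f))
        = (\<Sum>i\<in>I. \<Sum>j\<in>I. coef X i p * coef Y j p * A j p (A i \<triangleright> f))"
      by (subst sum.swap) (simp add: mult_ac)
    show ?thesis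
      using iter[OF X Y f] iter[OF Y X f] unfolding sw
      by (simp add: lie_bracket_def[of X Y] sum_fun_apply scaleR_fun_apply lie_bracket_def[of "A _"]
          sum_subtractf left_diff_distrib right_diff_distrib)
  qed
qed

end

section \<open>Affine connections in a frame\<close>

context smooth_manifold begin

lemma connection_vector_field: "affine_connection M \<D> \<Longrightarrow> X \<in> VF \<Longrightarrow> Y \<in> VF \<Longrightarrow>
    \<D> X Y \<in> VF"
  and connection_add_left: "affine_connection M \<D> \<Longrightarrow> X \<in> VF \<Longrightarrow> X' \<in> VF \<Longrightarrow>
    Y \<in> VF \<Longrightarrow> \<D> (X + X') Y = \<D> X Y + \<D> X' Y"
  and connection_mult_left: "affine_connection M \<D> \<Longrightarrow> f \<in> SF \<Longrightarrow> X \<in> VF \<Longrightarrow>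
    Y \<in> VF \<Longrightarrow> \<D> (f \<odot> X) Y = f \<odot> \<D> X Y"
  and connection_add_right: "affine_connection M \<D> \<Longrightarrow> X \<in> VF \<Longrightarrow> Y \<in> VF \<Longrightarrow>
    Y' \<in> VF \<Longrightarrow> \<D> X (Y + Y') = \<D> X Y + \<D> X Y'"
  and connection_leibniz: "affine_connection M \<D> \<Longrightarrow> f \<in> SF \<Longrightarrow> X \<in> VF \<Longrightarrow>
    Y \<in> VF \<Longrightarrow> \<D> X (f \<odot> Y) = (X \<triangleright> f) \<odot> Y + f \<odot> \<D> X Y"
  and connection_default: "affine_connection M \<D> \<Longrightarrow> X \<notin> VF \<or> Y \<notin> VF \<Longrightarrow> \<D> X Y = 0"
  unfolding affine_connection_def by blast+

lemma connection_zero_left: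
  assumes "affine_connection M \<D>" "Y \<in> VF"
  shows "\<D> 0 Y = 0"
  using connection_add_left[OF assms(1) vector_field_0 vector_field_0 assms(2)] by simp

lemma connection_zero_right:
  assumes "affine_connection M \<D>" "X \<in> VF"
  shows "\<D> X 0 = 0"
  using connection_add_right[OF assms vector_field_0 vector_field_0] by simp

lemma connection_sum_left:
  assumes D: "affine_connection M \<D>" and Y: "Y \<in> VF" and X: "\<And>i. i \<in> J \<Longrightarrow> X i \<in> VF"
  shows "\<D> (\<Sum>i\<in>J. X i) Y = (\<Sum>i\<in>J. \<D> (X i) Y)"
  using X
proof (induction J rule: infinite_finite_induct)
  case (insert i J)
  have "\<D> (X i + (\<Sum>i\<in>J. X i)) Y = \<D> (X i) Y + \<D> (\<Sum>i\<in>J. X i) Y"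
    by (rule connection_add_left[OF D _ vector_field_sum Y]) (use insert.prems in auto)
  also have "\<D> (\<Sum>i\<in>J. X i) Y = (\<Sum>i\<in>J. \<D> (X i) Y)" by (rule insert.IH) (use insert.prems in auto)
  finally show ?case unfolding sum.insert[OF insert.hyps] .
qed (simp_all add: connection_zero_left[OF D Y])

lemma connection_sum_right:
  assumes D: "affine_connection M \<D>" and X: "X \<in> VF" and Y: "\<And>i. i \<in> J \<Longrightarrow> Y i \<in> VF"
  shows "\<D> X (\<Sum>i\<in>J. Y i) = (\<Sum>i\<in>J. \<D> X (Y i))"
  using Y
proof (induction J rule: infinite_finite_induct)
  case (insert i J)
  have "\<D> X (Y i + (\<Sum>i\<in>J. Y i)) = \<D> X (Y i) + \<D> X (\<Sum>i\<in>J. Y i)"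
    by (rule connection_add_right[OF D X _ vector_field_sum]) (use insert.prems in auto)
  also have "\<D> X (\<Sum>i\<in>J. Y i) = (\<Sum>i\<in>J. \<D> X (Y i))" by (rule insert.IH) (use insert.prems in auto)
  finally show ?case unfolding sum.insert[OF insert.hyps] .
qed (simp_all add: connection_zero_right[OF D X])

end

context lie_frame
begin

lemma connection_tensorial:
  assumes D: "affine_connection M \<D>" and X: "X \<in> VF" and Y: "Y \<in> VF"
  shows "\<D> X Y p = (\<Sum>i\<in>I. coef_at p i (X p) *\<^sub>R \<D> (A i) Y p)"
proof -
  have "\<D> X Y = \<D> (\<Sum>i\<in>I. coef X i \<odot> A i) Y"
    by (rule arg_cong[where f="\<lambda>X. \<D> X Y", OF vector_field_expansion[OF X]])
  also have "\<dots> = (\<Sum>i\<in>I. \<D> (coef X i \<odot> A i) Y)"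
    by (rule connection_sum_left[OF D Y]) (rule vector_field_mult[OF coef_smooth[OF X] frame_vector_field])
  also have "\<dots> = (\<Sum>i\<in>I. coef X i \<odot> \<D> (A i) Y)"
    by (rule sum.cong[OF refl]) (rule connection_mult_left[OF D coef_smooth[OF X] frame_vector_field Y])
  finally have "\<D> X Y p = (\<Sum>i\<in>I. coef X i \<odot> \<D> (A i) Y) p" by simp
  also have "\<dots> = (\<Sum>i\<in>I. (coef X i \<odot> \<D> (A i) Y) p)" by (rule sum_fun_apply)
  finally show ?thesis unfolding vf_scale_def coef_def .
qed

lemma connection_in_frame:
  assumes D: "affine_connection M \<D>" and X: "X \<in> VF" and Y: "Y \<in> VF"
  shows "\<D> X Y p = (\<Sum>j\<in>I. X p (coef Y j) *\<^sub>R A j p)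
    + (\<Sum>i\<in>I. \<Sum>j\<in>I. (coef X i p * coef Y j p) *\<^sub>R \<D> (A i) (A j) p)"
proof -
  have "\<D> X Y = \<D> X (\<Sum>j\<in>I. coef Y j \<odot> A j)"
    by (rule arg_cong[OF vector_field_expansion[OF Y]])
  also have "\<dots> = (\<Sum>j\<in>I. \<D> X (coef Y j \<odot> A j))"
    by (rule connection_sum_right[OF D X]) (rule vector_field_mult[OF coef_smooth[OF Y] frame_vector_field])
  also have "\<dots> = (\<Sum>j\<in>I. (X \<triangleright> coef Y j) \<odot> A j + coef Y j \<odot> \<D> X (A j))"
    by (rule sum.cong[OF refl]) (rule connection_leibniz[OF D coef_smooth[OF Y] X frame_vector_field])
  finally have "\<D> X Y p = (\<Sum>j\<in>I. (X \<triangleright> coef Y j) \<odot> A j + coef Y j \<odot> \<D> X (A j)) p" by simp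
  also have "\<dots> = (\<Sum>j\<in>I. ((X \<triangleright> coef Y j) \<odot> A j + coef Y j \<odot> \<D> X (A j)) p)" by (rule sum_fun_apply)
  also have "\<dots> = (\<Sum>j\<in>I. X p (coef Y j) *\<^sub>R A j p
      + (\<Sum>i\<in>I. (coef X i p * coef Y j p) *\<^sub>R \<D> (A i) (A j) p))"
  proof (rule sum.cong[OF refl])
    fix j assume j: "j \<in> I"
    have "((X \<triangleright> coef Y j) \<odot> A j + coef Y j \<odot> \<D> X (A j)) p
        = X p (coef Y j) *\<^sub>R A j p + coef Y j p *\<^sub>R \<D> X (A j) p"
      by (simp add: vf_scale_def vf_apply_def fun_eq_iff)
    also have "coef Y j p *\<^sub>R \<D> X (A j) p = (\<Sum>i\<in>I. (coef X i p * coef Y j p) *\<^sub>R \<D> (A i) (A j) p)"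
      unfolding connection_tensorial[OF D X frame_vector_field[OF j]] coef_def
      by (simp only: scaleR_sum_right scaleR_scaleR mult.commute)
    finally show "((X \<triangleright> coef Y j) \<odot> A j + coef Y j \<odot> \<D> X (A j)) p
        = X p (coef Y j) *\<^sub>R A j p + (\<Sum>i\<in>I. (coef X i p * coef Y j p) *\<^sub>R \<D> (A i) (A j) p)" .
  qed
  also have "\<dots> = (\<Sum>j\<in>I. X p (coef Y j) *\<^sub>R A j p)
    + (\<Sum>j\<in>I. \<Sum>i\<in>I. (coef X i p * coef Y j p) *\<^sub>R \<D> (A i) (A j) p)" by (rule sum.distrib)
  also have "(\<Sum>j\<in>I. \<Sum>i\<in>I. (coef X i p * coef Y j p) *\<^sub>R \<D> (A i) (A j) p)
    = (\<Sum>i\<in>I. \<Sum>j\<in>I. (coef X i p * coef Y j p) *\<^sub>R \<D> (A i) (A j) p)" by (rule sum.swap)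
  finally show ?thesis .
qed

text \<open>The connection with prescribed values \<open>\<Gamma> i j\<close> on the frame, extended by the connection axioms.\<close>

definition frame_connection :: "('i \<Rightarrow> 'i \<Rightarrow> 'a vfield) \<Rightarrow> 'a vfield \<Rightarrow> 'a vfield \<Rightarrow> 'a vfield"
  where "frame_connection \<Gamma> X Y = (if X \<in> VF \<and> Y \<in> VF then
    (\<lambda>p. (\<Sum>j\<in>I. X p (coef Y j) *\<^sub>R A j p) + (\<Sum>i\<in>I. \<Sum>j\<in>I. (coef X i p * coef Y j p) *\<^sub>R \<Gamma> i j p)) else 0)"

lemma connection_determined_by_frame:
  assumes D: "affine_connection M \<D>" and \<Gamma>: "\<And>i j. i \<in> I \<Longrightarrow> j \<in> I \<Longrightarrow> \<D> (A i) (A j) = \<Gamma> i j"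
  shows "\<D> = frame_connection \<Gamma>"
proof (rule ext, rule ext)
  fix X Y
  show "\<D> X Y = frame_connection \<Gamma> X Y"
  proof (cases "X \<in> VF \<and> Y \<in> VF")
    case True
    then have "\<D> X Y p = frame_connection \<Gamma> X Y p" for p
      unfolding frame_connection_def using connection_in_frame[OF D, of X Y p] \<Gamma>
      by (simp cong: sum.cong)
    then show ?thesis by blast
  qed (use connection_default[OF D] in \<open>auto simp: frame_connection_def\<close>)
qed

lemma coef_add: "X \<in> VF \<Longrightarrow> Y \<in> VF \<Longrightarrow> coef (X + Y) k = (\<lambda>p. coef X k p + coef Y k p)"
  using coef_at_add vector_field_tangent by (simp add: coef_def fun_eq_iff plus_fun_def)

lemma coef_mult: "X \<in> VF \<Longrightarrow> coef (f \<odot> X) k = (\<lambda>p. f p * coef X k p)"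
  using coef_at_scale vector_field_tangent by (simp add: coef_def vf_scale_def)

lemma frame_connection_vector_field:
  assumes \<Gamma>: "\<And>i j. i \<in> I \<Longrightarrow> j \<in> I \<Longrightarrow> \<Gamma> i j \<in> VF" and X: "X \<in> VF" and Y: "Y \<in> VF"
  shows "frame_connection \<Gamma> X Y \<in> VF"
proof -
  have "frame_connection \<Gamma> X Y = (\<Sum>j\<in>I. (X \<triangleright> coef Y j) \<odot> A j)
      + (\<Sum>i\<in>I. \<Sum>j\<in>I. (\<lambda>p. coef X i p * coef Y j p) \<odot> \<Gamma> i j)"
    using X Y by (intro ext) (simp add: frame_connection_def sum_fun_apply vf_apply_def vf_scale_def)
  then show ?thesis
    using \<Gamma> vector_field_smooth[OF X coef_smooth[OF Y]]
    by (auto intro!: vector_field_add vector_field_sum vector_field_mult smooth_mult coef_smooth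
        frame_vector_field X Y)
qed

lemma affine_frame_connection:
  assumes \<Gamma>: "\<And>i j. i \<in> I \<Longrightarrow> j \<in> I \<Longrightarrow> \<Gamma> i j \<in> VF"
  shows "affine_connection M (frame_connection \<Gamma>)"
  unfolding affine_connection_def
proof (intro conjI ballI allI impI)
  let ?D = "frame_connection \<Gamma>"
  note at = frame_connection_def
  show "?D X Y \<in> VF" if "X \<in> VF" "Y \<in> VF" for X Y
    using frame_connection_vector_field[OF \<Gamma> that] .
  show "?D (X + X') Y = ?D X Y + ?D X' Y" if X: "X \<in> VF" "X' \<in> VF" and Y: "Y \<in> VF" for X X' Y
  proof
    fix p
    have "?D (X + X') Y p = (\<Sum>j\<in>I. (X p (coef Y j) + X' p (coef Y j)) *\<^sub>R A j p)
      + (\<Sum>i\<in>I. \<Sum>j\<in>I. ((coef X i p + coef X' i p) * coef Y j p) *\<^sub>R \<Gamma> i j p)"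
      using X Y vector_field_add[OF X] by (simp add: at coef_add)
    also have "\<dots> = ?D X Y p + ?D X' Y p"
      using X Y by (simp only: at if_True simp_thms scaleR_add_left distrib_right sum.distrib add_ac)
    also have "\<dots> = (?D X Y + ?D X' Y) p" by simp
    finally show "?D (X + X') Y p = (?D X Y + ?D X' Y) p" .
  qed
  show "?D (f \<odot> X) Y = f \<odot> ?D X Y" if f: "f \<in> SF" and X: "X \<in> VF" and Y: "Y \<in> VF" for f X Y
  proof
    fix p
    have "?D (f \<odot> X) Y p = (\<Sum>j\<in>I. (f p * X p (coef Y j)) *\<^sub>R A j p)
      + (\<Sum>i\<in>I. \<Sum>j\<in>I. (f p * coef X i p * coef Y j p) *\<^sub>R \<Gamma> i j p)"
      using X Y vector_field_mult[OF f X] by (simp add: at coef_mult) (simp add: vf_scale_def scaleR_fun_apply)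
    also have "\<dots> = f p *\<^sub>R ?D X Y p"
      using X Y by (simp only: at if_True simp_thms scaleR_add_right scaleR_sum_right scaleR_scaleR mult.assoc)
    also have "\<dots> = (f \<odot> ?D X Y) p" by (simp add: vf_scale_def)
    finally show "?D (f \<odot> X) Y p = (f \<odot> ?D X Y) p" .
  qed
  show "?D X (Y + Y') = ?D X Y + ?D X Y'" if X: "X \<in> VF" and Y: "Y \<in> VF" "Y' \<in> VF" for X Y Y'
  proof
    fix p
    have "?D X (Y + Y') p = (\<Sum>j\<in>I. (X p (coef Y j) + X p (coef Y' j)) *\<^sub>R A j p)
      + (\<Sum>i\<in>I. \<Sum>j\<in>I. (coef X i p * (coef Y j p + coef Y' j p)) *\<^sub>R \<Gamma> i j p)"
      using X Y vector_field_add[OF Y]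
      by (simp add: at coef_add tangent_add[OF vector_field_tangent[OF X] coef_smooth coef_smooth])
    also have "\<dots> = ?D X Y p + ?D X Y' p"
      using X Y by (simp only: at if_True simp_thms scaleR_add_left distrib_left sum.distrib add_ac)
    also have "\<dots> = (?D X Y + ?D X Y') p" by simp
    finally show "?D X (Y + Y') p = (?D X Y + ?D X Y') p" .
  qed
  show "?D X (f \<odot> Y) = (X \<triangleright> f) \<odot> Y + f \<odot> ?D X Y" if f: "f \<in> SF" and X: "X \<in> VF" and Y: "Y \<in> VF" for f X Y
  proof
    fix p
    have "?D X (f \<odot> Y) p = (\<Sum>j\<in>I. (f p * X p (coef Y j) + coef Y j p * X p f) *\<^sub>R A j p)
      + (\<Sum>i\<in>I. \<Sum>j\<in>I. (f p * (coef X i p * coef Y j p)) *\<^sub>R \<Gamma> i j p)"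
      using X Y vector_field_mult[OF f Y]
      by (simp add: at coef_mult tangent_mult[OF vector_field_tangent[OF X] f coef_smooth] mult_ac)
    also have "\<dots> = X p f *\<^sub>R (\<Sum>j\<in>I. coef Y j p *\<^sub>R A j p) + f p *\<^sub>R ?D X Y p"
      using X Y by (simp only: at if_True simp_thms scaleR_add_right scaleR_add_left scaleR_sum_right
          scaleR_scaleR mult.commute[of _ "X p f"] sum.distrib add_ac)
    also have "(\<Sum>j\<in>I. coef Y j p *\<^sub>R A j p) = Y p"
      unfolding coef_def by (rule frame_expansion[OF vector_field_tangent[OF Y], symmetric])
    also have "X p f *\<^sub>R Y p + f p *\<^sub>R ?D X Y p = ((X \<triangleright> f) \<odot> Y + f \<odot> ?D X Y) p"
      by (simp add: vf_scale_def vf_apply_def)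
    finally show "?D X (f \<odot> Y) p = ((X \<triangleright> f) \<odot> Y + f \<odot> ?D X Y) p" .
  qed
  show "?D X Y = 0" if "X \<notin> VF \<or> Y \<notin> VF" for X Y
    using that by (auto simp: at)
qed

lemma frame_connection_frame:
  assumes i: "i \<in> I" and j: "j \<in> I"
  shows "frame_connection \<Gamma> (A i) (A j) = \<Gamma> i j"
proof
  fix p
  have "A i p (coef (A j) k) = 0" if "k \<in> I" for k
    using coef_frame[OF j that] tangent_const[OF frame_tangent[OF i]] by auto
  moreover have "(\<Sum>k\<in>I. \<Sum>l\<in>I. (coef (A i) k p * coef (A j) l p) *\<^sub>R \<Gamma> k l p)
      = (\<Sum>k\<in>I. if k = i then (\<Sum>l\<in>I. if l = j then \<Gamma> k l p else 0) else 0)"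
    using i j by (intro sum.cong refl) (auto simp: coef_frame intro!: sum.cong)
  then have "(\<Sum>k\<in>I. \<Sum>l\<in>I. (coef (A i) k p * coef (A j) l p) *\<^sub>R \<Gamma> k l p) = \<Gamma> i j p"
    by (simp only: sum.delta[OF finite_I] i j if_True)
  moreover have "(\<Sum>k\<in>I. A i p (coef (A j) k) *\<^sub>R A k p) = 0"
    using calculation(1) by (simp cong: sum.cong)
  ultimately show "frame_connection \<Gamma> (A i) (A j) p = \<Gamma> i j p"
    unfolding frame_connection_def using frame_vector_field[OF i] frame_vector_field[OF j]
    by (simp only: if_True simp_thms add_0_left)
qed

section \<open>The Lie-Cartan and Levi-Civita connections\<close>

text \<open>A left-invariant field has constant coefficients in the frame, so prescribing the connection on the
frame prescribes it on all left-invariant fields.\<close>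

lemma lie_cartan_connection_eq:
  "lie_cartan_connection M mul \<nu> = frame_connection (\<lambda>i j. \<nu> *\<^sub>R lie_bracket (A i) (A j))"
  (is "_ = frame_connection ?\<Gamma>")
  unfolding lie_cartan_connection_def
proof (rule the_equality)
  have \<Gamma>: "?\<Gamma> i j \<in> VF" if "i \<in> I" "j \<in> I" for i j
    by (intro vector_field_scaleR vector_field_bracket frame_vector_field that)
  have "frame_connection ?\<Gamma> X Y = \<nu> *\<^sub>R lie_bracket X Y"
    if X: "X \<in> left_invariant_fields M mul" and Y: "Y \<in> left_invariant_fields M mul" for X Y
  proof
    fix p
    have XY: "X \<in> VF" "Y \<in> VF" using X Y unfolding left_invariant_fields_def by auto
    have c: "coef Z k = (\<lambda>p. coef Z k e)" if "Z \<in> left_invariant_fields M mul" for Z k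
      using coef_left_invariant[OF that] by blast
    have z: "X p (coef Y k) = 0" "Y p (coef X k) = 0" for k
      using c[OF X, of k] c[OF Y, of k] tangent_const vector_field_tangent[OF XY(1)]
        vector_field_tangent[OF XY(2)] by metis+
    have "frame_connection ?\<Gamma> X Y p = (\<Sum>i\<in>I. \<Sum>j\<in>I. (coef X i p * coef Y j p) *\<^sub>R \<nu> *\<^sub>R lie_bracket (A i) (A j) p)"
      using XY z by (simp add: frame_connection_def scaleR_fun_apply)
    also have "\<dots> = \<nu> *\<^sub>R (\<Sum>i\<in>I. \<Sum>j\<in>I. (coef X i p * coef Y j p) *\<^sub>R lie_bracket (A i) (A j) p)"
      by (simp only: scaleR_sum_right scaleR_scaleR mult.commute)
    also have "\<dots> = \<nu> *\<^sub>R lie_bracket X Y p"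
      unfolding bracket_in_frame[OF XY] z by simp
    also have "\<dots> = (\<nu> *\<^sub>R lie_bracket X Y) p" by (rule scaleR_fun_apply[symmetric])
    finally show "frame_connection ?\<Gamma> X Y p = (\<nu> *\<^sub>R lie_bracket X Y) p" .
  qed
  then show "affine_connection M (frame_connection ?\<Gamma>) \<and>
    (\<forall>X\<in>left_invariant_fields M mul. \<forall>Y\<in>left_invariant_fields M mul.
       frame_connection ?\<Gamma> X Y = \<nu> *\<^sub>R lie_bracket X Y)"
    using affine_frame_connection[of ?\<Gamma>, OF \<Gamma>] by blast
  fix \<D> assume "affine_connection M \<D> \<and>
    (\<forall>X\<in>left_invariant_fields M mul. \<forall>Y\<in>left_invariant_fields M mul. \<D> X Y = \<nu> *\<^sub>R lie_bracket X Y)"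
  then show "\<D> = frame_connection ?\<Gamma>"
    using frame_left_invariant by (intro connection_determined_by_frame) blast+
qed

text \<open>The structure functions of the frame with the last index lowered by the metric.\<close>

definition structure_constant :: "'a \<Rightarrow> 'i \<Rightarrow> 'i \<Rightarrow> 'i \<Rightarrow> real"
  where "structure_constant p i j l = g p (lie_bracket (A i) (A j) p) (A l p)"

text \<open>The Koszul formula in the frame: the terms that differentiate \<open>g(A\<^sub>i, A\<^sub>j)\<close> are absent because these
functions are constant.\<close>

definition koszul :: "'a \<Rightarrow> 'i \<Rightarrow> 'i \<Rightarrow> 'i \<Rightarrow> real"
  where "koszul p i j l =
    (structure_constant p i j l - structure_constant p j l i + structure_constant p l i j) / 2"

text \<open>The covariant derivative of \<open>A\<^sub>j\<close> along \<open>A\<^sub>i\<close>, obtained by raising the last index of \<open>koszul\<close>.\<close>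

definition christoffel :: "'i \<Rightarrow> 'i \<Rightarrow> 'a vfield"
  where "christoffel i j = (\<Sum>k\<in>I. (\<lambda>p. \<Sum>l\<in>I. ginv k l * koszul p i j l) \<odot> A k)"

lemma bracket_frame_vector_field: "i \<in> I \<Longrightarrow> j \<in> I \<Longrightarrow> lie_bracket (A i) (A j) \<in> VF"
  by (intro vector_field_bracket frame_vector_field)

lemma structure_constant_skew:
  assumes "i \<in> I" "j \<in> I" "l \<in> I"
  shows "structure_constant p j i l = - structure_constant p i j l"
proof -
  have "lie_bracket (A j) (A i) p = (-1) *\<^sub>R lie_bracket (A i) (A j) p"
    by (subst lie_bracket_skew) (simp add: fun_eq_iff scaleR_fun_apply)
  then show ?thesis
    using g_scale[OF vector_field_tangent[OF bracket_frame_vector_field] frame_tangent, of i j l p "-1"] assms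
    by (simp add: structure_constant_def)
qed

lemma christoffel_vector_field:
  assumes "i \<in> I" "j \<in> I"
  shows "christoffel i j \<in> VF"
proof -
  have "(\<lambda>p. structure_constant p i j l) \<in> SF" if "i \<in> I" "j \<in> I" "l \<in> I" for i j l
    using g_riemannian bracket_frame_vector_field[OF that(1,2)] frame_vector_field[OF that(3)]
    unfolding riemannian_metric_def structure_constant_def by blast
  then have "(\<lambda>p. (1/2) * (structure_constant p i j l - structure_constant p j l i + structure_constant p l i j)) \<in> SF"
    if "l \<in> I" for l using that assms
    by (intro smooth_mult smooth_const smooth_add smooth_diff) auto
  then have "(\<lambda>p. koszul p i j l) \<in> SF" if "l \<in> I" for l
    using that unfolding koszul_def by simp
  then show ?thesis
    unfolding christoffel_def
    by (intro vector_field_sum vector_field_mult smooth_sum smooth_mult smooth_const frame_vector_field)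
qed

lemma g_christoffel:
  assumes "l \<in> I"
  shows "g p (christoffel i j p) (A l p) = koszul p i j l"
proof -
  have "christoffel i j p = (\<Sum>k\<in>I. (\<Sum>m\<in>I. ginv k m * koszul p i j m) *\<^sub>R A k p)"
    unfolding christoffel_def by (subst sum_fun_apply) (simp add: vf_scale_def)
  then have "g p (christoffel i j p) (A l p) = (\<Sum>k\<in>I. (\<Sum>m\<in>I. ginv k m * koszul p i j m) * G k l)"
    using assms frame_tangent
    by (simp add: g_sum subspace_scale[OF tangent_subspace] g_scale g_frame cong: sum.cong)
  also have "\<dots> = (\<Sum>k\<in>I. \<Sum>m\<in>I. koszul p i j m * (G l k * ginv k m))"
    using assms G_sym[OF assms] unfolding sum_distrib_right
    by (intro sum.cong refl) (simp add: mult_ac)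
  also have "\<dots> = (\<Sum>m\<in>I. koszul p i j m * (\<Sum>k\<in>I. G l k * ginv k m))"
    unfolding sum_distrib_left by (rule sum.swap)
  also have "\<dots> = koszul p i j l"
    using G_ginv[OF assms] sum_delta(2)[OF assms] by (simp cong: sum.cong)
  finally show ?thesis .
qed

lemma g_eqI:
  assumes "u \<in> TM p" "v \<in> TM p" "\<And>l. l \<in> I \<Longrightarrow> g p u (A l p) = g p v (A l p)"
  shows "u = v"
proof -
  have "coef_at p k u = coef_at p k v" for k unfolding coef_at_def using assms(3) by (simp cong: sum.cong)
  then show ?thesis using frame_expansion[OF assms(1)] frame_expansion[OF assms(2)] by presburger
qed

lemma g_expand:
  assumes u: "u \<in> TM p" and v: "v \<in> TM p"
  shows "g p u v = (\<Sum>k\<in>I. coef_at p k v * g p u (A k p))"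
proof -
  have "g p u v = g p (\<Sum>k\<in>I. coef_at p k v *\<^sub>R A k p) u"
    unfolding g_sym[OF u v] by (rule arg_cong[where f="\<lambda>v. g p v u", OF frame_expansion[OF v]])
  also have "\<dots> = (\<Sum>k\<in>I. coef_at p k v * g p (A k p) u)"
    using u frame_tangent by (simp add: g_sum g_scale subspace_scale[OF tangent_subspace] cong: sum.cong)
  finally show ?thesis using g_sym[OF u] frame_tangent by (simp cong: sum.cong)
qed

lemma koszul_torsion:
  "i \<in> I \<Longrightarrow> j \<in> I \<Longrightarrow> l \<in> I \<Longrightarrow> koszul p i j l - koszul p j i l = structure_constant p i j l"
  using structure_constant_skew[of i j l p] structure_constant_skew[of i l j p] structure_constant_skew[of j l i p]
  unfolding koszul_def by (simp add: field_simps)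

lemma koszul_metric:
  "i \<in> I \<Longrightarrow> j \<in> I \<Longrightarrow> l \<in> I \<Longrightarrow> koszul p i j l + koszul p i l j = 0"
  using structure_constant_skew[of i j l p] structure_constant_skew[of i l j p] structure_constant_skew[of j l i p]
  unfolding koszul_def by (simp add: field_simps)

lemma christoffel_torsion:
  assumes "i \<in> I" "j \<in> I"
  shows "christoffel i j p - christoffel j i p = lie_bracket (A i) (A j) p"
proof (rule g_eqI)
  let ?u = "christoffel i j p" and ?v = "christoffel j i p"
  have u: "?u \<in> TM p" "?v \<in> TM p" by (intro vector_field_tangent christoffel_vector_field assms)+
  then show "?u - ?v \<in> TM p" by (rule subspace_diff[OF tangent_subspace])
  show "lie_bracket (A i) (A j) p \<in> TM p"
    by (intro vector_field_tangent bracket_frame_vector_field assms)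
  fix l assume l: "l \<in> I"
  have "?u - ?v = 1 *\<^sub>R ?u + (-1) *\<^sub>R ?v" by simp
  then have "g p (?u - ?v) (A l p) = 1 * g p ?u (A l p) + (-1) * g p ?v (A l p)"
    using g_linear[OF u frame_tangent[OF l], of 1 "-1"] by (simp only:)
  then show "g p (?u - ?v) (A l p) = g p (lie_bracket (A i) (A j) p) (A l p)"
    using koszul_torsion[OF assms l, of p] by (simp add: g_christoffel[OF l] structure_constant_def)
qed

lemma christoffel_connection_torsion_free:
  assumes X: "X \<in> VF" and Y: "Y \<in> VF"
  shows "frame_connection christoffel X Y - frame_connection christoffel Y X = lie_bracket X Y"
proof
  fix p
  let ?D = "frame_connection christoffel"
  have sw: "(\<Sum>i\<in>I. \<Sum>j\<in>I. (coef Y i p * coef X j p) *\<^sub>R christoffel i j p)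
      = (\<Sum>i\<in>I. \<Sum>j\<in>I. (coef X i p * coef Y j p) *\<^sub>R christoffel j i p)"
    by (subst sum.swap) (simp only: mult.commute)
  have "(?D X Y - ?D Y X) p = ?D X Y p - ?D Y X p" by simp
  also have "\<dots> = (\<Sum>j\<in>I. (X p (coef Y j) - Y p (coef X j)) *\<^sub>R A j p)
    + (\<Sum>i\<in>I. \<Sum>j\<in>I. (coef X i p * coef Y j p) *\<^sub>R (christoffel i j p - christoffel j i p))"
    unfolding frame_connection_def using X Y
    by (simp only: simp_thms if_True sw scaleR_left_diff_distrib scaleR_right_diff_distrib sum_subtractf)
      (simp only: algebra_simps)
  also have "(\<Sum>i\<in>I. \<Sum>j\<in>I. (coef X i p * coef Y j p) *\<^sub>R (christoffel i j p - christoffel j i p))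
      = (\<Sum>i\<in>I. \<Sum>j\<in>I. (coef X i p * coef Y j p) *\<^sub>R lie_bracket (A i) (A j) p)"
    by (intro sum.cong refl arg_cong2[where f="(*\<^sub>R)"] christoffel_torsion)
  finally show "(?D X Y - ?D Y X) p = lie_bracket X Y p"
    unfolding bracket_in_frame[OF X Y] .
qed

text \<open>Expanding everything in the frame, the terms with derivatives of coefficients agree on both sides,
and the remaining terms cancel in pairs by the skew symmetry \<open>koszul_metric\<close>.\<close>

lemma christoffel_connection_metric:
  assumes X: "X \<in> VF" and Y: "Y \<in> VF" and Z: "Z \<in> VF"
  shows "X p (\<lambda>q. g q (Y q) (Z q)) =
    g p (frame_connection christoffel X Y p) (Z p) + g p (Y p) (frame_connection christoffel X Z p)"
proof -
  let ?D = "frame_connection christoffel"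
  have DT: "?D X Y p \<in> TM p" if "Y \<in> VF" for Y
    by (intro vector_field_tangent frame_connection_vector_field christoffel_vector_field X that)
  have lower: "g p (?D X Y p) (A k p) = (\<Sum>j\<in>I. X p (coef Y j) * G j k)
      + (\<Sum>i\<in>I. \<Sum>j\<in>I. coef X i p * coef Y j p * koszul p i j k)"
    if Y: "Y \<in> VF" and k: "k \<in> I" for Y k
  proof -
    have s: "(\<Sum>j\<in>I. X p (coef Y j) *\<^sub>R A j p) \<in> TM p" "\<And>i. i \<in> I \<Longrightarrow> (\<Sum>j\<in>I. (coef X i p * coef Y j p) *\<^sub>R christoffel i j p) \<in> TM p"
      "(\<Sum>i\<in>I. \<Sum>j\<in>I. (coef X i p * coef Y j p) *\<^sub>R christoffel i j p) \<in> TM p"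
      by (intro subspace_sum subspace_scale tangent_subspace frame_tangent vector_field_tangent
          christoffel_vector_field; assumption)+
    show ?thesis
      using X Y k s frame_tangent vector_field_tangent[OF christoffel_vector_field]
      by (simp add: frame_connection_def g_add g_sum subspace_scale[OF tangent_subspace] g_scale g_frame
          g_christoffel cong: sum.cong)
  qed
  have left: "g p (?D X Y p) (Z p) = (\<Sum>k\<in>I. \<Sum>j\<in>I. coef Z k p * X p (coef Y j) * G j k)
      + (\<Sum>k\<in>I. \<Sum>i\<in>I. \<Sum>j\<in>I. coef Z k p * coef X i p * coef Y j p * koszul p i j k)"
    if Y: "Y \<in> VF" and Z: "Z \<in> VF" for Y Z
    unfolding g_expand[OF DT[OF Y] vector_field_tangent[OF Z]] coef_def[of Z, symmetric]
    by (simp add: lower[OF Y] coef_def[of Z] distrib_left sum.distrib sum_distrib_left mult_ac cong: sum.cong)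
  have cancel: "(\<Sum>k\<in>I. \<Sum>i\<in>I. \<Sum>j\<in>I. coef Y k p * coef X i p * coef Z j p * koszul p i j k)
      = - (\<Sum>k\<in>I. \<Sum>i\<in>I. \<Sum>j\<in>I. coef Z k p * coef X i p * coef Y j p * koszul p i j k)"
  proof -
    have "(\<Sum>k\<in>I. \<Sum>i\<in>I. \<Sum>j\<in>I. coef Y k p * coef X i p * coef Z j p * koszul p i j k)
        = (\<Sum>i\<in>I. \<Sum>k\<in>I. \<Sum>j\<in>I. coef Y k p * coef X i p * coef Z j p * koszul p i j k)"
      by (rule sum.swap)
    also have "\<dots> = (\<Sum>i\<in>I. \<Sum>j\<in>I. \<Sum>k\<in>I. coef Y k p * coef X i p * coef Z j p * koszul p i j k)"
      by (intro sum.cong refl sum.swap)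
    also have "\<dots> = (\<Sum>j\<in>I. \<Sum>i\<in>I. \<Sum>k\<in>I. coef Y k p * coef X i p * coef Z j p * koszul p i j k)"
      by (rule sum.swap)
    also have "\<dots> = (\<Sum>j\<in>I. \<Sum>i\<in>I. \<Sum>k\<in>I. - (coef Z j p * coef X i p * coef Y k p * koszul p i k j))"
    proof (intro sum.cong refl)
      fix i j k assume "i \<in> I" "j \<in> I" "k \<in> I"
      then have "koszul p i j k = - koszul p i k j" using koszul_metric[of i j k p] by simp
      then show "coef Y k p * coef X i p * coef Z j p * koszul p i j k
          = - (coef Z j p * coef X i p * coef Y k p * koszul p i k j)" by simp
    qed
    finally show ?thesis by (simp only: sum_negf)
  qed
  have "(\<lambda>q. g q (Y q) (Z q)) = (\<lambda>q. \<Sum>k\<in>I. \<Sum>j\<in>I. G j k * (coef Z k q * coef Y j q))"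
  proof
    fix q
    have "g q (Y q) (Z q) = (\<Sum>k\<in>I. coef Z k q * g q (Y q) (A k q))"
      unfolding coef_def by (rule g_expand[OF vector_field_tangent[OF Y] vector_field_tangent[OF Z]])
    also have "\<dots> = (\<Sum>k\<in>I. coef Z k q * (\<Sum>j\<in>I. coef Y j q * G j k))"
    proof (intro sum.cong refl arg_cong2[where f="(*)"])
      fix k assume k: "k \<in> I"
      have "g q (Y q) (A k q) = g q (A k q) (Y q)" by (rule g_sym[OF vector_field_tangent[OF Y] frame_tangent[OF k]])
      also have "\<dots> = (\<Sum>j\<in>I. coef Y j q * g q (A k q) (A j q))"
        unfolding coef_def by (rule g_expand[OF frame_tangent[OF k] vector_field_tangent[OF Y]])
      finally show "g q (Y q) (A k q) = (\<Sum>j\<in>I. coef Y j q * G j k)"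
        using k by (simp add: g_frame G_sym cong: sum.cong)
    qed
    finally show "g q (Y q) (Z q) = (\<Sum>k\<in>I. \<Sum>j\<in>I. G j k * (coef Z k q * coef Y j q))"
      by (simp add: sum_distrib_left mult_ac)
  qed
  moreover have "X p (\<lambda>q. \<Sum>k\<in>I. \<Sum>j\<in>I. G j k * (coef Z k q * coef Y j q))
      = (\<Sum>k\<in>I. \<Sum>j\<in>I. G j k * (coef Z k p * X p (coef Y j) + coef Y j p * X p (coef Z k)))"
  proof -
    note Xp = vector_field_tangent[OF X, of p]
    have s1: "(\<lambda>q. coef Z k q * coef Y j q) \<in> SF" for k j by (intro smooth_mult coef_smooth Y Z)
    have s2: "(\<lambda>q. G j k * (coef Z k q * coef Y j q)) \<in> SF" for k j by (intro smooth_mult smooth_const s1)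
    show ?thesis
      by (simp only: tangent_sum[OF Xp smooth_sum[OF s2]] tangent_sum[OF Xp s2] tangent_scale[OF Xp s1]
          tangent_mult[OF Xp coef_smooth[OF Z] coef_smooth[OF Y]])
  qed
  moreover have "\<dots> = (\<Sum>k\<in>I. \<Sum>j\<in>I. coef Z k p * X p (coef Y j) * G j k)
      + (\<Sum>k\<in>I. \<Sum>j\<in>I. coef Y k p * X p (coef Z j) * G j k)"
  proof -
    have "(\<Sum>k\<in>I. \<Sum>j\<in>I. G j k * (coef Y j p * X p (coef Z k)))
        = (\<Sum>k\<in>I. \<Sum>j\<in>I. coef Y k p * X p (coef Z j) * G j k)"
      by (subst sum.swap, intro sum.cong refl) (simp add: G_sym mult_ac)
    then show ?thesis by (simp add: distrib_left sum.distrib mult_ac)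
  qed
  ultimately show ?thesis
    using left[OF Y Z] left[OF Z Y] cancel g_sym[OF vector_field_tangent[OF Y] DT[OF Z]] by simp
qed

text \<open>For uniqueness, the Koszul formula is recovered from the torsion and metric conditions on the frame
alone.\<close>

lemma levi_civita_eq: "levi_civita M g = frame_connection christoffel"
  unfolding levi_civita_def
proof (rule the_equality)
  show "affine_connection M (frame_connection christoffel) \<and>
    (\<forall>X\<in>VF. \<forall>Y\<in>VF. frame_connection christoffel X Y - frame_connection christoffel Y X = lie_bracket X Y) \<and>
    (\<forall>X\<in>VF. \<forall>Y\<in>VF. \<forall>Z\<in>VF. \<forall>p. X p (\<lambda>q. g q (Y q) (Z q)) =
      g p (frame_connection christoffel X Y p) (Z p) + g p (Y p) (frame_connection christoffel X Z p))"
    using affine_frame_connection[of christoffel, OF christoffel_vector_field] christoffel_connection_torsion_free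
      christoffel_connection_metric by blast
next
  fix \<D> assume "affine_connection M \<D> \<and>
    (\<forall>X\<in>VF. \<forall>Y\<in>VF. \<D> X Y - \<D> Y X = lie_bracket X Y) \<and>
    (\<forall>X\<in>VF. \<forall>Y\<in>VF. \<forall>Z\<in>VF. \<forall>p. X p (\<lambda>q. g q (Y q) (Z q)) = g p (\<D> X Y p) (Z p) + g p (Y p) (\<D> X Z p))"
  then have D: "affine_connection M \<D>"
    and tor: "\<And>X Y. X \<in> VF \<Longrightarrow> Y \<in> VF \<Longrightarrow> \<D> X Y - \<D> Y X = lie_bracket X Y"
    and met: "\<And>X Y Z p. X \<in> VF \<Longrightarrow> Y \<in> VF \<Longrightarrow> Z \<in> VF \<Longrightarrow>
      X p (\<lambda>q. g q (Y q) (Z q)) = g p (\<D> X Y p) (Z p) + g p (Y p) (\<D> X Z p)" by blast+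
  show "\<D> = frame_connection christoffel"
  proof (rule connection_determined_by_frame[OF D], rule ext)
    fix i j p assume ij: "i \<in> I" "j \<in> I"
    let ?s = "\<lambda>i j l. g p (\<D> (A i) (A j) p) (A l p)"
    have DT: "\<D> (A i) (A j) p \<in> TM p" if "i \<in> I" "j \<in> I" for i j
      by (intro vector_field_tangent connection_vector_field[OF D] frame_vector_field that)
    have t: "?s i j l - ?s j i l = structure_constant p i j l" if "i \<in> I" "j \<in> I" "l \<in> I" for i j l
    proof -
      have "lie_bracket (A i) (A j) p = 1 *\<^sub>R \<D> (A i) (A j) p + (-1) *\<^sub>R \<D> (A j) (A i) p"
        using tor[OF frame_vector_field[OF that(1)] frame_vector_field[OF that(2)]] by (simp add: fun_eq_iff)
      then show ?thesis
        unfolding structure_constant_def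
        using g_linear[OF DT[OF that(1,2)] DT[OF that(2,1)] frame_tangent[OF that(3)], of 1 "-1"]
        by (simp only:)
    qed
    have m: "?s i j l + ?s i l j = 0" if "i \<in> I" "j \<in> I" "l \<in> I" for i j l
    proof -
      have "(\<lambda>q. g q (A j q) (A l q)) = (\<lambda>q. G j l)" using that g_frame by blast
      then have "0 = ?s i j l + g p (A j p) (\<D> (A i) (A l) p)"
        using met[OF frame_vector_field[OF that(1)] frame_vector_field[OF that(2)] frame_vector_field[OF that(3)], of p]
          tangent_const[OF frame_tangent[OF that(1)]] by simp
      then show ?thesis using g_sym[OF frame_tangent[OF that(2)] DT[OF that(1,3)]] by simp
    qed
    \<comment> \<open>the linear algebra of the Koszul formula: torsion for the three cyclic index orders, metricity for each\<close>
    have solve: "a = (x - y + z) / 2"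
      if "a - b = x" "c - d = y" "u - w = z" "a + w = 0" "c + b = 0" "u + d = 0"
      for a b c d u w x y z :: real
    proof -
      have "x - y + z = a + a" using that by linarith
      then show ?thesis by simp
    qed
    show "\<D> (A i) (A j) p = christoffel i j p"
    proof (rule g_eqI[OF DT[OF ij] vector_field_tangent[OF christoffel_vector_field[OF ij]]])
      fix l assume l: "l \<in> I"
      show "?s i j l = g p (christoffel i j p) (A l p)"
        unfolding g_christoffel[OF l] koszul_def
        by (rule solve[OF t[OF ij l] t[OF ij(2) l ij(1)] t[OF l ij] m[OF ij l] m[OF ij(2) l ij(1)] m[OF l ij]])
    qed
  qed
qed

section \<open>Divergence and Laplacian in a frame\<close>

lemma divergence_in_frame:
  assumes D: "affine_connection M \<D>" and X: "X \<in> VF"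
  shows "divergence M \<D> X p = (\<Sum>k\<in>I. coef_at p k (\<D> (A k) X p))"
proof -
  let ?L = "covariant_derivative_at M \<D> X p"
  have L: "?L v = (\<Sum>i\<in>I. coef_at p i v *\<^sub>R \<D> (A i) X p)" if v: "v \<in> TM p" for v
  proof -
    let ?Z = "\<Sum>i\<in>I. (\<lambda>q. coef_at p i v) \<odot> A i"
    have "?Z \<in> VF" by (intro vector_field_sum vector_field_mult smooth_const frame_vector_field)
    moreover have "?Z p = (\<Sum>i\<in>I. coef_at p i v *\<^sub>R A i p)" by (subst sum_fun_apply) (simp add: vf_scale_def)
    then have "?Z p = v" by (rule trans) (rule frame_expansion[OF v, symmetric])
    ultimately have "\<exists>Z. Z \<in> VF \<and> Z p = v" by blast
    then have "(SOME Z. Z \<in> VF \<and> Z p = v) \<in> VF \<and> (SOME Z. Z \<in> VF \<and> Z p = v) p = v"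
      by (rule someI_ex)
    then show ?thesis
      unfolding covariant_derivative_at_def
      using connection_tensorial[OF D _ X, of "SOME Z. Z \<in> VF \<and> Z p = v" p] by simp
  qed
  have LA: "?L (A k p) = \<D> (A k) X p" if k: "k \<in> I" for k
    unfolding L[OF frame_tangent[OF k]] by (rule connection_tensorial[OF D frame_vector_field[OF k] X, symmetric])
  have "divergence M \<D> X p = (\<Sum>k\<in>I. coef_at p k (?L (A k p)))"
    unfolding divergence_def
  proof (rule trace_on_eq[where a="\<lambda>i. A i p" and c="coef_at p", OF tangent_subspace finite_I frame_tangent frame_expansion coef_at_linear])
    show "?L (A i p) \<in> TM p" if "i \<in> I" for i
      unfolding LA[OF that] by (intro vector_field_tangent connection_vector_field[OF D] frame_vector_field X that)
    show "?L v = (\<Sum>i\<in>I. coef_at p i v *\<^sub>R ?L (A i p))" if "v \<in> TM p" for v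
      unfolding L[OF that] by (intro sum.cong refl arg_cong2[where f="(*\<^sub>R)"] LA[symmetric])
  qed
  also have "\<dots> = (\<Sum>k\<in>I. coef_at p k (\<D> (A k) X p))"
    by (intro sum.cong refl) (simp only: LA)
  finally show ?thesis .
qed

lemma gradient_frame:
  assumes U: "U \<in> SF"
  shows "gradient M g U = (\<Sum>j\<in>I. (\<lambda>p. \<Sum>i\<in>I. ginv i j * (A i \<triangleright> U) p) \<odot> A j)"
proof
  fix p
  have "inverse_matrix_on I (\<lambda>i j. g p (A i p) (A j p)) ginv"
    using ginv unfolding inverse_matrix_on_def by (simp add: g_frame cong: sum.cong)
  from gradient_in_frame[where b="\<lambda>i. A i p" and p=p and f=U, OF g_riemannian finite_I frame_span this]
  have "gradient M g U p = (\<Sum>i\<in>I. \<Sum>j\<in>I. (ginv i j * A i p U) *\<^sub>R A j p)" .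
  also have "\<dots> = (\<Sum>j\<in>I. \<Sum>i\<in>I. (ginv i j * A i p U) *\<^sub>R A j p)" by (rule sum.swap)
  also have "\<dots> = (\<Sum>j\<in>I. ((\<lambda>p. \<Sum>i\<in>I. ginv i j * (A i \<triangleright> U) p) \<odot> A j) p)"
    by (simp only: scaleR_sum_left vf_scale_def vf_apply_def)
  also have "\<dots> = (\<Sum>j\<in>I. (\<lambda>p. \<Sum>i\<in>I. ginv i j * (A i \<triangleright> U) p) \<odot> A j) p"
    by (rule sum_fun_apply[symmetric])
  finally show "gradient M g U p = (\<Sum>j\<in>I. (\<lambda>p. \<Sum>i\<in>I. ginv i j * (A i \<triangleright> U) p) \<odot> A j) p" .
qed

text \<open>The divergence of \<open>\<Sum> h\<^sub>j A\<^sub>j\<close> is \<open>\<Sum> A\<^sub>j h\<^sub>j + \<Sum> h\<^sub>j div A\<^sub>j\<close>, and the hypothesis on traces says that the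
frame fields are divergence-free.\<close>

lemma generalised_laplacian_in_frame:
  assumes D: "affine_connection M \<D>" and U: "U \<in> SF"
    and trace: "\<And>j p. j \<in> I \<Longrightarrow> (\<Sum>k\<in>I. coef_at p k (\<D> (A k) (A j) p)) = 0"
  shows "generalised_laplacian M g \<D> U p = (\<Sum>i\<in>I. \<Sum>j\<in>I. ginv i j * (A i \<triangleright> A j \<triangleright> U) p)"
proof -
  define h where "h j = (\<lambda>p. \<Sum>i\<in>I. ginv i j * (A i \<triangleright> U) p)" for j
  have AU: "A i \<triangleright> U \<in> SF" if "i \<in> I" for i by (rule vector_field_smooth[OF frame_vector_field[OF that] U])
  have h: "h j \<in> SF" for j unfolding h_def by (intro smooth_sum smooth_mult smooth_const AU)
  have grad: "gradient M g U = (\<Sum>j\<in>I. h j \<odot> A j)" unfolding h_def by (rule gradient_frame[OF U])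
  have hA: "h j \<odot> A j \<in> VF" if "j \<in> I" for j by (intro vector_field_mult h frame_vector_field that)
  have DA: "\<D> (A k) (A j) p \<in> TM p" if "k \<in> I" "j \<in> I" for k j
    by (intro vector_field_tangent connection_vector_field[OF D] frame_vector_field that)
  have component: "coef_at p k (\<D> (A k) (gradient M g U) p)
      = A k p (h k) + (\<Sum>j\<in>I. h j p * coef_at p k (\<D> (A k) (A j) p))" if k: "k \<in> I" for k
  proof -
    have "\<D> (A k) (gradient M g U) = (\<Sum>j\<in>I. \<D> (A k) (h j \<odot> A j))"
      unfolding grad by (rule connection_sum_right[OF D frame_vector_field[OF k] hA])
    then have "\<D> (A k) (gradient M g U) p = (\<Sum>j\<in>I. \<D> (A k) (h j \<odot> A j) p)"
      by (simp only: sum_fun_apply[of "\<lambda>j. \<D> (A k) (h j \<odot> A j)" I p])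
    also have "\<dots> = (\<Sum>j\<in>I. A k p (h j) *\<^sub>R A j p + h j p *\<^sub>R \<D> (A k) (A j) p)"
    proof (rule sum.cong[OF refl])
      fix j assume j: "j \<in> I"
      show "\<D> (A k) (h j \<odot> A j) p = A k p (h j) *\<^sub>R A j p + h j p *\<^sub>R \<D> (A k) (A j) p"
        unfolding connection_leibniz[OF D h frame_vector_field[OF k] frame_vector_field[OF j]]
        by (simp add: vf_scale_def vf_apply_def fun_eq_iff)
    qed
    finally have "coef_at p k (\<D> (A k) (gradient M g U) p)
        = (\<Sum>j\<in>I. coef_at p k (A k p (h j) *\<^sub>R A j p + h j p *\<^sub>R \<D> (A k) (A j) p))"
      by (simp only: coef_at_sum subspace_add[OF tangent_subspace] subspace_scale[OF tangent_subspace] frame_tangent DA k)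
    also have "\<dots> = (\<Sum>j\<in>I. A k p (h j) * (if k = j then 1 else 0) + h j p * coef_at p k (\<D> (A k) (A j) p))"
      using k by (intro sum.cong refl)
        (simp only: coef_at_linear[OF frame_tangent subspace_scale[OF tangent_subspace DA]] coef_at_scale[OF DA] coef_at_frame)
    also have "\<dots> = A k p (h k) + (\<Sum>j\<in>I. h j p * coef_at p k (\<D> (A k) (A j) p))"
      unfolding sum.distrib sum_delta(2)[OF k, of "\<lambda>j. A k p (h j)"] ..
    finally show ?thesis .
  qed
  have gr: "gradient M g U \<in> VF" unfolding grad by (rule vector_field_sum[OF hA])
  have "generalised_laplacian M g \<D> U p = (\<Sum>k\<in>I. coef_at p k (\<D> (A k) (gradient M g U) p))"
    unfolding generalised_laplacian_def by (rule divergence_in_frame[OF D gr])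
  also have "\<dots> = (\<Sum>k\<in>I. A k p (h k)) + (\<Sum>k\<in>I. \<Sum>j\<in>I. h j p * coef_at p k (\<D> (A k) (A j) p))"
    by (simp only: component sum.distrib cong: sum.cong)
  also have "(\<Sum>k\<in>I. \<Sum>j\<in>I. h j p * coef_at p k (\<D> (A k) (A j) p))
      = (\<Sum>j\<in>I. h j p * (\<Sum>k\<in>I. coef_at p k (\<D> (A k) (A j) p)))"
    unfolding sum_distrib_left by (rule sum.swap)
  also have "\<dots> = 0" using trace by (simp cong: sum.cong)
  also have "(\<Sum>k\<in>I. A k p (h k)) = (\<Sum>k\<in>I. \<Sum>i\<in>I. ginv k i * (A k \<triangleright> A i \<triangleright> U) p)"
  proof (rule sum.cong[OF refl])
    fix k assume k: "k \<in> I"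
    have "A k p (h k) = (\<Sum>i\<in>I. A k p (\<lambda>p. ginv i k * (A i \<triangleright> U) p))"
      unfolding h_def by (rule tangent_sum[OF frame_tangent[OF k]]) (intro smooth_mult smooth_const AU)
    also have "\<dots> = (\<Sum>i\<in>I. ginv k i * (A k \<triangleright> A i \<triangleright> U) p)"
      using tangent_scale[OF frame_tangent[OF k] AU] ginv_sym[OF k]
      by (intro sum.cong refl) (simp add: vf_apply_def[of "A k"])
    finally show "A k p (h k) = (\<Sum>i\<in>I. ginv k i * (A k \<triangleright> A i \<triangleright> U) p)" .
  qed
  finally show ?thesis by simp
qed

text \<open>The trace of \<open>Z \<mapsto> [Z, A\<^sub>j]\<close>, which is the negative of the trace of \<open>ad A\<^sub>j\<close>.\<close>

definition ad_trace :: "'a \<Rightarrow> 'i \<Rightarrow> real"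
  where "ad_trace p j = (\<Sum>k\<in>I. coef_at p k (lie_bracket (A k) (A j) p))"

lemma lie_cartan_trace:
  assumes j: "j \<in> I"
  shows "(\<Sum>k\<in>I. coef_at p k (lie_cartan_connection M mul \<nu> (A k) (A j) p)) = \<nu> * ad_trace p j"
proof -
  have "coef_at p k (lie_cartan_connection M mul \<nu> (A k) (A j) p) = \<nu> * coef_at p k (lie_bracket (A k) (A j) p)"
    if k: "k \<in> I" for k
    unfolding lie_cartan_connection_eq frame_connection_frame[OF k j]
    by (subst scaleR_fun_apply) (intro coef_at_scale vector_field_tangent bracket_frame_vector_field k j)
  then show ?thesis by (simp add: ad_trace_def sum_distrib_left cong: sum.cong)
qed

text \<open>Contracting the Koszul formula with the symmetric matrix \<open>ginv\<close>: the last structure constant is skew in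
the contracted indices and drops out, and the first two contribute equally.\<close>

lemma levi_civita_trace:
  assumes j: "j \<in> I"
  shows "(\<Sum>k\<in>I. coef_at p k (levi_civita M g (A k) (A j) p)) = ad_trace p j"
proof -
  let ?C = "structure_constant p"
  have s1: "ad_trace p j = (\<Sum>k\<in>I. \<Sum>l\<in>I. ginv k l * ?C k j l)"
    by (simp add: ad_trace_def coef_at_def structure_constant_def)
  have s2: "(\<Sum>k\<in>I. \<Sum>l\<in>I. ginv k l * ?C j l k) = - ad_trace p j"
  proof -
    have "(\<Sum>k\<in>I. \<Sum>l\<in>I. ginv k l * ?C j l k) = (\<Sum>k\<in>I. \<Sum>l\<in>I. - (ginv l k * ?C l j k))"
    proof (intro sum.cong refl)
      fix k l assume "k \<in> I" "l \<in> I"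
      then show "ginv k l * ?C j l k = - (ginv l k * ?C l j k)"
        using structure_constant_skew[of l j k p] j ginv_sym[of k l] by simp
    qed
    also have "\<dots> = - (\<Sum>k\<in>I. \<Sum>l\<in>I. ginv l k * ?C l j k)" by (simp only: sum_negf)
    also have "(\<Sum>k\<in>I. \<Sum>l\<in>I. ginv l k * ?C l j k) = ad_trace p j" unfolding s1 by (rule sum.swap)
    finally show ?thesis .
  qed
  have s3: "(\<Sum>k\<in>I. \<Sum>l\<in>I. ginv k l * ?C l k j) = 0"
  proof -
    have "(\<Sum>k\<in>I. \<Sum>l\<in>I. ginv k l * ?C l k j) = (\<Sum>l\<in>I. \<Sum>k\<in>I. ginv k l * ?C l k j)" by (rule sum.swap)
    also have "\<dots> = (\<Sum>l\<in>I. \<Sum>k\<in>I. - (ginv l k * ?C k l j))"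
    proof (intro sum.cong refl)
      fix k l assume "k \<in> I" "l \<in> I"
      then show "ginv k l * ?C l k j = - (ginv l k * ?C k l j)"
        using structure_constant_skew[of k l j p] j ginv_sym[of k l] by simp
    qed
    also have "\<dots> = - (\<Sum>k\<in>I. \<Sum>l\<in>I. ginv k l * ?C l k j)" by (simp only: sum_negf)
    finally show ?thesis by linarith
  qed
  have "(\<Sum>k\<in>I. coef_at p k (levi_civita M g (A k) (A j) p)) = (\<Sum>k\<in>I. \<Sum>l\<in>I. ginv k l * koszul p k j l)"
    unfolding levi_civita_eq using j
    by (simp add: frame_connection_frame coef_at_def g_christoffel cong: sum.cong)
  also have "\<dots> = ((\<Sum>k\<in>I. \<Sum>l\<in>I. ginv k l * ?C k j l) - (\<Sum>k\<in>I. \<Sum>l\<in>I. ginv k l * ?C j l k)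
      + (\<Sum>k\<in>I. \<Sum>l\<in>I. ginv k l * ?C l k j)) / 2"
    unfolding koszul_def by (simp add: sum.distrib sum_subtractf sum_divide_distrib add_divide_distrib
        diff_divide_distrib algebra_simps)
  finally show ?thesis unfolding s2 s3 s1[symmetric] by simp
qed

lemma laplacians_coincide:
  assumes trace: "\<And>p j. j \<in> I \<Longrightarrow> ad_trace p j = 0" and U: "U \<in> SF"
  shows "lie_cartan_laplacian M mul g \<nu> U = (\<lambda>p. \<Sum>i\<in>I. \<Sum>j\<in>I. ginv i j * (A i \<triangleright> A j \<triangleright> U) p)"
    and "laplace_beltrami M g U = (\<lambda>p. \<Sum>i\<in>I. \<Sum>j\<in>I. ginv i j * (A i \<triangleright> A j \<triangleright> U) p)"
proof -
  have "affine_connection M (lie_cartan_connection M mul \<nu>)"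
    unfolding lie_cartan_connection_eq
    by (intro affine_frame_connection vector_field_scaleR bracket_frame_vector_field)
  then show "lie_cartan_laplacian M mul g \<nu> U = (\<lambda>p. \<Sum>i\<in>I. \<Sum>j\<in>I. ginv i j * (A i \<triangleright> A j \<triangleright> U) p)"
    unfolding lie_cartan_laplacian_def using lie_cartan_trace trace
    by (intro ext generalised_laplacian_in_frame U) auto
  have "affine_connection M (levi_civita M g)"
    unfolding levi_civita_eq by (intro affine_frame_connection christoffel_vector_field)
  then show "laplace_beltrami M g U = (\<lambda>p. \<Sum>i\<in>I. \<Sum>j\<in>I. ginv i j * (A i \<triangleright> A j \<triangleright> U) p)"
    unfolding laplace_beltrami_def using levi_civita_trace trace
    by (intro ext generalised_laplacian_in_frame U) auto
qed

end

section \<open>Invariant integration\<close>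

context smooth_manifold
begin

lemma field_vanishes_outside:
  assumes X: "X \<in> VF" and f: "f \<in> SF"
    and K: "compact K" "\<And>q. q \<notin> K \<Longrightarrow> f q = 0" and p: "p \<notin> K"
  shows "(X \<triangleright> f) p = 0"
  unfolding vf_apply_def
  using K p compact_imp_closed[OF K(1)]
  by (intro tangent_local[OF vector_field_tangent[OF X] f, of "- K"]) auto

lemma integrable_compact_support:
  fixes f :: "'a \<Rightarrow> real"
  assumes sets: "sets \<mu> = sets borel" and fin: "\<forall>K. compact K \<longrightarrow> emeasure \<mu> K < \<infinity>"
    and f: "continuous_on UNIV f" and K: "compact K" "\<And>q. q \<notin> K \<Longrightarrow> f q = 0"
  shows "integrable \<mu> f"
proof -
  obtain C where C: "\<And>x. x \<in> K \<Longrightarrow> norm (f x) \<le> C"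
    using compact_imp_bounded[OF compact_continuous_image[OF continuous_on_subset[OF f] K(1)]]
    unfolding bounded_iff by auto
  have "K \<in> sets \<mu>" using compact_imp_closed[OF K(1)] sets by simp
  then have "integrable \<mu> (\<lambda>x. C * indicator K x)"
    using fin[rule_format, OF K(1)] by (intro integrable_mult_right) (simp add: integrable_indicator_iff)
  moreover have "f \<in> borel_measurable \<mu>"
    using borel_measurable_continuous_onI[OF f] measurable_cong_sets[OF sets refl] by blast
  moreover have "norm (f x) \<le> norm (C * indicator K x)" for x
    using C[of x] K(2)[of x] by (cases "x \<in> K") auto
  then have "AE x in \<mu>. norm (f x) \<le> norm (C * indicator K x)" by simp
  ultimately show ?thesis by (rule Bochner_Integration.integrable_bound)
qed

end

context lie_group
begin

lemma continuous_translate: "continuous_on UNIV (\<lambda>x. mul h x)" "continuous_on UNIV (\<lambda>x. mul x h)"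
proof -
  have "continuous_on UNIV (\<lambda>x. (h, x))" "continuous_on UNIV (\<lambda>x. (x, h))" by (intro continuous_intros)+
  from continuous_on_compose2[OF continuous_mul this(1)] continuous_on_compose2[OF continuous_mul this(2)]
  show "continuous_on UNIV (\<lambda>x. mul h x)" "continuous_on UNIV (\<lambda>x. mul x h)" by simp_all
qed

lemma continuous_iv: "continuous_on UNIV iv"
  using smooth_iv unfolding smooth_map_def by blast

lemma integral_right_translate:
  fixes f :: "'a \<Rightarrow> real"
  assumes sets: "sets \<mu> = sets borel" and inv: "distr \<mu> borel (\<lambda>x. mul x h) = \<mu>"
    and f: "continuous_on UNIV f"
  shows "(\<integral>x. f (mul x h) \<partial>\<mu>) = (\<integral>x. f x \<partial>\<mu>)"
proof -
  have "(\<lambda>x. mul x h) \<in> measurable \<mu> borel"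
    using borel_measurable_continuous_onI[OF continuous_translate(2)] measurable_cong_sets[OF sets refl] by blast
  from integral_distr[OF this borel_measurable_continuous_onI[OF f]]
  show ?thesis by (simp add: inv)
qed

text \<open>The field generated by \<open>v\<close> differentiates along right translations by a curve \<open>\<gamma>\<close> through the identity
with velocity \<open>v\<close>; a straight line in a chart will do. By right invariance the difference quotients of
\<open>f\<close> along \<open>\<gamma>\<close> have integral zero, and they converge dominatedly, being supported in a common compact
set and bounded there by the mean value theorem.\<close>

lemma integral_left_field_eq_0:
  assumes sets: "sets \<mu> = sets borel" and fin: "\<forall>K. compact K \<longrightarrow> emeasure \<mu> K < \<infinity>"
    and inv: "\<And>h. distr \<mu> borel (\<lambda>x. mul x h) = \<mu>"
    and v: "v \<in> TM e" and f: "f \<in> SF"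
    and K: "compact K" "\<And>q. q \<notin> K \<Longrightarrow> f q = 0"
  shows "(\<integral>x. left_field v x f \<partial>\<mu>) = 0"
proof -
  obtain U \<phi> where U: "(U, \<phi>) \<in> M" "e \<in> U" by (rule chart_at)
  obtain w where w: "\<And>f. f \<in> SF \<Longrightarrow>
      v f = frechet_derivative (\<lambda>x. f (inv_into U \<phi> x)) (at (\<phi> e)) w"
    using tangent_directional[OF v U] by blast
  let ?y = "\<lambda>t. \<phi> e + t *\<^sub>R w"
  define J where "J = {t. ?y t \<in> \<phi> ` U}"
  define \<gamma> where "\<gamma> t = inv_into U \<phi> (?y t)" for t
  define \<psi> where "\<psi> x t = frechet_derivative (\<lambda>y. f (mul x (inv_into U \<phi> y))) (at (?y t)) w" for x t
  have cy: "continuous_on A ?y" for A by (intro continuous_intros)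
  have J: "open J"
    using open_vimage[OF chart_image_open[OF U(1)] cy[of UNIV]] by (simp add: J_def vimage_def)
  have "0 \<in> J" using U by (simp add: J_def)
  then obtain r where r: "r > 0" "cball 0 r \<subseteq> J" using J open_contains_cball by blast
  let ?S = "{-r..r}"
  have SJ: "?S \<subseteq> J" using r by (auto simp: subset_iff dist_real_def)
  have \<gamma>0: "\<gamma> 0 = e" using chart_inv[OF U] by (simp add: \<gamma>_def)
  have c\<gamma>: "continuous_on ?S \<gamma>"
    unfolding \<gamma>_def using SJ
    by (intro continuous_on_compose2[OF chart_inverse_continuous[OF U(1)] cy]) (auto simp: J_def)
  have der: "((\<lambda>t. f (mul x (\<gamma> t))) has_real_derivative \<psi> x t) (at t)" if "t \<in> J" for x t
    using directional_derivative[OF smooth_functionsD[OF smooth_left_translate[OF f] U(1)], of "\<phi> e" t w] that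
    by (simp add: J_def \<gamma>_def \<psi>_def)
  have \<psi>0: "\<psi> x 0 = left_field v x f" for x
    using w[OF smooth_left_translate[OF f]] f by (simp add: \<psi>_def left_field_def)
  have c\<psi>: "continuous_on (UNIV \<times> ?S) (\<lambda>(x, t). \<psi> x t)"
  proof (intro continuous_at_imp_continuous_on ballI)
    fix z :: "'a \<times> real" assume z: "z \<in> UNIV \<times> ?S"
    obtain V \<kappa> where V: "(V, \<kappa>) \<in> M" "fst z \<in> V" by (rule chart_at)
    let ?F = "\<lambda>z. f (mul (inv_into V \<kappa> (fst z)) (inv_into U \<phi> (snd z)))"
    have F: "smooth_on (\<kappa> ` V \<times> \<phi> ` U) ?F" by (rule smooth_mul_in_charts[OF f V(1) U(1)])
    have "continuous_on (V \<times> J) (\<lambda>z. frechet_derivative ?F (at (\<kappa> (fst z), ?y (snd z))) (0, w))"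
    proof (rule continuous_on_compose2[OF smooth_on_continuous_on[OF smooth_on_frechet_derivative[OF F]]])
      show "continuous_on (V \<times> J) (\<lambda>z. (\<kappa> (fst z), ?y (snd z)))"
        by (intro continuous_on_Pair continuous_on_compose2[OF chart_continuous[OF V(1)]] continuous_intros) auto
      show "(\<lambda>z. (\<kappa> (fst z), ?y (snd z))) ` (V \<times> J) \<subseteq> \<kappa> ` V \<times> \<phi> ` U"
        by (auto simp: J_def)
    qed
    then have "continuous_on (V \<times> J) (\<lambda>(x, t). \<psi> x t)"
    proof (rule continuous_on_eq)
      fix z assume "z \<in> V \<times> J"
      then show "frechet_derivative ?F (at (\<kappa> (fst z), ?y (snd z))) (0, w) = (case z of (x, t) \<Rightarrow> \<psi> x t)"
        using partial_derivative_snd[OF F, of "\<kappa> (fst z)" "?y (snd z)" w] chart_inv[OF V(1)]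
        by (auto simp: J_def \<psi>_def)
    qed
    moreover have "open (V \<times> J)" using chart_open[OF V(1)] J by (rule open_Times)
    moreover have "z \<in> V \<times> J" using z V SJ by (cases z) auto
    ultimately show "isCont (\<lambda>(x, t). \<psi> x t) z" using continuous_on_eq_continuous_at by blast
  qed
  \<comment> \<open>contains every \<open>x\<close> with \<open>f (x \<gamma>(t)) \<noteq> 0\<close> for some \<open>t\<close>\<close>
  define K' where "K' = (\<lambda>(x, t). mul x (iv (\<gamma> t))) ` (K \<times> ?S)"
  have K': "compact K'"
    unfolding K'_def
  proof (rule compact_continuous_image)
    have "continuous_on (K \<times> ?S) (\<lambda>z. (fst z, iv (\<gamma> (snd z))))"
      by (intro continuous_on_Pair continuous_on_compose2[OF continuous_iv] continuous_on_compose2[OF c\<gamma>]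
          continuous_intros) auto
    from continuous_on_compose2[OF continuous_mul this]
    show "continuous_on (K \<times> ?S) (\<lambda>(x, t). mul x (iv (\<gamma> t)))" by (simp add: case_prod_unfold)
    show "compact (K \<times> ?S)" using K by (intro compact_Times) auto
  qed
  have zero: "f (mul x (\<gamma> t)) = 0" if "x \<notin> K'" "t \<in> ?S" for x t
  proof (rule K(2), rule notI)
    assume "mul x (\<gamma> t) \<in> K"
    moreover have "mul (mul x (\<gamma> t)) (iv (\<gamma> t)) = x" by (simp add: assoc)
    ultimately have "x \<in> K'" unfolding K'_def using that(2) by (force intro!: image_eqI[of _ _ "(mul x (\<gamma> t), t)"])
    then show False using that by blast
  qed
  have "compact ((\<lambda>(x, t). \<psi> x t) ` (K' \<times> ?S))"
    using K' by (intro compact_continuous_image continuous_on_subset[OF c\<psi>] compact_Times) auto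
  from compact_imp_bounded[OF this]
  obtain C where "\<forall>z\<in>(\<lambda>(x, t). \<psi> x t) ` (K' \<times> ?S). norm z \<le> C" unfolding bounded_iff by blast
  then have C: "\<bar>\<psi> x t\<bar> \<le> C" if "x \<in> K'" "t \<in> ?S" for x t using that by force
  define q where "q n x = (f (mul x (\<gamma> (r / Suc n))) - f x) / (r / Suc n)" for n x
  have tn: "r / Suc n \<in> ?S" "r / Suc n > 0" for n
  proof -
    show pos: "r / Suc n > 0" using r by simp
    have "r / Suc n \<le> r / 1" using r by (intro divide_left_mono) auto
    moreover have "- r \<le> r / Suc n" using pos r(1) by linarith
    ultimately show "r / Suc n \<in> ?S" unfolding atLeastAtMost_iff by simp
  qed
  have bound: "norm (q n x) \<le> C * indicator K' x" for n x
  proof (cases "x \<in> K'")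
    case False
    then show ?thesis
      using zero[OF False tn(1)] zero[OF False, of 0] r \<gamma>0 by (simp add: q_def)
  next
    case True
    have "\<exists>z. 0 < z \<and> z < r / Suc n \<and>
        f (mul x (\<gamma> (r / Suc n))) - f (mul x (\<gamma> 0)) = (r / Suc n - 0) * \<psi> x z"
      using tn[of n] SJ by (intro MVT2 der) auto
    then obtain z where z: "0 < z" "z < r / Suc n" "f (mul x (\<gamma> (r / Suc n))) - f x = (r / Suc n) * \<psi> x z"
      using \<gamma>0 by auto
    then have "q n x = \<psi> x z" unfolding q_def z(3) using r(1) by simp
    then show ?thesis using C[OF True, of z] z tn[of n] True by simp
  qed
  have lim: "(\<lambda>n. q n x) \<longlonglongrightarrow> left_field v x f" for x
  proof -
    have "((\<lambda>h. (f (mul x (\<gamma> (0 + h))) - f (mul x (\<gamma> 0))) / h) \<longlongrightarrow> \<psi> x 0) (at 0)"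
      using der[OF \<open>0 \<in> J\<close>, of x] by (simp add: DERIV_def)
    moreover have "filterlim (\<lambda>n. r / Suc n) (at 0) sequentially"
    proof -
      have "(\<lambda>n. r / Suc n) \<longlonglongrightarrow> 0" by (rule LIMSEQ_Suc[OF lim_const_over_n])
      then show ?thesis using r unfolding filterlim_at by simp
    qed
    ultimately have "(\<lambda>n. (f (mul x (\<gamma> (0 + r / Suc n))) - f (mul x (\<gamma> 0))) / (r / Suc n)) \<longlonglongrightarrow> \<psi> x 0"
      by (rule filterlim_compose)
    then show ?thesis by (simp add: q_def \<psi>0 \<gamma>0)
  qed
  have coef_at: "continuous_on UNIV f" by (rule smooth_functions_continuous[OF f])
  have ct: "continuous_on UNIV (\<lambda>x. f (mul x h))" for h
    by (rule smooth_functions_continuous[OF smooth_right_translate[OF f]])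
  have meas: "u \<in> borel_measurable \<mu>" if "continuous_on UNIV u" for u :: "'a \<Rightarrow> real"
    using borel_measurable_continuous_onI[OF that] measurable_cong_sets[OF sets refl] by blast
  have K'm: "K' \<in> sets \<mu>" using compact_imp_closed[OF K'] sets by simp
  have dom: "integrable \<mu> (\<lambda>x. C * indicator K' x)"
    using fin[rule_format, OF K'] K'm by (intro integrable_mult_right) (simp add: integrable_indicator_iff)
  have "(\<lambda>n. \<integral>x. q n x \<partial>\<mu>) \<longlonglongrightarrow> (\<integral>x. left_field v x f \<partial>\<mu>)"
  proof (rule integral_dominated_convergence[OF _ _ dom])
    show "(\<lambda>x. left_field v x f) \<in> borel_measurable \<mu>"
      using meas[OF smooth_functions_continuous[OF left_field_smooth[OF v f]]] by (simp add: vf_apply_def)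
    show "q n \<in> borel_measurable \<mu>" for n
      unfolding q_def by (intro borel_measurable_divide borel_measurable_diff meas coef_at ct borel_measurable_const)
    show "AE x in \<mu>. (\<lambda>n. q n x) \<longlonglongrightarrow> left_field v x f" using lim by simp
    show "AE x in \<mu>. norm (q n x) \<le> C * indicator K' x" for n using bound by simp
  qed
  moreover have "(\<integral>x. q n x \<partial>\<mu>) = 0" for n
  proof -
    have if': "integrable \<mu> f" by (rule integrable_compact_support[OF sets fin coef_at K])
    have "integrable \<mu> (\<lambda>x. f (mul x (\<gamma> (r / Suc n))))"
      by (rule integrable_compact_support[OF sets fin ct K']) (rule zero[OF _ tn(1)])
    then show ?thesis
      unfolding q_def using if' integral_right_translate[OF sets inv coef_at] by simp
  qed
  ultimately have "(\<lambda>n. 0) \<longlonglongrightarrow> (\<integral>x. left_field v x f \<partial>\<mu>)" by simp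
  from LIMSEQ_unique[OF this tendsto_const] show ?thesis .
qed

text \<open>By second countability, countably many translates of \<open>W\<close> cover the group; if \<open>W\<close> were null, so would be
the whole group.\<close>

lemma open_nonnull:
  assumes sets: "sets \<mu> = sets borel" and nz: "emeasure \<mu> UNIV \<noteq> 0"
    and inv: "\<And>h. distr \<mu> borel (\<lambda>x. mul h x) = \<mu>"
    and W: "open W" "p \<in> W"
  shows "emeasure \<mu> W \<noteq> 0"
proof
  assume 0: "emeasure \<mu> W = 0"
  let ?t = "\<lambda>h. (\<lambda>x. mul h x) -` W"
  have m: "(\<lambda>x. mul h x) \<in> measurable \<mu> borel" for h
    using borel_measurable_continuous_onI[OF continuous_translate(1)] measurable_cong_sets[OF sets refl] by blast
  have sp: "space \<mu> = UNIV" using sets_eq_imp_space_eq[OF sets] by simp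
  have op: "open (?t h)" for h by (rule open_vimage[OF W(1) continuous_translate(1)])
  have null: "?t h \<in> null_sets \<mu>" for h
  proof -
    have "emeasure \<mu> (?t h) = emeasure (distr \<mu> borel (\<lambda>x. mul h x)) W"
      using W by (subst emeasure_distr[OF m]) (auto simp: sp)
    then show ?thesis using 0 inv op sets by (auto simp: null_sets_def)
  qed
  obtain F where F: "F \<subseteq> range ?t" "countable F" "\<Union>F = \<Union>(range ?t)"
    using Lindelof[of "range ?t"] op by blast
  have "x \<in> ?t (mul p (iv x))" for x using W by (simp add: assoc)
  then have "\<Union>(range ?t) = UNIV" by blast
  moreover have "\<Union>F \<in> null_sets \<mu>"
    using null_sets_UN'[OF F(2), of "\<lambda>x. x"] F(1) null by auto
  ultimately show False using F nz by (auto simp: null_sets_def)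
qed

end

context lie_frame
begin

context
  fixes \<mu> :: "'a measure"
  assumes sets: "sets \<mu> = sets borel" and fin: "\<forall>K. compact K \<longrightarrow> emeasure \<mu> K < \<infinity>"
    and nonzero: "emeasure \<mu> UNIV \<noteq> 0"
    and left: "\<And>h. distr \<mu> borel (\<lambda>x. mul h x) = \<mu>"
    and right: "\<And>h. distr \<mu> borel (\<lambda>x. mul x h) = \<mu>"
begin

text \<open>Integration by parts. For a compactly supported \<open>f\<close>, the functions \<open>A\<^sub>i (a\<^sub>i f)\<close> and \<open>Y f\<close> have integral zero
by right and left invariance of the measure, where \<open>a\<^sub>i\<close> are the coefficients of \<open>Y\<close>. Hence
\<open>h = \<Sum> A\<^sub>i a\<^sub>i\<close> is orthogonal to all such \<open>f\<close>, in particular to its own product with a bump function, and so it vanishes because nonempty open sets are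
not null.\<close>

lemma right_field_divergence_free:
  assumes v: "v \<in> TM e"
  shows "(\<Sum>i\<in>I. A i p (coef (right_field v) i)) = 0"
proof (rule ccontr)
  let ?Y = "right_field v"
  have Y: "?Y \<in> VF" by (rule right_field_vector_field[OF v])
  define h where "h = (\<lambda>p. \<Sum>i\<in>I. (A i \<triangleright> coef ?Y i) p)"
  assume "(\<Sum>i\<in>I. A i p (coef ?Y i)) \<noteq> 0"
  then have hp: "h p \<noteq> 0" by (simp add: h_def vf_apply_def)
  have h: "h \<in> SF"
    unfolding h_def by (intro smooth_sum vector_field_smooth frame_vector_field coef_smooth Y)
  obtain \<rho> K where \<rho>: "\<rho> \<in> SF" "\<And>q. \<rho> q \<ge> 0" "\<rho> p > 0" and K: "compact K" "\<And>q. q \<notin> K \<Longrightarrow> \<rho> q = 0"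
    using bump[of UNIV p] by auto
  define f where "f q = \<rho> q * h q" for q
  have f: "f \<in> SF" unfolding f_def by (intro smooth_mult \<rho> h)
  have fK: "f q = 0" if "q \<notin> K" for q using K(2)[OF that] by (simp add: f_def)
  have af: "(\<lambda>q. coef ?Y i q * f q) \<in> SF" for i by (intro smooth_mult coef_smooth Y f)
  have intc: "integrable \<mu> u" if "u \<in> SF" "\<And>q. q \<notin> K \<Longrightarrow> u q = 0" for u
    by (rule integrable_compact_support[OF sets fin smooth_functions_continuous[OF that(1)] K(1) that(2)])
  have iA: "integrable \<mu> (A i \<triangleright> (\<lambda>q. coef ?Y i q * f q))" if "i \<in> I" for i
    by (intro intc vector_field_smooth frame_vector_field that af
        field_vanishes_outside[OF frame_vector_field[OF that] af K(1)]) (simp_all add: fK)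
  have iY: "integrable \<mu> (?Y \<triangleright> f)"
    by (intro intc vector_field_smooth Y f field_vanishes_outside[OF Y f K(1)]) (simp_all add: fK)
  have ih: "integrable \<mu> (\<lambda>q. f q * h q)" by (intro intc smooth_mult f h) (simp add: fK)
  have zA: "(\<integral>x. (A i \<triangleright> (\<lambda>q. coef ?Y i q * f q)) x \<partial>\<mu>) = 0" if i: "i \<in> I" for i
  proof -
    have "A i = left_field (A i e)" by (rule left_invariant_eq_left_field[OF frame_left_invariant[OF i]])
    then have "(A i \<triangleright> (\<lambda>q. coef ?Y i q * f q)) = (\<lambda>x. left_field (A i e) x (\<lambda>q. coef ?Y i q * f q))"
      unfolding vf_apply_def by metis
    then show ?thesis
      using integral_left_field_eq_0[OF sets fin right frame_tangent[OF i] af K(1)] fK by simp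
  qed
  have zY: "(\<integral>x. (?Y \<triangleright> f) x \<partial>\<mu>) = 0"
    using lie_group.integral_left_field_eq_0[OF opposite_lie_group sets fin left v f K(1) fK]
    by (simp add: opposite_left_field vf_apply_def)
  have split: "(\<Sum>i\<in>I. (A i \<triangleright> (\<lambda>q. coef ?Y i q * f q)) x) = (?Y \<triangleright> f) x + f x * h x" for x
  proof -
    have "(A i \<triangleright> (\<lambda>q. coef ?Y i q * f q)) x = coef ?Y i x * A i x f + f x * (A i \<triangleright> coef ?Y i) x"
      if "i \<in> I" for i
      using tangent_mult[OF frame_tangent[OF that] coef_smooth[OF Y] f] by (simp add: vf_apply_def)
    then show ?thesis
      using field_expansion_at[OF Y, of x f]
      by (simp add: sum.distrib h_def sum_distrib_left vf_apply_def[of ?Y] cong: sum.cong)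
  qed
  have "(\<integral>x. (?Y \<triangleright> f) x + f x * h x \<partial>\<mu>) = (\<Sum>i\<in>I. \<integral>x. (A i \<triangleright> (\<lambda>q. coef ?Y i q * f q)) x \<partial>\<mu>)"
    unfolding split[symmetric] by (rule Bochner_Integration.integral_sum[OF iA])
  also have "\<dots> = 0" using zA by simp
  finally have "(\<integral>x. f x * h x \<partial>\<mu>) = 0"
    using Bochner_Integration.integral_add[OF iY ih] zY by simp
  moreover have "f x * h x = \<rho> x * (h x)\<^sup>2" for x by (simp add: f_def power2_eq_square)
  ultimately have "AE x in \<mu>. f x * h x = 0"
    using integral_nonneg_eq_0_iff_AE[OF ih] \<rho>(2) by simp
  moreover have "open {x. f x * h x \<noteq> 0}"
    using smooth_functions_continuous[OF smooth_mult[OF f h]]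
    by (intro open_Collect_neq continuous_on_const)
  moreover have "space \<mu> = UNIV" using sets_eq_imp_space_eq[OF sets] by simp
  ultimately have "emeasure \<mu> {x. f x * h x \<noteq> 0} = 0"
    using AE_iff_measurable[of "{x. f x * h x \<noteq> 0}" \<mu> "\<lambda>x. f x * h x = 0"] sets by simp
  moreover have "p \<in> {x. f x * h x \<noteq> 0}" using hp \<rho>(3) by (simp add: f_def)
  ultimately show False
    using open_nonnull[OF sets nonzero left \<open>open {x. f x * h x \<noteq> 0}\<close>] by blast
qed

text \<open>Choose the right-invariant field \<open>Y\<close> that agrees with \<open>A\<^sub>j\<close> at \<open>p\<close>, and let \<open>a\<^sub>k\<close> be its coefficients. The
\<open>i\<close>-th component of \<open>[A\<^sub>i, Y] = 0\<close> at \<open>p\<close> is \<open>A\<^sub>i a\<^sub>i + [A\<^sub>i, A\<^sub>j]\<^sub>i = 0\<close>; summing over \<open>i\<close>, the first terms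
add up to zero because \<open>Y\<close> is divergence-free.\<close>

lemma ad_trace_eq_0:
  assumes j: "j \<in> I"
  shows "ad_trace p j = 0"
proof -
  define v where "v = differential M (\<lambda>x. mul x (iv p)) (A j p)"
  have v: "v \<in> TM e"
    using lie_group.differential_left_translation[OF opposite_lie_group frame_tangent[OF j], of "iv p" p]
    by (simp add: v_def)
  let ?Y = "right_field v"
  have Y: "?Y \<in> VF" by (rule right_field_vector_field[OF v])
  have Yp: "?Y p = A j p"
  proof
    fix f
    show "?Y p f = A j p f"
      using smooth_right_translate[of f p] tangent_nonsmooth[OF frame_tangent[OF j], of f p]
      by (simp add: right_field_def v_def differential_def assoc)
  qed
  have comm: "(\<Sum>k\<in>I. A i p (coef ?Y k) *\<^sub>R A k p) + (\<Sum>k\<in>I. coef ?Y k p *\<^sub>R lie_bracket (A i) (A k) p) = 0"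
    if i: "i \<in> I" for i
  proof -
    have "lie_bracket (A i) ?Y p = 0 p"
      using left_right_commute[OF frame_tangent[OF i] v] left_invariant_eq_left_field[OF frame_left_invariant[OF i]]
      by metis
    moreover have "?Y p (coef (A i) k) = 0" if "k \<in> I" for k
      using coef_frame[OF i that] tangent_const[OF vector_field_tangent[OF Y]] by simp
    then have "(\<Sum>k\<in>I. (A i p (coef ?Y k) - ?Y p (coef (A i) k)) *\<^sub>R A k p)
        = (\<Sum>k\<in>I. A i p (coef ?Y k) *\<^sub>R A k p)" by (intro sum.cong refl) simp
    moreover have "(\<Sum>l\<in>I. \<Sum>k\<in>I. (coef (A i) l p * coef ?Y k p) *\<^sub>R lie_bracket (A l) (A k) p)
        = (\<Sum>k\<in>I. coef ?Y k p *\<^sub>R lie_bracket (A i) (A k) p)"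
    proof -
      have "(\<Sum>l\<in>I. \<Sum>k\<in>I. (coef (A i) l p * coef ?Y k p) *\<^sub>R lie_bracket (A l) (A k) p)
          = (\<Sum>l\<in>I. if l = i then (\<Sum>k\<in>I. coef ?Y k p *\<^sub>R lie_bracket (A l) (A k) p) else 0)"
        using i by (intro sum.cong refl) (auto simp: coef_frame intro!: sum.cong)
      then show ?thesis by (simp only: sum.delta[OF finite_I] i if_True)
    qed
    ultimately show ?thesis
      using bracket_in_frame[OF frame_vector_field[OF i] Y, of p] by (simp only: zero_fun_apply)
  qed
  have bT: "lie_bracket (A i) (A k) p \<in> TM p" if "i \<in> I" "k \<in> I" for i k
    by (intro vector_field_tangent bracket_frame_vector_field that)
  have "A i p (coef ?Y i) + coef_at p i (lie_bracket (A i) (A j) p) = 0" if i: "i \<in> I" for i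
  proof -
    have s1: "(\<Sum>k\<in>I. A i p (coef ?Y k) *\<^sub>R A k p) \<in> TM p"
      by (intro subspace_sum subspace_scale tangent_subspace frame_tangent)
    have s2: "(\<Sum>k\<in>I. coef ?Y k p *\<^sub>R lie_bracket (A i) (A k) p) \<in> TM p"
      by (intro subspace_sum subspace_scale tangent_subspace bT i)
    have "0 = coef_at p i (\<Sum>k\<in>I. A i p (coef ?Y k) *\<^sub>R A k p)
        + coef_at p i (\<Sum>k\<in>I. coef ?Y k p *\<^sub>R lie_bracket (A i) (A k) p)"
      unfolding coef_at_add[OF s1 s2, symmetric] comm[OF i] coef_at_zero ..
    also have "coef_at p i (\<Sum>k\<in>I. A i p (coef ?Y k) *\<^sub>R A k p) = (\<Sum>k\<in>I. A i p (coef ?Y k) * (if i = k then 1 else 0))"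
      using i frame_tangent by (simp add: coef_at_sum subspace_scale[OF tangent_subspace] coef_at_scale coef_at_frame cong: sum.cong)
    also have "\<dots> = A i p (coef ?Y i)" by (rule sum_delta(2)[OF i])
    also have "coef_at p i (\<Sum>k\<in>I. coef ?Y k p *\<^sub>R lie_bracket (A i) (A k) p)
        = (\<Sum>k\<in>I. (if k = j then 1 else 0) * coef_at p i (lie_bracket (A i) (A k) p))"
      using i j bT by (simp add: coef_at_sum subspace_scale[OF tangent_subspace] coef_at_scale coef_def Yp coef_at_frame cong: sum.cong)
    also have "\<dots> = coef_at p i (lie_bracket (A i) (A j) p)"
      by (rule sum_delta(3)[OF j])
    finally show ?thesis by simp
  qed
  then have "(\<Sum>i\<in>I. A i p (coef ?Y i) + coef_at p i (lie_bracket (A i) (A j) p)) = 0" by simp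
  then show ?thesis
    unfolding sum.distrib right_field_divergence_free[OF v] ad_trace_def by simp
qed

end

end

section \<open>The Laplacians of a unimodular group\<close>

theorem corollary1:
  fixes M :: "('a::{t2_space, second_countable_topology}, 'e::real_inner) chart set"
    and mul :: "'a \<Rightarrow> 'a \<Rightarrow> 'a" and e :: 'a and iv :: "'a \<Rightarrow> 'a"
    and g :: "'a \<Rightarrow> 'a tangent \<Rightarrow> 'a tangent \<Rightarrow> real" and \<nu> :: real
    and I :: "'i set" and A :: "'i \<Rightarrow> 'a vfield" and ginv :: "'i \<Rightarrow> 'i \<Rightarrow> real"
  assumes "lie_group M mul e iv"
    and "connected (UNIV :: 'a set)"
    and "unimodular mul"
    and "left_invariant_metric M mul g"
    and "left_invariant_frame M mul I A"
    and "inverse_matrix_on I (metric_components g A e) ginv"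
  shows "\<forall>U\<in>smooth_functions M.
    lie_cartan_laplacian M mul g \<nu> U = (\<lambda>p. \<Sum>i\<in>I. \<Sum>j\<in>I. ginv i j * (A i \<triangleright> A j \<triangleright> U) p) \<and>
    (\<lambda>p. \<Sum>i\<in>I. \<Sum>j\<in>I. ginv i j * (A i \<triangleright> A j \<triangleright> U) p) = laplace_beltrami M g U"
proof -
  interpret lie_frame M mul e iv g I A ginv
    using assms(1,4-6) by (intro lie_frame.intro lie_frame_axioms.intro)
  obtain \<mu> where \<mu>: "left_haar_measure mul \<mu>" "\<And>h. distr \<mu> borel (\<lambda>x. mul x h) = \<mu>"
    using assms(3) unfolding unimodular_def by blast
  have "ad_trace p j = 0" if "j \<in> I" for p j
    using ad_trace_eq_0[of \<mu>, OF _ _ _ _ \<mu>(2) that] \<mu>(1) unfolding left_haar_measure_def by simp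
  then show ?thesis using laplacians_coincide by simp
qed

end
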